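(* Let $G$ be an infinite finitely generated group and $\mathcal C$ a set of pattern codings that is recursively enumerable with oracle $\mathtt{WP}(G)$. If $p(\mathcal C)$ is closed by extensions, then $p(\mathcal C)$ is $G$-recursively enumerable.
   Context: Let $S\subset G$ be a finite generating set closed under inverses and containing $1_G$. Words in $S^*$ represent elements of $G$; write $u=_G v$ if they represent the same element. $\mathtt{WP}(G)=\{w\in S^*: w=_G 1_G\}$. Let $\Sigma$ be a finite alphabet. A pattern over $\Sigma$ is an element of $\Sigma^F$ with $F\subset G$ finite; $\Sigma_G^*$ is the set of all patterns. A set $L\subset \Sigma_G^*$ is closed by extensions if whenever $p_1\in \Sigma^{F_1}$, $p_2\in \Sigma^{F_2}$, $F_1\subset F_2$ and $p_2|_{F_1}=p_1$, then $p_1\in L$ implies $p_2\in L$. A pattern coding over $\Sigma$ is a finite set $c$ of pairs $(w,a)$ with $w\in S^*$, $a\in \Sigma$. It is consistent if $(u,a),(v,b)\in c$ and $u=_G v$ imply $a=b$; then $p(c)$ is the pattern whose support is the set of group elements represented by the words in $c$, with $p(c)_w=a$ for $(w,a)\in c$. For a set $\mathcal C$ of pattern codings, $p(\mathcal C)=\{p(c): c\in\mathcal C \text{ consistent}\}$. $\mathcal C$ is recursively enumerable with oracle $\mathtt{WP}(G)$ if some Turing machine with oracle $\mathtt{WP}(G)$ accepts on input $c$ if and only if $c\in\mathcal C$. A $G$-machine is a tuple $(Q,\Sigma,\sqcup,q_0,Q_F,\delta)$ with $Q$ a finite set of states, $\Sigma$ a finite alphabet, $\sqcup\in\Sigma$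 the blank symbol, $q_0\in Q$ the initial state, $Q_F\subset Q$ the set of accepting states, and $\delta:\Sigma\times Q\to\Sigma\times Q\times S$ the transition function. It acts on $\Sigma^G\times Q$ by: if $\delta(x_{1_G},q)=(a,q',s)$ then $T(x,q)=(\sigma_{s^{-1}}(\widetilde x),q')$, where $\widetilde x_{1_G}=a$, $\widetilde x$ equals $x$ elsewhere, and $(\sigma_g y)_h=y_{g^{-1}h}$. For a pattern $p\in\Sigma^F$, $x^p\in\Sigma^G$ equals $p$ on $F$ and $\sqcup$ off $F$; $T$ accepts $p$ if $T^n(x^p,q_0)\in\Sigma^G\times Q_F$ for some $n\in\mathbb N$. A set $L\subset\Sigma_G^*$ is $G$-recursively enumerable if there exists a $G$-machine $T$ which accepts $p\in\Sigma_G^*$ if and only if $p\in L$.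
   Formalization: The G-machine may use a finite tape alphabet larger than Σ, and its blank ⊔ is not a letter of Σ; with ⊔ in Σ the claim fails, e.g. for the set of all patterns whose support contains 1_G, since the empty pattern and 1_G ↦ ⊔ give the same x^p. *)

theory Defs
  imports "HOL-Algebra.Generated_Groups"
begin

section \<open>Words and the word problem\<close>

definition word_val :: "('g, 'm) monoid_scheme \<Rightarrow> 'g list \<Rightarrow> 'g" where
  "word_val G w = foldr (\<lambda>s g. s \<otimes>\<^bsub>G\<^esub> g) w \<one>\<^bsub>G\<^esub>"

definition WP :: "('g, 'm) monoid_scheme \<Rightarrow> 'g set \<Rightarrow> 'g list set" where
  "WP G S = {w \<in> lists S. word_val G w = \<one>\<^bsub>G\<^esub>}"


section \<open>Patterns and pattern codings\<close>

text \<open>A pattern with support \<open>F\<close> is a partial map with domain \<open>F\<close>.\<close>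

definition patterns :: "('g, 'm) monoid_scheme \<Rightarrow> 'a set \<Rightarrow> ('g \<rightharpoonup> 'a) set" where
  "patterns G \<Sigma> = {p. finite (dom p) \<and> dom p \<subseteq> carrier G \<and> ran p \<subseteq> \<Sigma>}"

definition closed_by_extensions ::
    "('g, 'm) monoid_scheme \<Rightarrow> 'a set \<Rightarrow> ('g \<rightharpoonup> 'a) set \<Rightarrow> bool" where
  "closed_by_extensions G \<Sigma> L \<longleftrightarrow>
     (\<forall>p1\<in>patterns G \<Sigma>. \<forall>p2\<in>patterns G \<Sigma>. p1 \<subseteq>\<^sub>m p2 \<longrightarrow> p1 \<in> L \<longrightarrow> p2 \<in> L)"

definition pattern_codings :: "'g set \<Rightarrow> 'a set \<Rightarrow> ('g list \<times> 'a) set set" where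
  "pattern_codings S \<Sigma> = {c. finite c \<and> c \<subseteq> lists S \<times> \<Sigma>}"

definition consistent :: "('g, 'm) monoid_scheme \<Rightarrow> ('g list \<times> 'a) set \<Rightarrow> bool" where
  "consistent G c \<longleftrightarrow>
     (\<forall>u a v b. (u, a) \<in> c \<longrightarrow> (v, b) \<in> c \<longrightarrow> word_val G u = word_val G v \<longrightarrow> a = b)"

definition pattern_of :: "('g, 'm) monoid_scheme \<Rightarrow> ('g list \<times> 'a) set \<Rightarrow> ('g \<rightharpoonup> 'a)" where
  "pattern_of G c = (\<lambda>g. if \<exists>(w, a)\<in>c. word_val G w = g
     then Some (THE a. \<exists>w. (w, a) \<in> c \<and> word_val G w = g) else None)"

definition patterns_of ::
    "('g, 'm) monoid_scheme \<Rightarrow> ('g list \<times> 'a) set set \<Rightarrow> ('g \<rightharpoonup> 'a) set" where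
  "patterns_of G C = {pattern_of G c | c. c \<in> C \<and> consistent G c}"


section \<open>Turing machines with an oracle\<close>

text \<open>
  Deterministic machines with a two-way infinite work tape and a write-only oracle tape. An
  ordinary step rewrites the scanned cell, moves the head by at most one cell and may append one
  letter to the oracle tape. In the query state the machine passes to the yes-state or the no-state
  according to whether the word on the oracle tape belongs to the oracle; the oracle tape is then
  erased. An input is accepted if an accepting state is ever reached.

  Tape symbols are of type \<open>'i + nat\<close>, where \<open>Inl i\<close> is the input letter \<open>i\<close>. States are natural
  numbers. As state set and alphabet are finite, this loses no generality.
\<close>

datatype tape_move = MoveL | MoveN | MoveR

fun move_offset :: "tape_move \<Rightarrow> int" where
  "move_offset MoveL = -1"
| "move_offset MoveN = 0"
| "move_offset MoveR = 1"

record ('i, 'o) oracle_tm =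
  tm_states :: "nat set"
  tm_alphabet :: "('i + nat) set"
  tm_blank :: "'i + nat"
  tm_init :: nat
  tm_final :: "nat set"
  tm_query :: nat
  tm_yes :: nat
  tm_no :: nat
  tm_trans :: "('i + nat) \<times> nat \<Rightarrow> ('i + nat) \<times> nat \<times> tape_move \<times> 'o option"

text \<open>\<open>I\<close> is the input alphabet, \<open>S\<close> the alphabet of the oracle tape.\<close>

definition oracle_tm :: "'i set \<Rightarrow> 'o set \<Rightarrow> ('i, 'o) oracle_tm \<Rightarrow> bool" where
  "oracle_tm I S M \<longleftrightarrow>
     finite (tm_states M) \<and> finite (tm_alphabet M) \<and>
     Inl ` I \<subseteq> tm_alphabet M \<and> tm_blank M \<in> tm_alphabet M \<and> tm_blank M \<notin> Inl ` I \<and>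
     {tm_init M, tm_query M, tm_yes M, tm_no M} \<subseteq> tm_states M \<and>
     tm_final M \<subseteq> tm_states M \<and>
     (\<forall>a\<in>tm_alphabet M. \<forall>q\<in>tm_states M. case tm_trans M (a, q) of
        (b, r, d, e) \<Rightarrow> b \<in> tm_alphabet M \<and> r \<in> tm_states M \<and> set_option e \<subseteq> S)"

text \<open>A configuration consists of state, work tape, head position and word on the oracle tape.\<close>

type_synonym ('i, 'o) tm_config = "nat \<times> (int \<Rightarrow> 'i + nat) \<times> int \<times> 'o list"

fun tm_step ::
    "('i, 'o) oracle_tm \<Rightarrow> 'o list set \<Rightarrow> ('i, 'o) tm_config \<Rightarrow> ('i, 'o) tm_config" where
  "tm_step M A (q, t, h, u) =
     (if q = tm_query M then (if u \<in> A then tm_yes M else tm_no M, t, h, [])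
      else case tm_trans M (t h, q) of (b, r, d, e) \<Rightarrow>
        (r, t(h := b), h + move_offset d, (case e of None \<Rightarrow> u | Some s \<Rightarrow> u @ [s])))"

definition tm_start :: "('i, 'o) oracle_tm \<Rightarrow> 'i list \<Rightarrow> ('i, 'o) tm_config" where
  "tm_start M w = (tm_init M,
     (\<lambda>k. if 0 \<le> k \<and> k < int (length w) then Inl (w ! nat k) else tm_blank M), 0, [])"

definition tm_accepts :: "('i, 'o) oracle_tm \<Rightarrow> 'o list set \<Rightarrow> 'i list \<Rightarrow> bool" where
  "tm_accepts M A w \<longleftrightarrow> (\<exists>n. fst ((tm_step M A ^^ n) (tm_start M w)) \<in> tm_final M)"

text \<open>
  A list of pairs \<open>(w, a)\<close> is written as a string over the disjoint union of \<open>S\<close> and \<open>\<Sigma>\<close>; the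
  letter \<open>a\<close> marks the end of the word \<open>w\<close>. A finite set of pairs is presented to the machine by
  a list of its elements. The answer must not depend on the order of the list or on repetitions.
\<close>

definition encode_coding :: "('g list \<times> 'a) list \<Rightarrow> ('g + 'a) list" where
  "encode_coding cs = concat (map (\<lambda>(w, a). map Inl w @ [Inr a]) cs)"

definition re_with_oracle ::
    "'g set \<Rightarrow> 'a set \<Rightarrow> 'g list set \<Rightarrow> ('g list \<times> 'a) set set \<Rightarrow> bool" where
  "re_with_oracle S \<Sigma> A C \<longleftrightarrow>
     (\<exists>M :: ('g + 'a, 'g) oracle_tm. oracle_tm (S <+> \<Sigma>) S M \<and>
        (\<forall>cs \<in> lists (lists S \<times> \<Sigma>). tm_accepts M A (encode_coding cs) \<longleftrightarrow> set cs \<in> C))"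


section \<open>\<open>G\<close>-machines\<close>

text \<open>
  As for Turing machines, the tape alphabet is a finite set containing the pattern alphabet \<open>\<Sigma>\<close>
  (embedded by \<open>Inl\<close>), and the blank symbol is not a letter of \<open>\<Sigma>\<close>. If the blank could occur
  in patterns, a machine could not distinguish a pattern from its extension by blanks.
\<close>

record ('g, 'a) g_machine =
  gm_states :: "nat set"
  gm_alphabet :: "('a + nat) set"
  gm_blank :: "'a + nat"
  gm_init :: nat
  gm_final :: "nat set"
  gm_trans :: "('a + nat) \<times> nat \<Rightarrow> ('a + nat) \<times> nat \<times> 'g"

definition g_machine :: "'g set \<Rightarrow> 'a set \<Rightarrow> ('g, 'a) g_machine \<Rightarrow> bool" where
  "g_machine S \<Sigma> T \<longleftrightarrow>
     finite (gm_states T) \<and> finite (gm_alphabet T) \<and>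
     Inl ` \<Sigma> \<subseteq> gm_alphabet T \<and> gm_blank T \<in> gm_alphabet T \<and> gm_blank T \<notin> Inl ` \<Sigma> \<and>
     gm_init T \<in> gm_states T \<and> gm_final T \<subseteq> gm_states T \<and>
     gm_trans T \<in> gm_alphabet T \<times> gm_states T \<rightarrow> gm_alphabet T \<times> gm_states T \<times> S"

text \<open>
  Elements of \<open>\<Gamma>\<^sup>G\<close> are represented by total functions; values outside \<open>carrier G\<close> are never
  read.
\<close>

definition shift :: "('g, 'm) monoid_scheme \<Rightarrow> 'g \<Rightarrow> ('g \<Rightarrow> 's) \<Rightarrow> ('g \<Rightarrow> 's)" where
  "shift G g y = (\<lambda>h. y (inv\<^bsub>G\<^esub> g \<otimes>\<^bsub>G\<^esub> h))"

fun gm_step :: "('g, 'm) monoid_scheme \<Rightarrow> ('g, 'a) g_machine \<Rightarrow>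
    ('g \<Rightarrow> 'a + nat) \<times> nat \<Rightarrow> ('g \<Rightarrow> 'a + nat) \<times> nat" where
  "gm_step G T (x, q) = (case gm_trans T (x \<one>\<^bsub>G\<^esub>, q) of
     (a, r, s) \<Rightarrow> (shift G (inv\<^bsub>G\<^esub> s) (x(\<one>\<^bsub>G\<^esub> := a)), r))"

definition gm_input :: "('g, 'a) g_machine \<Rightarrow> ('g \<rightharpoonup> 'a) \<Rightarrow> ('g \<Rightarrow> 'a + nat)" where
  "gm_input T p = (\<lambda>g. case p g of None \<Rightarrow> gm_blank T | Some a \<Rightarrow> Inl a)"

definition gm_accepts ::
    "('g, 'm) monoid_scheme \<Rightarrow> ('g, 'a) g_machine \<Rightarrow> ('g \<rightharpoonup> 'a) \<Rightarrow> bool" where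
  "gm_accepts G T p \<longleftrightarrow>
     (\<exists>n. snd ((gm_step G T ^^ n) (gm_input T p, gm_init T)) \<in> gm_final T)"

definition G_recursively_enumerable ::
    "('g, 'm) monoid_scheme \<Rightarrow> 'g set \<Rightarrow> 'a set \<Rightarrow> ('g \<rightharpoonup> 'a) set \<Rightarrow> bool" where
  "G_recursively_enumerable G S \<Sigma> L \<longleftrightarrow> L \<subseteq> patterns G \<Sigma> \<and>
     (\<exists>T. g_machine S \<Sigma> T \<and> (\<forall>p\<in>patterns G \<Sigma>. gm_accepts G T p \<longleftrightarrow> p \<in> L))"

end

theory Submission
  imports Defs
begin

text \<open>
  Let \<open>M\<close> be an oracle machine for \<open>C\<close>. Since the set of patterns is closed by extensions, a pattern
  \<open>p\<close> belongs to it if and only if there is a coding \<open>c\<close> accepted by \<open>M\<close> such that \<open>p\<close> carries the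
  letter \<open>a\<close> at the place of \<open>w\<close> for all \<open>(w, a)\<close> in \<open>c\<close> (\<open>patterns_of_iff\<close>). A \<open>G\<close>-machine has to search for such a
  coding and for an accepting run of \<open>M\<close>, with \<open>G\<close> as its only memory.

  For the oracle and for the comparison with \<open>p\<close> a single pebble on \<open>G\<close> suffices. A query concerns a word that was
  written letter by letter on the oracle tape; if the pebble makes the corresponding moves,
  the word represents the neutral element exactly when the pebble is back at the origin. In
  the same way the pebble walks along \<open>w\<close> to the place where \<open>a\<close> has to be compared with \<open>p\<close>. The search becomes
  deterministic by enumerating finite words of choices and simulating, for each of them, a machine that
  first guesses the coding from these choices and then runs \<open>M\<close>. So what remains is to maintain, on \<open>G\<close>, an
  unbounded array and a pebble, and to let the head find its way between them.

  The array is where the hypothesis that \<open>G\<close> is infinite and finitely generated enters. Depth-first search in the Cayley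
  graph discovers infinitely many vertices \<open>a 0, a 1, \<dots>\<close>, since a finite set of vertices that is closed under the
  generators would be all of \<open>G\<close>. The \<open>i\<close>-th array entry is stored in the vertex \<open>a i\<close>. If each visited vertex
  is labelled with the generator that leads to it from its parent, then the head can repeat the search from
  the labels alone: it gets from \<open>a i\<close> to \<open>a (i + 1)\<close>, which extends the array when needed, and back to the origin
  (\<open>dfs_enumeration_exists\<close>, \<open>runs_next\<close>, \<open>runs_home\<close>).

  The pebble may be anywhere, so the head reaches it by following, from the origin,
  the generators by which the pebble last left the cells; this is the loop-erased path of the
  pebble, and it leads to the pebble (\<open>runs_pebble\<close>).

  With these means a \<open>G\<close>-machine can sweep through the array with a finite transducer and
  then move the pebble (\<open>sweep_machine_exists\<close>); a suitable transducer counts through all words of choices and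
  simulates one step of a machine with choices per sweep (\<open>choice_machine_exists\<close>).
  Finally such a machine is written down for the oracle machine (\<open>guesser_machine_exists\<close>).
\<close>

section \<open>Depth-first search in an infinite Cayley graph\<close>

locale infinite_fg_group = group G for G :: "('g, 'm) monoid_scheme" (structure) +
  fixes ss :: "'g list"
  assumes gens_carrier: "set ss \<subseteq> carrier G"
    and generates: "generate G (set ss) = carrier G"
    and infinite_carrier: "infinite (carrier G)"
    and one_gen: "\<one> \<in> set ss"
    and inv_gen: "s \<in> set ss \<Longrightarrow> inv s \<in> set ss"
begin

lemma gen_closed [simp, intro]: "s \<in> set ss \<Longrightarrow> s \<in> carrier G"
  using gens_carrier by blast

lemma gen_nth_closed [simp, intro]: "i < length ss \<Longrightarrow> ss ! i \<in> carrier G"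
  by (simp add: gen_closed)

text \<open>The set of generators is closed under inverses, so the submonoid generated by it is all of \<open>G\<close>.\<close>

lemma closed_under_gens_infinite:
  assumes "\<one> \<in> V" "V \<subseteq> carrier G" "\<And>g i. g \<in> V \<Longrightarrow> i < length ss \<Longrightarrow> g \<otimes> ss ! i \<in> V"
  shows "infinite V"
proof -
  have step: "g \<otimes> s \<in> V" if "g \<in> V" "s \<in> set ss" for g s
    using that assms(3) by (metis in_set_conv_nth)
  have "g \<otimes> h \<in> V" if "h \<in> generate G (set ss)" "g \<in> V" for g h
    using that
  proof (induction arbitrary: g)
    case one
    then show ?case using assms(2) by auto
  next
    case (incl h)
    then show ?case using step by blast
  next
    case (inv h)
    then show ?case using step inv_gen by blast
  next
    case (eng h1 h2)
    then have "h1 \<in> carrier G" "h2 \<in> carrier G" "g \<in> carrier G"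
      using generates assms(2) by auto
    moreover have "(g \<otimes> h1) \<otimes> h2 \<in> V" using eng by blast
    ultimately show ?case by (simp add: m_assoc)
  qed
  then have "carrier G \<subseteq> V"
    using assms(1,2) generates by (metis l_one subsetI)
  then show ?thesis using infinite_carrier finite_subset by blast
qed

end

text \<open>The label of a visited vertex tells by which generator it was reached from its parent.\<close>

datatype label = Unvisited | Root | Via nat

context infinite_fg_group
begin

text \<open>
  The moves of a depth-first search between two discoveries. A pair \<open>(v, j)\<close> means that the search
  stands at \<open>v\<close> and that the generators before the \<open>j\<close>-th have been tried there. The neighbour by
  the \<open>j\<close>-th generator is skipped if it is visited and not a child of \<open>v\<close>; when all generators
  have been tried, the search returns to the parent. Whether a neighbour is a child of \<open>v\<close> can be
  read off the label of the neighbour alone.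
\<close>

definition quiet_step :: "('g \<Rightarrow> label) \<Rightarrow> 'g \<times> nat \<Rightarrow> 'g \<times> nat \<Rightarrow> bool" where
  "quiet_step D = (\<lambda>(v, j) (v', j').
     j < length ss \<and> D (v \<otimes> ss ! j) \<noteq> Unvisited \<and> D (v \<otimes> ss ! j) \<noteq> Via j \<and> v' = v \<and> j' = Suc j \<or>
     length ss \<le> j \<and> (\<exists>i<length ss. D v = Via i \<and> v' = v \<otimes> inv (ss ! i) \<and> j' = Suc i))"

text \<open>
  The invariant of the search speaks about the stack of ancestors of the current vertex, the current
  vertex on top, each with the number of generators tried so far. A neighbour that has been tried is
  visited, and one that has not been tried yet is not a child; hence the search never enters a vertex twice.
  A visited vertex off the stack is finished, i.e. all of its neighbours are visited. That the parent
  of a labelled vertex is visited ensures that a newly discovered vertex has no children.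
\<close>

fun dfs_chain :: "('g \<Rightarrow> label) \<Rightarrow> ('g \<times> nat) list \<Rightarrow> bool" where
  "dfs_chain D [] \<longleftrightarrow> False"
| "dfs_chain D [(v, j)] \<longleftrightarrow> v = \<one> \<and> D v = Root"
| "dfs_chain D ((v, j) # (u, i) # st) \<longleftrightarrow>
     (\<exists>m<length ss. i = Suc m \<and> v = u \<otimes> ss ! m \<and> D v = Via m) \<and> dfs_chain D ((u, i) # st)"

definition dfs_inv :: "('g \<Rightarrow> label) \<Rightarrow> ('g \<times> nat) list \<Rightarrow> bool" where
  "dfs_inv D st \<longleftrightarrow> dfs_chain D st \<and> distinct (map fst st) \<and>
     finite {g. D g \<noteq> Unvisited} \<and> {g. D g \<noteq> Unvisited} \<subseteq> carrier G \<and>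
     (\<forall>(u, j) \<in> set st. \<forall>i<length ss.
        (i < j \<longrightarrow> D (u \<otimes> ss ! i) \<noteq> Unvisited) \<and> (j \<le> i \<longrightarrow> D (u \<otimes> ss ! i) \<noteq> Via i)) \<and>
     (\<forall>g. D g \<noteq> Unvisited \<longrightarrow> g \<notin> fst ` set st \<longrightarrow>
        (\<forall>i<length ss. D (g \<otimes> ss ! i) \<noteq> Unvisited)) \<and>
     (\<forall>u\<in>carrier G. \<forall>i<length ss. D (u \<otimes> ss ! i) = Via i \<longrightarrow> D u \<noteq> Unvisited)"

lemma dfs_invD:
  assumes "dfs_inv D st"
  shows "dfs_chain D st" "distinct (map fst st)"
    and "finite {g. D g \<noteq> Unvisited}" "{g. D g \<noteq> Unvisited} \<subseteq> carrier G"
    and "\<And>u j i. (u, j) \<in> set st \<Longrightarrow> i < j \<Longrightarrow> i < length ss \<Longrightarrow> D (u \<otimes> ss ! i) \<noteq> Unvisited"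
    and "\<And>u j i. (u, j) \<in> set st \<Longrightarrow> j \<le> i \<Longrightarrow> i < length ss \<Longrightarrow> D (u \<otimes> ss ! i) \<noteq> Via i"
    and "\<And>g i. D g \<noteq> Unvisited \<Longrightarrow> g \<notin> fst ` set st \<Longrightarrow> i < length ss \<Longrightarrow> D (g \<otimes> ss ! i) \<noteq> Unvisited"
    and "\<And>u i. u \<in> carrier G \<Longrightarrow> i < length ss \<Longrightarrow> D (u \<otimes> ss ! i) = Via i \<Longrightarrow> D u \<noteq> Unvisited"
proof -
  note c = assms[unfolded dfs_inv_def]
  show "dfs_chain D st" using c by (elim conjE)
  show "distinct (map fst st)" using c by (elim conjE)
  show "finite {g. D g \<noteq> Unvisited}" using c by (elim conjE)
  show "{g. D g \<noteq> Unvisited} \<subseteq> carrier G" using c by (elim conjE)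
  show "\<And>u j i. (u, j) \<in> set st \<Longrightarrow> i < j \<Longrightarrow> i < length ss \<Longrightarrow> D (u \<otimes> ss ! i) \<noteq> Unvisited"
    using c by fast
  show "\<And>u j i. (u, j) \<in> set st \<Longrightarrow> j \<le> i \<Longrightarrow> i < length ss \<Longrightarrow> D (u \<otimes> ss ! i) \<noteq> Via i"
    using c by fast
  show "\<And>g i. D g \<noteq> Unvisited \<Longrightarrow> g \<notin> fst ` set st \<Longrightarrow> i < length ss \<Longrightarrow> D (g \<otimes> ss ! i) \<noteq> Unvisited"
    using c by (elim conjE) simp
  show "\<And>u i. u \<in> carrier G \<Longrightarrow> i < length ss \<Longrightarrow> D (u \<otimes> ss ! i) = Via i \<Longrightarrow> D u \<noteq> Unvisited"
    using c by (elim conjE) simp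
qed

lemma dfs_chain_visited: "dfs_chain D st \<Longrightarrow> u \<in> fst ` set st \<Longrightarrow> D u \<noteq> Unvisited"
  by (induction D st rule: dfs_chain.induct) auto

lemma dfs_chain_root: "dfs_chain D st \<Longrightarrow> D \<one> = Root"
  by (induction D st rule: dfs_chain.induct) auto

lemma dfs_chain_update:
  "dfs_chain D st \<Longrightarrow> D w = Unvisited \<Longrightarrow> dfs_chain (D(w := x)) st"
  by (induction D st rule: dfs_chain.induct) auto

lemma dfs_chain_retop: "dfs_chain D ((v, j) # st) \<Longrightarrow> dfs_chain D ((v, j') # st)"
  by (cases st) auto

text \<open>
  The search never runs dry: if the stack were exhausted, the finite set of visited vertices would be
  closed under the generators.
\<close>

lemma dfs_search:
  assumes "dfs_inv D ((v, j) # st)"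
  shows "\<exists>v' j' st'. (quiet_step D)\<^sup>*\<^sup>* (v, j) (v', j') \<and> j' < length ss \<and>
    D (v' \<otimes> ss ! j') = Unvisited \<and> dfs_inv D ((v', j') # st')"
  using assms
proof (induction "(length st, length ss - j)" arbitrary: v j st
    rule: wf_induct_rule[OF wf_lex_prod[OF wf_less_than wf_less_than]])
  case 1
  note inv = 1(2)[unfolded dfs_inv_def]
  have IH: "\<exists>v' j' st'. (quiet_step D)\<^sup>*\<^sup>* (v2, j2) (v', j') \<and> j' < length ss \<and>
      D (v' \<otimes> ss ! j') = Unvisited \<and> dfs_inv D ((v', j') # st')"
    if "dfs_inv D ((v2, j2) # st2)"
      "length st2 < length st \<or> length st2 = length st \<and> length ss - j2 < length ss - j" for v2 j2 st2
    using 1(1)[OF _ that(1)] that(2) by simp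
  show ?case
  proof (cases "j < length ss")
    case True
    show ?thesis
    proof (cases "D (v \<otimes> ss ! j) = Unvisited")
      case unv: True
      show ?thesis
        using True unv 1(2) by (intro exI[of _ v] exI[of _ j] exI[of _ st]) auto
    next
      case False
      have "D (v \<otimes> ss ! j) \<noteq> Via j" using inv True by auto
      then have q: "quiet_step D (v, j) (v, Suc j)"
        using True False by (simp add: quiet_step_def)
      have "dfs_inv D ((v, Suc j) # st)"
        using inv False dfs_chain_retop[of D v j st "Suc j"] unfolding dfs_inv_def
        by (auto simp: less_Suc_eq)
      from IH[OF this] True show ?thesis
        using q by (meson converse_rtranclp_into_rtranclp diff_less_mono2 lessI)
    qed
  next
    case False
    show ?thesis
    proof (cases st)
      case Nil
      have "infinite {g. D g \<noteq> Unvisited}"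
      proof (rule closed_under_gens_infinite)
        show "\<one> \<in> {g. D g \<noteq> Unvisited}" using inv dfs_chain_root[of D] by auto
        show "{g. D g \<noteq> Unvisited} \<subseteq> carrier G" using inv by blast
        fix g i assume "g \<in> {g. D g \<noteq> Unvisited}" "i < length ss"
        then show "g \<otimes> ss ! i \<in> {g. D g \<noteq> Unvisited}"
          using inv False Nil by (cases "g = v") auto
      qed
      then show ?thesis using inv by blast
    next
      case (Cons ui st')
      obtain u i where ui: "ui = (u, i)" by (cases ui)
      have ch: "dfs_chain D ((v, j) # (u, i) # st')" using inv Cons ui by simp
      then obtain m where m: "m < length ss" "i = Suc m" "v = u \<otimes> ss ! m" "D v = Via m" by auto
      have "D u \<noteq> Unvisited" using dfs_chain_visited[OF ch, of u] by simp
      then have u: "u \<in> carrier G" using inv by auto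
      have q: "quiet_step D (v, j) (u, i)"
        using False m u by (auto simp: quiet_step_def m_assoc)
      have "dfs_inv D ((u, i) # st')"
        using inv Cons ui False unfolding dfs_inv_def by auto
      from IH[OF this] Cons show ?thesis
        using q by (metis converse_rtranclp_into_rtranclp length_Cons lessI)
    qed
  qed
qed

text \<open>
  Pushing the new vertex \<open>w\<close> keeps the invariant: \<open>w\<close> becomes a child of \<open>v\<close> only, because right multiplication
  with a generator is injective, and no vertex is a child of \<open>w\<close> yet.
\<close>

lemma dfs_discover:
  assumes inv: "dfs_inv D ((v, j) # st)" and j: "j < length ss" and w: "D (v \<otimes> ss ! j) = Unvisited"
  shows "dfs_inv (D(v \<otimes> ss ! j := Via j)) ((v \<otimes> ss ! j, 0) # (v, Suc j) # st)"
proof -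
  define w where "w = v \<otimes> ss ! j"
  note I = dfs_invD(2-4)[OF inv] and ch0 = dfs_invD(1)[OF inv] and nf0 = dfs_invD(7)[OF inv]
    and par0 = dfs_invD(8)[OF inv]
  have fr0: "(i < k \<longrightarrow> D (u \<otimes> ss ! i) \<noteq> Unvisited) \<and> (k \<le> i \<longrightarrow> D (u \<otimes> ss ! i) \<noteq> Via i)"
    if "(u, k) \<in> set ((v, j) # st)" "i < length ss" for u k i
    using dfs_invD(5,6)[OF inv that(1)] that(2) by blast
  have vis: "D u \<noteq> Unvisited" if "u \<in> fst ` set ((v, j) # st)" for u
    using dfs_chain_visited[OF ch0 that] .
  have carr: "u \<in> carrier G" if "u \<in> fst ` set ((v, j) # st)" for u
    using vis[OF that] I(3) by auto
  have v: "v \<in> carrier G" using carr[of v] by simp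
  have ne: "w \<notin> fst ` set ((v, j) # st)" using vis[of w] w unfolding w_def by blast
  have wc: "w \<in> carrier G" using v j w_def by simp
  have "dfs_chain (D(w := Via j)) ((v, Suc j) # st)"
    using dfs_chain_update[OF dfs_chain_retop[OF ch0, of "Suc j"]] w w_def by simp
  then have ch: "dfs_chain (D(w := Via j)) ((w, 0) # (v, Suc j) # st)"
    using j w_def by auto
  have vis': "{g. (D(w := Via j)) g \<noteq> Unvisited} = insert w {g. D g \<noteq> Unvisited}" by auto
  have fr: "(i < k \<longrightarrow> (D(w := Via j)) (u \<otimes> ss ! i) \<noteq> Unvisited) \<and>
      (k \<le> i \<longrightarrow> (D(w := Via j)) (u \<otimes> ss ! i) \<noteq> Via i)"
    if uk: "(u, k) \<in> set ((w, 0) # (v, Suc j) # st)" and i: "i < length ss" for u k i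
  proof -
    consider "u = w" "k = 0" | "u = v" "k = Suc j" | "(u, k) \<in> set st" using uk by auto
    then show ?thesis
    proof cases
      case 1
      have "D (w \<otimes> ss ! i) \<noteq> Via i" using par0[OF wc i] w w_def by blast
      moreover have "w \<otimes> ss ! i \<noteq> w" if "i = j"
        using that ne v wc j w_def by auto
      ultimately show ?thesis using 1 by auto
    next
      case 2
      then show ?thesis using fr0[of v j i] i w_def by (auto simp: less_Suc_eq)
    next
      case 3
      then have "u \<in> fst ` set st" by force
      then have "u \<noteq> v" "u \<in> carrier G" using I(1) carr[of u] by auto
      then have "u \<otimes> ss ! i \<noteq> w" if "i = j" using that v j w_def by simp
      moreover have "(i < k \<longrightarrow> D (u \<otimes> ss ! i) \<noteq> Unvisited) \<and> (k \<le> i \<longrightarrow> D (u \<otimes> ss ! i) \<noteq> Via i)"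
        using fr0[of u k i] 3 i by simp
      ultimately show ?thesis by auto
    qed
  qed
  have nf: "(D(w := Via j)) (g \<otimes> ss ! i) \<noteq> Unvisited"
    if "(D(w := Via j)) g \<noteq> Unvisited" "g \<notin> fst ` set ((w, 0) # (v, Suc j) # st)" "i < length ss" for g i
    using that nf0[of g i] by (auto split: if_splits)
  have par: "(D(w := Via j)) u \<noteq> Unvisited"
    if "u \<in> carrier G" "i < length ss" "(D(w := Via j)) (u \<otimes> ss ! i) = Via i" for u i
  proof (cases "u \<otimes> ss ! i = w")
    case True
    then have "u = v" using that v j w_def by simp
    then show ?thesis using vis[of v] by simp
  next
    case False
    then show ?thesis using that par0[of u i] by auto
  qed
  have "dfs_inv (D(w := Via j)) ((w, 0) # (v, Suc j) # st)"
    unfolding dfs_inv_def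
  proof (intro conjI)
    show "distinct (map fst ((w, 0) # (v, Suc j) # st))" using I(1) ne by simp
    show "finite {g. (D(w := Via j)) g \<noteq> Unvisited}" "{g. (D(w := Via j)) g \<noteq> Unvisited} \<subseteq> carrier G"
      unfolding vis' using I(2,3) wc by auto
    show "\<forall>(u, k)\<in>set ((w, 0) # (v, Suc j) # st). \<forall>i<length ss.
        (i < k \<longrightarrow> (D(w := Via j)) (u \<otimes> ss ! i) \<noteq> Unvisited) \<and>
        (k \<le> i \<longrightarrow> (D(w := Via j)) (u \<otimes> ss ! i) \<noteq> Via i)"
      using fr by blast
  qed (rule ch, (use nf par in blast)+)
  then show ?thesis by (simp add: w_def)
qed

end

text \<open>
  The vertices \<open>a 0, a 1, \<dots>\<close> in the order of their discovery; \<open>D n\<close> is the labelling after the discovery of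
  \<open>a n\<close>, and \<open>l n\<close> is the index of the generator by which \<open>a (Suc n)\<close> is discovered, from a vertex \<open>u\<close>. The last
  assumption says that the labels lead the head from \<open>a n\<close> to \<open>u\<close>.
\<close>

locale dfs_enumeration = infinite_fg_group G ss
  for G :: "('g, 'm) monoid_scheme" (structure) and ss +
  fixes D :: "nat \<Rightarrow> 'g \<Rightarrow> label" and a :: "nat \<Rightarrow> 'g" and l :: "nat \<Rightarrow> nat"
  assumes D_0: "D 0 = (\<lambda>_. Unvisited)(\<one> := Root)"
    and a_0: "a 0 = \<one>"
    and D_Suc: "D (Suc n) = (D n)(a (Suc n) := Via (l n))"
    and a_new: "D n (a (Suc n)) = Unvisited"
    and l_less: "l n < length ss"
    and a_Suc: "\<exists>u. D n u \<noteq> Unvisited \<and> u \<in> carrier G \<and> a (Suc n) = u \<otimes> ss ! l n \<and>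
       (quiet_step (D n))\<^sup>*\<^sup>* (a n, 0) (u, l n)"

lemma (in infinite_fg_group) dfs_enumeration_exists: "\<exists>D a l. dfs_enumeration G ss D a l"
proof -
  define P where "P = (\<lambda>n::nat. \<lambda>(D, st::('g \<times> nat) list).
    dfs_inv D st \<and> snd (hd st) = 0 \<and> (n = 0 \<longrightarrow> D = (\<lambda>_. Unvisited)(\<one> := Root) \<and> fst (hd st) = \<one>))"
  define Q where "Q = (\<lambda>n::nat. \<lambda>(D, st::('g \<times> nat) list) (D', st'::('g \<times> nat) list). \<exists>i<length ss.
    D' = D(fst (hd st') := Via i) \<and> D (fst (hd st')) = Unvisited \<and>
    (\<exists>u. D u \<noteq> Unvisited \<and> u \<in> carrier G \<and> fst (hd st') = u \<otimes> ss ! i \<and>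
         (quiet_step D)\<^sup>*\<^sup>* (fst (hd st), 0) (u, i)))"
  have "\<exists>f. \<forall>n. P n (f n) \<and> Q n (f n) (f (Suc n))"
  proof (rule dependent_nat_choice)
    have "dfs_inv ((\<lambda>_. Unvisited)(\<one> := Root)) [(\<one>, 0)]"
      by (auto simp: dfs_inv_def)
    then show "\<exists>x. P 0 x" by (auto simp: P_def)
    fix x n assume "P n x"
    then obtain D st where x: "x = (D, st)" and inv: "dfs_inv D st" and z: "snd (hd st) = 0"
      by (cases x) (auto simp: P_def)
    from inv obtain v st1 where st: "st = (v, 0) # st1"
      using z by (cases st) (auto simp: dfs_inv_def)
    from dfs_search[OF inv[unfolded st]] obtain u i st' where
      q: "(quiet_step D)\<^sup>*\<^sup>* (v, 0) (u, i)" "i < length ss" "D (u \<otimes> ss ! i) = Unvisited"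
         "dfs_inv D ((u, i) # st')" by blast
    have "D u \<noteq> Unvisited" "u \<in> carrier G"
      using q(4) dfs_chain_visited[of D "(u, i) # st'" u] by (auto simp: dfs_inv_def)
    then show "\<exists>y. P (Suc n) y \<and> Q n x y"
      using dfs_discover[OF q(4,2,3)] q x st
      by (intro exI[of _ "(D(u \<otimes> ss ! i := Via i), (u \<otimes> ss ! i, 0) # (u, Suc i) # st')"])
         (auto simp: P_def Q_def)
  qed
  then obtain f where f: "\<And>n. P n (f n)" "\<And>n. Q n (f n) (f (Suc n))" by blast
  define D where "D n = fst (f n)" for n
  define a where "a n = fst (hd (snd (f n)))" for n
  have "\<forall>n. \<exists>i<length ss. D (Suc n) = (D n)(a (Suc n) := Via i) \<and> D n (a (Suc n)) = Unvisited \<and>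
    (\<exists>u. D n u \<noteq> Unvisited \<and> u \<in> carrier G \<and> a (Suc n) = u \<otimes> ss ! i \<and>
       (quiet_step (D n))\<^sup>*\<^sup>* (a n, 0) (u, i))"
    using f(2) by (simp add: Q_def D_def a_def case_prod_beta)
  then obtain l where l: "\<And>n. l n < length ss \<and> D (Suc n) = (D n)(a (Suc n) := Via (l n)) \<and>
    D n (a (Suc n)) = Unvisited \<and>
    (\<exists>u. D n u \<noteq> Unvisited \<and> u \<in> carrier G \<and> a (Suc n) = u \<otimes> ss ! l n \<and>
       (quiet_step (D n))\<^sup>*\<^sup>* (a n, 0) (u, l n))" by metis
  have "D 0 = (\<lambda>_. Unvisited)(\<one> := Root)" "a 0 = \<one>"
    using f(1)[of 0] by (auto simp: P_def D_def a_def case_prod_beta)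
  then have "dfs_enumeration G ss D a l"
    using l by unfold_locales blast+
  then show ?thesis by blast
qed

context dfs_enumeration
begin

lemma a_closed [simp]: "a n \<in> carrier G"
proof (cases n)
  case (Suc m)
  then show ?thesis using a_Suc[of m] l_less[of m] by auto
qed (simp add: a_0)

lemma D_visited_iff: "D n g \<noteq> Unvisited \<longleftrightarrow> g \<in> a ` {..n}"
  by (induction n) (auto simp: D_0 a_0 D_Suc atMost_Suc)

text \<open>The search only labels new vertices.\<close>

lemma D_mono: "m \<le> n \<Longrightarrow> D m g \<noteq> Unvisited \<Longrightarrow> D n g = D m g"
proof (induction n rule: dec_induct)
  case (step k)
  then show ?case using a_new[of k] by (auto simp: D_Suc)
qed simp

lemma D_root_iff: "D n g = Root \<longleftrightarrow> g = \<one>"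
proof (induction n)
  case (Suc n)
  have "D (Suc n) \<one> = Root" using D_mono[of 0 "Suc n" \<one>] by (simp add: D_0)
  then show ?case using Suc by (auto simp: D_Suc)
qed (simp add: D_0)

lemma a_inj: "inj a"
proof (rule linorder_injI)
  fix m n :: nat assume "m < n"
  then obtain k where k: "n = Suc k" "m \<le> k" by (cases n) auto
  then have "a m \<in> a ` {..k}" by auto
  then show "a m \<noteq> a n" using a_new[of k] k D_visited_iff[of k "a m"] by auto
qed

lemma D_a_Suc: "n < N \<Longrightarrow> D N (a (Suc n)) = Via (l n)"
  using D_mono[of "Suc n" N "a (Suc n)"] by (simp add: D_Suc)

text \<open>
  Since labels never change, a later traversal of the array takes the same decisions as the search.
\<close>

lemma quiet_step_mono: "m \<le> n \<Longrightarrow> quiet_step (D m) x y \<Longrightarrow> quiet_step (D n) x y"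
  using D_mono[of m n] unfolding quiet_step_def by (auto split: prod.splits)

lemma quiet_steps_mono: "m \<le> n \<Longrightarrow> (quiet_step (D m))\<^sup>*\<^sup>* x y \<Longrightarrow> (quiet_step (D n))\<^sup>*\<^sup>* x y"
  using quiet_step_mono by (auto elim: mono_rtranclp[rule_format, rotated])

text \<open>Parents come earlier in the enumeration, so that climbing to the parent again and again ends at the origin.\<close>

lemma a_parent: "\<exists>m\<le>n. a (Suc n) \<otimes> inv (ss ! l n) = a m"
proof -
  obtain u where u: "D n u \<noteq> Unvisited" "u \<in> carrier G" "a (Suc n) = u \<otimes> ss ! l n"
    using a_Suc[of n] by blast
  then have "a (Suc n) \<otimes> inv (ss ! l n) = u" using l_less[of n] by (simp add: m_assoc)
  then show ?thesis using u(1) D_visited_iff[of n u] by auto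
qed

end

section \<open>Programs for a head moving on the group\<close>

datatype ('g, 'c, 'r) prog =
  Act "'c \<Rightarrow> 'r \<Rightarrow> 'c \<times> 'r \<times> 'g"
| Seq "('g, 'c, 'r) prog" "('g, 'c, 'r) prog"
| While "'c \<Rightarrow> 'r \<Rightarrow> bool" "('g, 'c, 'r) prog"

text \<open>Here the head moves, whereas \<open>gm_step\<close> keeps the head at the origin and shifts the contents of the cells.\<close>

definition head_step :: "('g, 'm) monoid_scheme \<Rightarrow> ('c \<Rightarrow> 'q \<Rightarrow> 'c \<times> 'q \<times> 'g) \<Rightarrow>
    ('g \<Rightarrow> 'c) \<times> 'g \<times> 'q \<Rightarrow> ('g \<Rightarrow> 'c) \<times> 'g \<times> 'q" where
  "head_step G \<delta> = (\<lambda>(X, g, q). case \<delta> (X g) q of (c, q', s) \<Rightarrow> (X(g := c), g \<otimes>\<^bsub>G\<^esub> s, q'))"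

text \<open>A control state is a stack of programs still to be run, together with the register.\<close>

fun prog_step :: "'g \<Rightarrow> 'c \<Rightarrow> ('g, 'c, 'r) prog list \<times> 'r \<Rightarrow> 'c \<times> (('g, 'c, 'r) prog list \<times> 'r) \<times> 'g" where
  "prog_step e c ([], r) = (c, ([], r), e)"
| "prog_step e c (Act f # K, r) = (case f c r of (c', r', s) \<Rightarrow> (c', (K, r'), s))"
| "prog_step e c (Seq P Q # K, r) = (c, (P # Q # K, r), e)"
| "prog_step e c (While b P # K, r) = (c, (if b c r then P # While b P # K else K, r), e)"

text \<open>
  Only finitely many stacks occur while \<open>P\<close> is run on top of a stack \<open>K\<close>: each consists of a part of \<open>P\<close>, the
  rest of \<open>P\<close> after it, and \<open>K\<close>. This is what makes a program a machine with finitely many states.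
\<close>

fun prog_conts :: "('g, 'c, 'r) prog \<Rightarrow> ('g, 'c, 'r) prog list \<Rightarrow> ('g, 'c, 'r) prog list set" where
  "prog_conts (Act f) K = {Act f # K}"
| "prog_conts (Seq P Q) K = {Seq P Q # K} \<union> prog_conts P (Q # K) \<union> prog_conts Q K"
| "prog_conts (While b P) K = {While b P # K} \<union> prog_conts P (While b P # K)"

fun prog_ok :: "'c set \<Rightarrow> 'r set \<Rightarrow> 'g set \<Rightarrow> ('g, 'c, 'r) prog \<Rightarrow> bool" where
  "prog_ok A R S (Act f) \<longleftrightarrow> (\<forall>c\<in>A. \<forall>r\<in>R. f c r \<in> A \<times> R \<times> S)"
| "prog_ok A R S (Seq P Q) \<longleftrightarrow> prog_ok A R S P \<and> prog_ok A R S Q"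
| "prog_ok A R S (While b P) \<longleftrightarrow> prog_ok A R S P"

lemma finite_prog_conts: "finite (prog_conts P K)"
  by (induction P arbitrary: K) auto

lemma prog_conts_start: "P # K \<in> prog_conts P K"
  by (cases P) auto

lemma prog_conts_step:
  "L \<in> prog_conts P K \<Longrightarrow> fst (fst (snd (prog_step e c (L, r)))) \<in> insert K (prog_conts P K)"
proof (induction P arbitrary: K)
  case (Act f)
  then show ?case by (auto split: prod.splits)
next
  case (Seq P Q)
  then show ?case using prog_conts_start by fastforce
next
  case (While b P)
  then show ?case using prog_conts_start by fastforce
qed

lemma prog_conts_ok:
  "L \<in> prog_conts P K \<Longrightarrow> prog_ok A R S P \<Longrightarrow> list_all (prog_ok A R S) K \<Longrightarrow> list_all (prog_ok A R S) L"
  by (induction P arbitrary: K) fastforce+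

lemma prog_step_ok:
  assumes "list_all (prog_ok A R S) L" "c \<in> A" "r \<in> R" "e \<in> S"
  shows "prog_step e c (L, r) \<in> A \<times> (UNIV \<times> R) \<times> S"
proof (cases L)
  case (Cons P K)
  then show ?thesis
  proof (cases P)
    case (Act f)
    then have "f c r \<in> A \<times> R \<times> S" using Cons assms by simp
    then show ?thesis using Cons Act by (auto split: prod.splits)
  qed (use assms Cons in auto)
qed (use assms in auto)

text \<open>
  Finitely many states and cell contents of arbitrary types may be renamed into those of a
  \<open>G\<close>-machine. The renaming of cell contents must respect that a pattern letter and the blank stand
  for the initial contents of a cell; contents are therefore decoded, not encoded.
\<close>

lemma head_machine_realization:
  fixes G :: "('g, 'm) monoid_scheme" and \<delta> :: "'c \<Rightarrow> 'q \<Rightarrow> 'c \<times> 'q \<times> 'g" and ini :: "'a option \<Rightarrow> 'c"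
  assumes "group G" and S: "S \<subseteq> carrier G"
    and fin: "finite \<Sigma>" "finite A" "finite Q"
    and q0: "q0 \<in> Q" and F: "F \<subseteq> Q"
    and \<delta>: "\<And>c q. c \<in> A \<Longrightarrow> q \<in> Q \<Longrightarrow> \<delta> c q \<in> A \<times> Q \<times> S"
    and ini: "ini None \<in> A" "\<And>a. a \<in> \<Sigma> \<Longrightarrow> ini (Some a) \<in> A"
  shows "\<exists>T :: ('g, 'a) g_machine. g_machine S \<Sigma> T \<and> (\<forall>p\<in>patterns G \<Sigma>. gm_accepts G T p \<longleftrightarrow>
    (\<exists>n. snd (snd ((head_step G \<delta> ^^ n) (\<lambda>g. ini (p g), \<one>\<^bsub>G\<^esub>, q0))) \<in> F))"
proof -
  interpret group G by fact
  obtain ec :: "'c \<Rightarrow> nat" where ec: "inj_on ec A"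
    using finite_imp_inj_to_nat_seg[OF fin(2)] by blast
  obtain eq :: "'q \<Rightarrow> nat" where eq: "inj_on eq Q"
    using finite_imp_inj_to_nat_seg[OF fin(3)] by blast
  define dec where "dec x = (case x of Inl a \<Rightarrow> ini (Some a) | Inr 0 \<Rightarrow> ini None
    | Inr (Suc n) \<Rightarrow> inv_into A ec n)" for x
  define enc :: "'c \<Rightarrow> 'a + nat" where "enc c = Inr (Suc (ec c))" for c
  define uq where "uq = inv_into Q eq"
  have dec_enc: "dec (enc c) = c" if "c \<in> A" for c
    using that ec by (simp add: dec_def enc_def)
  have uq_eq: "uq (eq q) = q" if "q \<in> Q" for q
    using that eq by (simp add: uq_def)
  define Al where "Al = Inl ` \<Sigma> \<union> {Inr 0} \<union> enc ` A"
  have dec_A: "dec x \<in> A" if "x \<in> Al" for x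
    using that ini dec_enc by (auto simp: Al_def dec_def)
  define T :: "('g, 'a) g_machine" where "T = \<lparr>gm_states = eq ` Q, gm_alphabet = Al,
    gm_blank = Inr 0, gm_init = eq q0, gm_final = eq ` F,
    gm_trans = (\<lambda>(x, k). case \<delta> (dec x) (uq k) of (c, q, s) \<Rightarrow> (enc c, eq q, s))\<rparr>"
  have trans: "gm_trans T (x, eq q) = (case \<delta> (dec x) q of (c, q', s) \<Rightarrow> (enc c, eq q', s))"
    if "q \<in> Q" for x q
    using that by (simp add: T_def uq_eq)
  have "g_machine S \<Sigma> T"
    unfolding g_machine_def
  proof (intro conjI)
    show "finite (gm_states T)" "finite (gm_alphabet T)" using fin by (auto simp: T_def Al_def)
    show "Inl ` \<Sigma> \<subseteq> gm_alphabet T" "gm_blank T \<in> gm_alphabet T" "gm_blank T \<notin> Inl ` \<Sigma>"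
      by (auto simp: T_def Al_def)
    show "gm_init T \<in> gm_states T" "gm_final T \<subseteq> gm_states T" using q0 F by (auto simp: T_def)
    show "gm_trans T \<in> gm_alphabet T \<times> gm_states T \<rightarrow> gm_alphabet T \<times> gm_states T \<times> S"
    proof
      fix y assume "y \<in> gm_alphabet T \<times> gm_states T"
      then obtain x q where y: "y = (x, eq q)" "x \<in> Al" "q \<in> Q" by (auto simp: T_def)
      then show "gm_trans T y \<in> gm_alphabet T \<times> gm_states T \<times> S"
        using \<delta>[OF dec_A[OF y(2)] y(3)] trans by (auto simp: T_def Al_def split: prod.splits)
    qed
  qed
  moreover have "gm_accepts G T p \<longleftrightarrow>
      (\<exists>n. snd (snd ((head_step G \<delta> ^^ n) (\<lambda>g. ini (p g), \<one>\<^bsub>G\<^esub>, q0))) \<in> F)"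
    if p: "p \<in> patterns G \<Sigma>" for p
  proof -
    have sim: "case ((gm_step G T ^^ n) (gm_input T p, gm_init T),
        (head_step G \<delta> ^^ n) (\<lambda>g. ini (p g), \<one>\<^bsub>G\<^esub>, q0)) of ((x, k), (X, g, q)) \<Rightarrow>
        k = eq q \<and> q \<in> Q \<and> g \<in> carrier G \<and>
        (\<forall>h\<in>carrier G. x h \<in> Al \<and> dec (x h) = X (g \<otimes>\<^bsub>G\<^esub> h))" for n
    proof (induction n)
      case 0
      have "\<forall>h\<in>carrier G. gm_input T p h \<in> Al \<and> dec (gm_input T p h) = ini (p h)"
        using p by (auto simp: gm_input_def T_def Al_def dec_def patterns_def ran_def split: option.splits)
      then show ?case using q0 by (simp add: T_def)
    next
      case (Suc n)
      obtain x k X g q where c: "(gm_step G T ^^ n) (gm_input T p, gm_init T) = (x, k)"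
        "(head_step G \<delta> ^^ n) (\<lambda>g. ini (p g), \<one>\<^bsub>G\<^esub>, q0) = (X, g, q)"
        by (metis prod_cases3 surj_pair)
      with Suc have I: "k = eq q" "q \<in> Q" "g \<in> carrier G"
        "\<And>h. h \<in> carrier G \<Longrightarrow> x h \<in> Al" "\<And>h. h \<in> carrier G \<Longrightarrow> dec (x h) = X (g \<otimes>\<^bsub>G\<^esub> h)" by auto
      obtain c q' s where d: "\<delta> (X g) q = (c, q', s)" by (cases "\<delta> (X g) q") auto
      have x1: "dec (x \<one>\<^bsub>G\<^esub>) = X g" using I(3) I(5)[of "\<one>\<^bsub>G\<^esub>"] by simp
      have dd: "c \<in> A" "q' \<in> Q" "s \<in> S" "s \<in> carrier G"
        using \<delta>[OF dec_A[OF I(4)[of "\<one>\<^bsub>G\<^esub>"]] I(2)] d x1 S by auto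
      have t: "gm_trans T (x \<one>\<^bsub>G\<^esub>, k) = (enc c, eq q', s)" using trans[OF I(2)] I(1) x1 d by simp
      have "g \<otimes>\<^bsub>G\<^esub> s \<otimes>\<^bsub>G\<^esub> h = g \<longleftrightarrow> s \<otimes>\<^bsub>G\<^esub> h = \<one>\<^bsub>G\<^esub>" if "h \<in> carrier G" for h
        using that dd I(3) by (simp add: m_assoc)
      then show ?case
        using c I dd t d by (auto simp: head_step_def shift_def m_assoc dec_enc Al_def)
    qed
    have fin: "snd ((gm_step G T ^^ n) (gm_input T p, gm_init T)) \<in> gm_final T \<longleftrightarrow>
        snd (snd ((head_step G \<delta> ^^ n) (\<lambda>g. ini (p g), \<one>\<^bsub>G\<^esub>, q0))) \<in> F" for n
    proof -
      obtain x k X g q where c: "(gm_step G T ^^ n) (gm_input T p, gm_init T) = (x, k)"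
        "(head_step G \<delta> ^^ n) (\<lambda>g. ini (p g), \<one>\<^bsub>G\<^esub>, q0) = (X, g, q)"
        by (metis prod_cases3 surj_pair)
      with sim[of n] have "k = eq q" "q \<in> Q" by auto
      then show ?thesis using c F inj_onD[OF eq] by (auto simp: T_def)
    qed
    then show ?thesis unfolding gm_accepts_def by simp
  qed
  ultimately show ?thesis by blast
qed

text \<open>The empty stack is the accepting state, so that acceptance is termination of the program.\<close>

lemma program_machine_exists:
  fixes G :: "('g, 'm) monoid_scheme" and P :: "('g, 'c, 'r) prog" and ini :: "'a option \<Rightarrow> 'c"
  assumes "group G" "S \<subseteq> carrier G" "\<one>\<^bsub>G\<^esub> \<in> S" "finite \<Sigma>" "finite A" "finite R"
    and "prog_ok A R S P" "r0 \<in> R"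
    and "ini None \<in> A" "\<And>a. a \<in> \<Sigma> \<Longrightarrow> ini (Some a) \<in> A"
  shows "\<exists>T :: ('g, 'a) g_machine. g_machine S \<Sigma> T \<and> (\<forall>p\<in>patterns G \<Sigma>. gm_accepts G T p \<longleftrightarrow>
    (\<exists>n. fst (snd (snd ((head_step G (prog_step \<one>\<^bsub>G\<^esub>) ^^ n)
       (\<lambda>g. ini (p g), \<one>\<^bsub>G\<^esub>, ([P], r0))))) = []))"
proof -
  define Q where "Q = insert [] (prog_conts P []) \<times> R"
  have cl: "prog_step \<one>\<^bsub>G\<^esub> c q \<in> A \<times> Q \<times> S" if cA: "c \<in> A" and qQ: "q \<in> Q" for c q
  proof -
    obtain L r where q: "q = (L, r)" "L \<in> insert [] (prog_conts P [])" "r \<in> R"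
      using qQ by (auto simp: Q_def)
    then have "list_all (prog_ok A R S) L"
      using prog_conts_ok[of L P "[]" A R S] assms(7) by auto
    from prog_step_ok[OF this cA q(3) assms(3)]
    have "prog_step \<one>\<^bsub>G\<^esub> c q \<in> A \<times> (UNIV \<times> R) \<times> S" using q by simp
    moreover have "fst (fst (snd (prog_step \<one>\<^bsub>G\<^esub> c (L, r)))) \<in> insert [] (prog_conts P [])"
      using q(2) prog_conts_step[of L P "[]"] by auto
    ultimately show ?thesis using q(1) by (auto simp: Q_def)
  qed
  have Q: "finite Q" "([P], r0) \<in> Q" "{[]} \<times> R \<subseteq> Q"
    using assms(6,8) finite_prog_conts[of P "[]"] prog_conts_start[of P "[]"]
    unfolding Q_def by (intro finite_cartesian_product finite.insertI, blast+)
  from head_machine_realization[where \<delta> = "prog_step \<one>\<^bsub>G\<^esub>", OF assms(1,2,4,5) Q cl assms(9,10)]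
  obtain T :: "('g, 'a) g_machine" where T: "g_machine S \<Sigma> T"
    "\<forall>p\<in>patterns G \<Sigma>. gm_accepts G T p \<longleftrightarrow> (\<exists>n. snd (snd ((head_step G (prog_step \<one>\<^bsub>G\<^esub>) ^^ n)
       (\<lambda>g. ini (p g), \<one>\<^bsub>G\<^esub>, ([P], r0)))) \<in> {[]} \<times> R)" by blast
  have "snd (snd ((head_step G (prog_step \<one>\<^bsub>G\<^esub>) ^^ n) (\<lambda>g. ini (p g), \<one>\<^bsub>G\<^esub>, ([P], r0)))) \<in> Q \<and>
      range (fst ((head_step G (prog_step \<one>\<^bsub>G\<^esub>) ^^ n) (\<lambda>g. ini (p g), \<one>\<^bsub>G\<^esub>, ([P], r0)))) \<subseteq> A"
    if "p \<in> patterns G \<Sigma>" for p n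
  proof (induction n)
    case 0
    have "ini (p g) \<in> A" for g
      using that assms(9,10) by (cases "p g") (auto simp: patterns_def ran_def)
    then show ?case using Q(2) by auto
  next
    case (Suc n)
    obtain X g q where c: "(head_step G (prog_step \<one>\<^bsub>G\<^esub>) ^^ n) (\<lambda>g. ini (p g), \<one>\<^bsub>G\<^esub>, ([P], r0)) = (X, g, q)"
      by (metis prod_cases3)
    then have "X g \<in> A" "q \<in> Q" using Suc by auto
    from cl[OF this] Suc c show ?case by (auto simp: head_step_def split: prod.splits)
  qed
  then have "snd (snd ((head_step G (prog_step \<one>\<^bsub>G\<^esub>) ^^ n) (\<lambda>g. ini (p g), \<one>\<^bsub>G\<^esub>, ([P], r0)))) \<in> {[]} \<times> R \<longleftrightarrow>
      fst (snd (snd ((head_step G (prog_step \<one>\<^bsub>G\<^esub>) ^^ n) (\<lambda>g. ini (p g), \<one>\<^bsub>G\<^esub>, ([P], r0))))) = []"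
    if "p \<in> patterns G \<Sigma>" for p n
    using that by (fastforce simp: Q_def mem_Times_iff)
  then show ?thesis using T by (intro exI[of _ T]) auto
qed

text \<open>Terminating runs; the number of steps is positive so that an endless loop takes endless time.\<close>

definition (in group) runs :: "('a, 'c, 'r) prog \<Rightarrow> ('a \<Rightarrow> 'c) \<times> 'a \<times> 'r \<Rightarrow> ('a \<Rightarrow> 'c) \<times> 'a \<times> 'r \<Rightarrow> bool" where
  "runs P = (\<lambda>(X, g, r) (X', g', r'). g \<in> carrier G \<and> g' \<in> carrier G \<and>
     (\<forall>K. \<exists>m>0. (head_step G (prog_step \<one>) ^^ m) (X, g, (P # K, r)) = (X', g', (K, r'))))"

context group
begin

lemma runs_Act:
  assumes "f (X g) r = (c, r', s)" "g \<in> carrier G" "s \<in> carrier G"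
  shows "runs (Act f) (X, g, r) (X(g := c), g \<otimes> s, r')"
proof -
  have "(head_step G (prog_step \<one>) ^^ 1) (X, g, (Act f # K, r)) = (X(g := c), g \<otimes> s, (K, r'))" for K
    using assms by (simp add: head_step_def)
  then show ?thesis using assms unfolding runs_def by (auto intro!: exI[of _ "1::nat"])
qed

lemma runs_Seq:
  assumes "runs P s t" "runs Q t u"
  shows "runs (Seq P Q) s u"
proof -
  obtain X g r X1 g1 r1 X2 g2 r2 where s: "s = (X, g, r)" "t = (X1, g1, r1)" "u = (X2, g2, r2)"
    by (metis prod_cases3)
  have "\<exists>m>0. (head_step G (prog_step \<one>) ^^ m) (X, g, (Seq P Q # K, r)) = (X2, g2, (K, r2))" for K
  proof -
    obtain m where m: "(head_step G (prog_step \<one>) ^^ m) (X, g, (P # Q # K, r)) = (X1, g1, (Q # K, r1))"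
      using assms(1) s unfolding runs_def by blast
    obtain n where n: "(head_step G (prog_step \<one>) ^^ n) (X1, g1, (Q # K, r1)) = (X2, g2, (K, r2))"
      using assms(2) s unfolding runs_def by blast
    have "head_step G (prog_step \<one>) (X, g, (Seq P Q # K, r)) = (X, g, (P # Q # K, r))"
      using assms(1) s by (simp add: head_step_def runs_def)
    with m n have "(head_step G (prog_step \<one>) ^^ (n + (m + 1))) (X, g, (Seq P Q # K, r)) = (X2, g2, (K, r2))"
      by (simp only: funpow_add comp_apply) simp
    then show ?thesis by (intro exI[of _ "n + (m + 1)"]) auto
  qed
  then show ?thesis using assms s by (simp add: runs_def)
qed

lemma runs_While_False:
  assumes "\<not> b (X g) r" "g \<in> carrier G"
  shows "runs (While b P) (X, g, r) (X, g, r)"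
proof -
  have "(head_step G (prog_step \<one>) ^^ 1) (X, g, (While b P # K, r)) = (X, g, (K, r))" for K
    using assms by (simp add: head_step_def)
  then show ?thesis using assms unfolding runs_def by (auto intro!: exI[of _ "1::nat"])
qed

lemma runs_While_True:
  assumes "b (X g) r" "runs P (X, g, r) t" "runs (While b P) t u"
  shows "runs (While b P) (X, g, r) u"
proof -
  obtain X1 g1 r1 X2 g2 r2 where s: "t = (X1, g1, r1)" "u = (X2, g2, r2)"
    by (metis prod_cases3)
  have "\<exists>m>0. (head_step G (prog_step \<one>) ^^ m) (X, g, (While b P # K, r)) = (X2, g2, (K, r2))" for K
  proof -
    obtain m where m: "(head_step G (prog_step \<one>) ^^ m) (X, g, (P # While b P # K, r)) =
        (X1, g1, (While b P # K, r1))"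
      using assms(2) s unfolding runs_def by blast
    obtain n where n: "(head_step G (prog_step \<one>) ^^ n) (X1, g1, (While b P # K, r1)) = (X2, g2, (K, r2))"
      using assms(3) s unfolding runs_def by blast
    have "head_step G (prog_step \<one>) (X, g, (While b P # K, r)) = (X, g, (P # While b P # K, r))"
      using assms s by (simp add: head_step_def runs_def)
    with m n have "(head_step G (prog_step \<one>) ^^ (n + (m + 1))) (X, g, (While b P # K, r)) = (X2, g2, (K, r2))"
      by (simp only: funpow_add comp_apply) simp
    then show ?thesis by (intro exI[of _ "n + (m + 1)"]) auto
  qed
  then show ?thesis using assms s by (simp add: runs_def)
qed

text \<open>
  Since machines are deterministic, a loop whose body always ends in the next member of a sequence of
  states halts only if the loop condition fails at some member.
\<close>

lemma runs_main_loop: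
  assumes init: "runs I s0 t0" and rel0: "Rel 0 t0"
    and step: "\<And>n X g r. Rel n (X, g, r) \<Longrightarrow> b (X g) r \<Longrightarrow> \<exists>t. runs P (X, g, r) t \<and> Rel (Suc n) t"
    and cond: "\<And>n X g r. Rel n (X, g, r) \<Longrightarrow> b (X g) r \<longleftrightarrow> B n"
    and s0: "s0 = (X0, g0, r0)"
  shows "(\<exists>n. fst (snd (snd ((head_step G (prog_step \<one>) ^^ n) (X0, g0, ([Seq I (While b P)], r0))))) = [])
    \<longleftrightarrow> (\<exists>n. \<not> B n)"
proof -
  define H where "H n = (head_step G (prog_step \<one>) ^^ n) (X0, g0, ([Seq I (While b P)], r0))" for n
  have H_add: "H (m + n) = (head_step G (prog_step \<one>) ^^ m) (H n)" for m n
    by (simp add: H_def funpow_add)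
  have loop: "\<exists>m\<ge>n. \<exists>X g r. H m = (X, g, ([While b P], r)) \<and> g \<in> carrier G \<and> Rel n (X, g, r)"
    if "\<forall>k<n. B k" for n
    using that
  proof (induction n)
    case 0
    obtain X1 g1 r1 where t0: "t0 = (X1, g1, r1)" by (metis prod_cases3)
    have g: "g0 \<in> carrier G" "g1 \<in> carrier G" using init s0 t0 by (auto simp: runs_def)
    have "H 1 = (X0, g0, ([I, While b P], r0))" using g by (simp add: H_def head_step_def)
    moreover obtain m where "(head_step G (prog_step \<one>) ^^ m) (X0, g0, ([I, While b P], r0)) =
        (X1, g1, ([While b P], r1))"
      using init s0 t0 unfolding runs_def by blast
    ultimately have "H (m + 1) = (X1, g1, ([While b P], r1))" using H_add[of m 1] by simp
    then show ?case using rel0 g t0 by blast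
  next
    case (Suc n)
    then obtain m X g r where m: "m \<ge> n" "H m = (X, g, ([While b P], r))" "g \<in> carrier G" "Rel n (X, g, r)"
      by auto
    have b: "b (X g) r" using cond[OF m(4)] Suc by simp
    obtain X1 g1 r1 where t: "runs P (X, g, r) (X1, g1, r1)" "Rel (Suc n) (X1, g1, r1)"
      using step[OF m(4) b] by (metis prod_cases3)
    have "H (1 + m) = (X, g, ([P, While b P], r))"
      using m b unfolding H_add by (simp add: head_step_def)
    moreover obtain k where "(head_step G (prog_step \<one>) ^^ k) (X, g, ([P, While b P], r)) =
        (X1, g1, ([While b P], r1))"
      using t(1) unfolding runs_def by blast
    ultimately have "H (k + (1 + m)) = (X1, g1, ([While b P], r1))"
      using H_add[of k "1 + m"] by simp
    moreover have "k + (1 + m) \<ge> Suc n" using m(1) by simp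
    moreover have "g1 \<in> carrier G" using t(1) by (simp add: runs_def)
    ultimately show ?case using t(2) by blast
  qed
  have stay: "fst (snd (snd (H (m + n)))) = []" if "fst (snd (snd (H n))) = []" for m n
  proof (induction m)
    case (Suc m)
    obtain X g K r where "H (m + n) = (X, g, (K, r))" by (metis prod_cases4)
    then show ?case using Suc H_add[of 1 "m + n"] by (simp add: head_step_def)
  qed (use that in simp)
  have "(\<exists>n. fst (snd (snd (H n))) = []) \<longleftrightarrow> (\<exists>n. \<not> B n)"
  proof
    assume "\<exists>n. fst (snd (snd (H n))) = []"
    then obtain n where n: "fst (snd (snd (H n))) = []" by blast
    show "\<exists>n. \<not> B n"
    proof (rule ccontr)
      assume "\<nexists>n. \<not> B n"
      then obtain m X g r where "m \<ge> n" "H m = (X, g, ([While b P], r))" using loop[of n] by blast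
      then show False using stay[OF n, of "m - n"] by simp
    qed
  next
    assume "\<exists>n. \<not> B n"
    define n where "n = (LEAST n. \<not> B n)"
    have n: "\<not> B n" "\<forall>k<n. B k"
      using LeastI_ex[OF \<open>\<exists>n. \<not> B n\<close>] not_less_Least[of _ "\<lambda>n. \<not> B n"]
      unfolding n_def by blast+
    obtain m X g r where m: "H m = (X, g, ([While b P], r))" "g \<in> carrier G" "Rel n (X, g, r)"
      using loop[OF n(2)] by blast
    then have "\<not> b (X g) r" using cond[OF m(3)] n by simp
    then have "fst (snd (snd (H (1 + m)))) = []"
      using m unfolding H_add by (simp add: head_step_def)
    then show "\<exists>n. fst (snd (snd (H n))) = []" by blast
  qed
  then show ?thesis by (simp add: H_def)
qed

end

section \<open>An infinite array and a pebble on the group\<close>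

text \<open>
  A cell has four layers: the pattern, the label of the depth-first search, the pebble layer and the
  data. The pebble layer consists of the mark of the pebble, the generator by which the pebble left
  the cell last, and a generator pointing back to the origin.
\<close>

type_synonym ('g, 'a, 'd) cell = "'a option \<times> label \<times> (bool \<times> 'g \<times> 'g option) \<times> 'd"

type_synonym ('g, 'r) reg = "'r \<times> nat \<times> nat \<times> 'g option"

definition cells :: "('g \<Rightarrow> 'a option) \<Rightarrow> ('g \<Rightarrow> label) \<Rightarrow> ('g \<Rightarrow> bool \<times> 'g \<times> 'g option) \<Rightarrow> ('g \<Rightarrow> 'd) \<Rightarrow>
    'g \<Rightarrow> ('g, 'a, 'd) cell" where
  "cells p D P Y = (\<lambda>h. (p h, D h, P h, Y h))"

lemma (in group) runs_Act_cells:
  assumes "f (p g, D g, P g, Y g) r = ((p g, d, q, y), r', s)" "g \<in> carrier G" "s \<in> carrier G"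
    and "D' = D(g := d)" "P' = P(g := q)" "Y' = Y(g := y)" "g' = g \<otimes> s"
  shows "runs (Act f) (cells p D P Y, g, r) (cells p D' P' Y', g', r')"
proof -
  have "runs (Act f) (cells p D P Y, g, r) ((cells p D P Y)(g := (p g, d, q, y)), g \<otimes> s, r')"
    using assms by (intro runs_Act) (auto simp: cells_def)
  also have "(cells p D P Y)(g := (p g, d, q, y)) = cells p D' P' Y'"
    using assms by (auto simp: cells_def)
  finally show ?thesis using assms by simp
qed

context infinite_fg_group
begin

text \<open>
  Walking to the next vertex continues the depth-first search at the current vertex. A neighbour with the label
  \<open>Via j\<close> is a child discovered earlier and is entered like an unvisited one; thus the same
  program follows the existing array and extends it.
  The registers \<open>j\<close> and \<open>fl\<close> control the walk: \<open>fl\<close> is 0 when the \<open>j\<close>-th neighbour is to be tried,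
  1 when the head stands on that neighbour and 2 when the next vertex has been reached.
\<close>

definition walk_act :: "('g, 'a, 'd) cell \<Rightarrow> ('g, 'r) reg \<Rightarrow> ('g, 'a, 'd) cell \<times> ('g, 'r) reg \<times> 'g" where
  "walk_act = (\<lambda>(po, lb, pe, y) (r, j, fl, di).
     if j < length ss then
       if fl = 0 then ((po, lb, pe, y), (r, j, 1, di), ss ! j)
       else if lb = Unvisited \<or> lb = Via j then ((po, Via j, pe, y), (r, j, 2, di), \<one>)
       else ((po, lb, pe, y), (r, Suc j, 0, di), inv (ss ! j))
     else case lb of
         Via i \<Rightarrow> ((po, lb, pe, y), (r, Suc i, 0, di), inv (ss ! i))
       | _ \<Rightarrow> ((po, lb, pe, y), (r, j, fl, di), \<one>))"

definition walk_loop :: "('g, ('g, 'a, 'd) cell, ('g, 'r) reg) prog" where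
  "walk_loop = While (\<lambda>_ (r, j, fl, di). fl \<noteq> 2) (Act walk_act)"

definition next_prog :: "('g, ('g, 'a, 'd) cell, ('g, 'r) reg) prog" where
  "next_prog = Seq (Act (\<lambda>c (r, j, fl, di). (c, (r, 0, 0, di), \<one>))) walk_loop"

definition home_prog :: "('g, ('g, 'a, 'd) cell, ('g, 'r) reg) prog" where
  "home_prog = While (\<lambda>(po, lb, pe, y) _. lb \<noteq> Root)
     (Act (\<lambda>(po, lb, pe, y) R. ((po, lb, pe, y), R, case lb of Via i \<Rightarrow> inv (ss ! i) | _ \<Rightarrow> \<one>)))"

definition apply_act :: "('d \<Rightarrow> 'r \<Rightarrow> 'd \<times> 'r) \<Rightarrow> ('g, 'a, 'd) cell \<Rightarrow> ('g, 'r) reg \<Rightarrow>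
    ('g, 'a, 'd) cell \<times> ('g, 'r) reg \<times> 'g" where
  "apply_act f = (\<lambda>(po, lb, pe, y) (r, j, fl, di).
     case f y r of (y', r') \<Rightarrow> ((po, lb, pe, y'), (r', j, fl, di), \<one>))"

definition sweep_loop :: "('d \<Rightarrow> 'r \<Rightarrow> 'd \<times> 'r) \<Rightarrow> ('d \<Rightarrow> bool) \<Rightarrow> ('g, ('g, 'a, 'd) cell, ('g, 'r) reg) prog" where
  "sweep_loop f stop = While (\<lambda>(po, lb, pe, y) _. \<not> stop y) (Seq next_prog (Act (apply_act f)))"

definition sweep_prog :: "('d \<Rightarrow> 'r \<Rightarrow> 'd \<times> 'r) \<Rightarrow> ('d \<Rightarrow> bool) \<Rightarrow> ('g, ('g, 'a, 'd) cell, ('g, 'r) reg) prog" where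
  "sweep_prog f stop = Seq (Act (apply_act f)) (Seq (sweep_loop f stop) home_prog)"

text \<open>A quiet step takes one or two rounds of the loop.\<close>

lemma runs_walk_quiet_step:
  assumes "quiet_step D (v, j) (v', j')" and v: "v \<in> carrier G"
    and rest: "runs walk_loop (cells p D P Y, v', (r, j', 0, di)) t"
  shows "runs walk_loop (cells p D P Y, v, (r, j, 0, di)) t"
proof (cases "j < length ss")
  case True
  then have q: "D (v \<otimes> ss ! j) \<noteq> Unvisited" "D (v \<otimes> ss ! j) \<noteq> Via j" "v' = v" "j' = Suc j"
    using assms(1) by (auto simp: quiet_step_def)
  have "runs walk_loop (cells p D P Y, v \<otimes> ss ! j, (r, j, 1, di)) t"
    unfolding walk_loop_def
    by (rule runs_While_True[OF _ _ rest[unfolded walk_loop_def]], simp,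
        rule runs_Act_cells[where d = "D (v \<otimes> ss ! j)" and s = "inv (ss ! j)"])
      (use True q v in \<open>auto simp: walk_act_def m_assoc\<close>)
  then show ?thesis
    unfolding walk_loop_def
    by (rule runs_While_True[rotated 2], simp,
        intro runs_Act_cells[where d = "D v" and s = "ss ! j"])
      (use True v in \<open>auto simp: walk_act_def\<close>)
next
  case False
  then obtain i where i: "i < length ss" "D v = Via i" "v' = v \<otimes> inv (ss ! i)" "j' = Suc i"
    using assms(1) by (auto simp: quiet_step_def)
  show ?thesis
    unfolding walk_loop_def
    by (rule runs_While_True[OF _ _ rest[unfolded walk_loop_def]], simp,
        rule runs_Act_cells[where d = "D v" and s = "inv (ss ! i)"])
      (use False i v in \<open>auto simp: walk_act_def\<close>)
qed

lemma quiet_step_closed: "quiet_step D (v, j) (v', j') \<Longrightarrow> v \<in> carrier G \<Longrightarrow> v' \<in> carrier G"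
  by (auto simp: quiet_step_def)

lemma runs_walk_quiet_steps:
  assumes "(quiet_step D)\<^sup>*\<^sup>* (v, j) (v', j')" and "v \<in> carrier G"
    and "runs walk_loop (cells p D P Y, v', (r, j', 0, di)) t"
  shows "runs walk_loop (cells p D P Y, v, (r, j, 0, di)) t"
  using assms
proof (induction "(v, j)" arbitrary: v j rule: converse_rtranclp_induct)
  case (step x)
  obtain v1 j1 where x: "x = (v1, j1)" by (cases x)
  have "v1 \<in> carrier G" using quiet_step_closed step.hyps(1) step.prems(1) unfolding x by blast
  then have "runs walk_loop (cells p D P Y, v1, (r, j1, 0, di)) t" using step.hyps(3) step.prems(2) x by blast
  with step.hyps(1)[unfolded x] step.prems(1) show ?case by (rule runs_walk_quiet_step)
qed simp

end

context dfs_enumeration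
begin

text \<open>
  Here \<open>N\<close> is the index of the last discovered vertex. If \<open>i < N\<close>, the labels do not change.
\<close>

lemma runs_next:
  assumes "i \<le> N"
  shows "runs next_prog (cells p (D N) P Y, a i, (r, j, fl, di))
    (cells p (D (max N (Suc i))) P Y, a (Suc i), (r, l i, 2, di))"
proof -
  obtain u where u: "D i u \<noteq> Unvisited" "u \<in> carrier G" "a (Suc i) = u \<otimes> ss ! l i"
    "(quiet_step (D i))\<^sup>*\<^sup>* (a i, 0) (u, l i)"
    using a_Suc[of i] by blast
  have li: "l i < length ss" by (rule l_less)
  have D: "(D N (a (Suc i)) = Unvisited \<or> D N (a (Suc i)) = Via (l i)) \<and>
    D (max N (Suc i)) = (D N)(a (Suc i) := Via (l i))"
  proof (cases "i = N")
    case True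
    then show ?thesis using a_new[of N] D_Suc[of N] by (simp add: max_def)
  next
    case False
    then have "max N (Suc i) = N" "D N (a (Suc i)) = Via (l i)"
      using assms D_a_Suc[of i N] by simp_all
    then show ?thesis by (metis fun_upd_triv)
  qed
  obtain E where EM: "D (max N (Suc i)) = E" and E: "E = (D N)(a (Suc i) := Via (l i))"
    and D1: "D N (a (Suc i)) = Unvisited \<or> D N (a (Suc i)) = Via (l i)"
    using D by blast
  have "runs walk_loop (cells p (E) P Y, a (Suc i), (r, l i, 2, di))
      (cells p (E) P Y, a (Suc i), (r, l i, 2, di))"
    unfolding walk_loop_def by (rule runs_While_False) auto
  then have "runs walk_loop (cells p (D N) P Y, a (Suc i), (r, l i, 1, di))
      (cells p (E) P Y, a (Suc i), (r, l i, 2, di))"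
    unfolding walk_loop_def
    by (rule runs_While_True[rotated 2], simp,
        intro runs_Act_cells[where d = "Via (l i)" and s = "\<one>"])
      (use D1 E li in \<open>auto simp: walk_act_def\<close>)
  then have "runs walk_loop (cells p (D N) P Y, u, (r, l i, 0, di))
      (cells p (E) P Y, a (Suc i), (r, l i, 2, di))"
    unfolding walk_loop_def
    by (rule runs_While_True[rotated 2], simp,
        intro runs_Act_cells[where d = "D N u" and s = "ss ! l i"])
      (use u li in \<open>auto simp: walk_act_def\<close>)
  then have "runs walk_loop (cells p (D N) P Y, a i, (r, 0, 0, di))
      (cells p (E) P Y, a (Suc i), (r, l i, 2, di))"
    by (rule runs_walk_quiet_steps[OF quiet_steps_mono[OF assms u(4)] a_closed])
  then show ?thesis
    unfolding next_prog_def EM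
    by (rule runs_Seq[rotated], intro runs_Act_cells[where d = "D N (a i)" and s = "\<one>"]) auto
qed

lemma runs_home: "i \<le> N \<Longrightarrow> runs home_prog (cells p (D N) P Y, a i, R) (cells p (D N) P Y, \<one>, R)"
proof (induction i rule: less_induct)
  case (less i)
  show ?case
  proof (cases i)
    case 0
    show ?thesis unfolding home_prog_def 0 a_0
      by (rule runs_While_False) (auto simp: cells_def D_root_iff)
  next
    case (Suc k)
    obtain m where m: "m \<le> k" "a (Suc k) \<otimes> inv (ss ! l k) = a m" using a_parent[of k] by blast
    have d: "D N (a (Suc k)) = Via (l k)" using D_a_Suc[of k N] less.prems Suc by simp
    have "runs home_prog (cells p (D N) P Y, a m, R) (cells p (D N) P Y, \<one>, R)"
      using less m Suc by simp
    then show ?thesis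
      unfolding home_prog_def Suc
      by (rule runs_While_True[rotated 2], simp add: cells_def d,
          intro runs_Act_cells[where d = "D N (a (Suc k))" and s = "inv (ss ! l k)"])
        (use m d l_less[of k] in auto)
  qed
qed

end

subsection \<open>Sweeps\<close>

text \<open>
  A sweep passes through the array from the left with a finite transducer and stops behind the first
  entry that satisfies \<open>stop\<close> after its update.
\<close>

primrec sweep_reg :: "('d \<Rightarrow> 'r \<Rightarrow> 'd \<times> 'r) \<Rightarrow> (nat \<Rightarrow> 'd) \<Rightarrow> 'r \<Rightarrow> nat \<Rightarrow> 'r" where
  "sweep_reg f Z r 0 = r"
| "sweep_reg f Z r (Suc i) = snd (f (Z i) (sweep_reg f Z r i))"

definition sweep_out :: "('d \<Rightarrow> 'r \<Rightarrow> 'd \<times> 'r) \<Rightarrow> (nat \<Rightarrow> 'd) \<Rightarrow> 'r \<Rightarrow> nat \<Rightarrow> 'd" where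
  "sweep_out f Z r i = fst (f (Z i) (sweep_reg f Z r i))"

definition sweep_array :: "('d \<Rightarrow> 'r \<Rightarrow> 'd \<times> 'r) \<Rightarrow> (nat \<Rightarrow> 'd) \<Rightarrow> 'r \<Rightarrow> nat \<Rightarrow> nat \<Rightarrow> 'd" where
  "sweep_array f Z r n = (\<lambda>i. if i < n then sweep_out f Z r i else Z i)"

definition sweep_length :: "('d \<Rightarrow> 'r \<Rightarrow> 'd \<times> 'r) \<Rightarrow> ('d \<Rightarrow> bool) \<Rightarrow> (nat \<Rightarrow> 'd) \<Rightarrow> 'r \<Rightarrow> nat" where
  "sweep_length f stop Z r = Suc (LEAST i. stop (sweep_out f Z r i))"

context dfs_enumeration
begin

text \<open>
  An array \<open>Z\<close> is stored in a data layer \<open>Y\<close> if \<open>Y \<circ> a = Z\<close>. All entries of the infinite array thus have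
  a value, also those whose vertices have not been discovered yet.
\<close>

lemma array_update: "Y(a i := y) \<circ> a = (Y \<circ> a)(i := y)"
  using a_inj by (auto simp: fun_eq_iff inj_eq)

lemma runs_apply_act:
  assumes "Y \<circ> a = sweep_array f Z r i" "R = (sweep_reg f Z r i, j, fl, di)"
  shows "\<exists>Y'. Y' \<circ> a = sweep_array f Z r (Suc i) \<and>
    runs (Act (apply_act f)) (cells p E P Y, a i, R) (cells p E P Y', a i, (sweep_reg f Z r (Suc i), j, fl, di))"
proof (intro exI conjI)
  have y: "Y (a i) = Z i" using fun_cong[OF assms(1), of i] by (simp add: sweep_array_def)
  show "Y(a i := sweep_out f Z r i) \<circ> a = sweep_array f Z r (Suc i)"
    unfolding array_update assms(1) by (auto simp: sweep_array_def fun_eq_iff)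
  show "runs (Act (apply_act f)) (cells p E P Y, a i, R)
      (cells p E P (Y(a i := sweep_out f Z r i)), a i, (sweep_reg f Z r (Suc i), j, fl, di))"
    by (rule runs_Act_cells[where d = "E (a i)" and s = "\<one>"])
      (use y assms(2) in \<open>auto simp: apply_act_def sweep_out_def split: prod.splits\<close>)
qed

lemma runs_sweep_loop:
  assumes "Y \<circ> a = sweep_array f Z r (Suc i)" "i \<le> N" "n = sweep_length f stop Z r"
    and "stop (sweep_out f Z r k)" "Suc i \<le> n"
  shows "\<exists>N' Y' j' fl'. n \<le> Suc N' \<and> Y' \<circ> a = sweep_array f Z r n \<and>
    runs (sweep_loop f stop) (cells p (D N) P Y, a i, (sweep_reg f Z r (Suc i), j, fl, di))
      (cells p (D N') P Y', a (n - 1), (sweep_reg f Z r n, j', fl', di))"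
  using assms
proof (induction "n - Suc i" arbitrary: i Y N j fl)
  case 0
  then have n: "n = Suc i" by simp
  have "stop (sweep_out f Z r i)"
    using n 0 LeastI[of "\<lambda>i. stop (sweep_out f Z r i)" k] by (simp add: sweep_length_def)
  moreover have "Y (a i) = sweep_out f Z r i" using fun_cong[OF 0(2), of i] by (simp add: sweep_array_def)
  ultimately have "runs (sweep_loop f stop) (cells p (D N) P Y, a i, (sweep_reg f Z r (Suc i), j, fl, di))
      (cells p (D N) P Y, a i, (sweep_reg f Z r (Suc i), j, fl, di))"
    unfolding sweep_loop_def by (intro runs_While_False) (auto simp: cells_def)
  then show ?case using 0 n by fastforce
next
  case (Suc d)
  have nl: "\<not> stop (sweep_out f Z r i)"
    using Suc not_less_Least[of i "\<lambda>i. stop (sweep_out f Z r i)"] by (auto simp: sweep_length_def)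
  have y: "Y (a i) = sweep_out f Z r i" using fun_cong[OF Suc(3), of i] by (simp add: sweep_array_def)
  obtain Y1 where Y1: "Y1 \<circ> a = sweep_array f Z r (Suc (Suc i))"
    "runs (Act (apply_act f)) (cells p (D (max N (Suc i))) P Y, a (Suc i), (sweep_reg f Z r (Suc i), l i, 2, di))
      (cells p (D (max N (Suc i))) P Y1, a (Suc i), (sweep_reg f Z r (Suc (Suc i)), l i, 2, di))"
    using runs_apply_act[OF Suc(3) refl, where E = "D (max N (Suc i))"] by blast
  obtain N' Y' j' fl' where IH: "n \<le> Suc N'" "Y' \<circ> a = sweep_array f Z r n"
    "runs (sweep_loop f stop) (cells p (D (max N (Suc i))) P Y1, a (Suc i), (sweep_reg f Z r (Suc (Suc i)), l i, 2, di))
      (cells p (D N') P Y', a (n - 1), (sweep_reg f Z r n, j', fl', di))"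
    using Suc(1)[OF _ Y1(1) _ Suc(5,6), of "max N (Suc i)" "l i" 2] Suc(2) by fastforce
  have "runs (sweep_loop f stop) (cells p (D N) P Y, a i, (sweep_reg f Z r (Suc i), j, fl, di))
      (cells p (D N') P Y', a (n - 1), (sweep_reg f Z r n, j', fl', di))"
    using IH(3) unfolding sweep_loop_def
    by (rule runs_While_True[rotated 2])
      (use nl y in \<open>simp add: cells_def\<close>, rule runs_Seq[OF runs_next[OF Suc(4)] Y1(2)])
  then show ?case using IH by blast
qed

lemma runs_sweep:
  assumes Y: "Y \<circ> a = Z" and k: "stop (sweep_out f Z r k)" and n: "n = sweep_length f stop Z r"
  shows "\<exists>N' Y' j' fl'. Y' \<circ> a = sweep_array f Z r n \<and>
    runs (sweep_prog f stop) (cells p (D N) P Y, \<one>, (r, j, fl, di))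
      (cells p (D N') P Y', \<one>, (sweep_reg f Z r n, j', fl', di))"
proof -
  obtain Y1 where Y1: "Y1 \<circ> a = sweep_array f Z r (Suc 0)"
    "runs (Act (apply_act f)) (cells p (D N) P Y, a 0, (r, j, fl, di))
      (cells p (D N) P Y1, a 0, (sweep_reg f Z r (Suc 0), j, fl, di))"
    using runs_apply_act[of Y f Z r 0 "(r, j, fl, di)" j fl di p "D N" P] Y by (auto simp: sweep_array_def)
  have n1: "Suc 0 \<le> n" by (simp add: n sweep_length_def)
  obtain N' Y' j' fl' where L: "n \<le> Suc N'" "Y' \<circ> a = sweep_array f Z r n"
    "runs (sweep_loop f stop) (cells p (D N) P Y1, a 0, (sweep_reg f Z r (Suc 0), j, fl, di))
      (cells p (D N') P Y', a (n - 1), (sweep_reg f Z r n, j', fl', di))"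
    using runs_sweep_loop[where p = p and P = P, OF Y1(1) le0 n k n1, of N j fl di] by blast
  have "n - 1 \<le> N'" using L(1) by simp
  from runs_Seq[OF Y1(2) runs_Seq[OF L(3) runs_home[OF this]]] L(2) show ?thesis
    unfolding sweep_prog_def a_0 by blast
qed

end

subsection \<open>The pebble\<close>

text \<open>
  A trail is the path that is obtained from the origin by following the last exits recorded in the
  pebble layer; it leads to the pebble. The exits of cells off the trail do no harm, since the pebble
  records a new exit whenever it leaves a cell again. Hence no exits have to be erased when the pebble
  is reset.
\<close>

context infinite_fg_group
begin

definition trail :: "('g \<Rightarrow> bool \<times> 'g \<times> 'g option) \<Rightarrow> (nat \<Rightarrow> 'g) \<Rightarrow> nat \<Rightarrow> bool" where
  "trail P x n \<longleftrightarrow> x 0 = \<one> \<and> inj_on x {..n} \<and>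
     (\<forall>i<n. fst (snd (P (x i))) \<in> set ss \<and> x (Suc i) = x i \<otimes> fst (snd (P (x i)))) \<and>
     (\<forall>h\<in>carrier G. fst (P h) \<longleftrightarrow> h = x n)"

definition pebble_at :: "('g \<Rightarrow> bool \<times> 'g \<times> 'g option) \<Rightarrow> 'g \<Rightarrow> bool" where
  "pebble_at P g \<longleftrightarrow> (\<exists>x n. trail P x n \<and> g = x n)"

definition trail_back :: "('g \<Rightarrow> bool \<times> 'g \<times> 'g option) \<Rightarrow> (nat \<Rightarrow> 'g) \<Rightarrow> nat \<Rightarrow> 'g option" where
  "trail_back P x i = (case i of 0 \<Rightarrow> None | Suc k \<Rightarrow> Some (fst (snd (P (x k)))))"

text \<open>
  The head writes the way back into the cells of the trail afresh on each walk to the pebble.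
\<close>

definition seek_loop :: "('g, ('g, 'a, 'd) cell, ('g, 'r) reg) prog" where
  "seek_loop = While (\<lambda>(po, lb, (mk, ex, ba), y) _. \<not> mk)
     (Act (\<lambda>(po, lb, (mk, ex, ba), y) (r, j, fl, di). ((po, lb, (mk, ex, di), y), (r, j, fl, Some ex), ex)))"

definition back_loop :: "('r \<Rightarrow> bool) \<Rightarrow> ('g, ('g, 'a, 'd) cell, ('g, 'r) reg) prog" where
  "back_loop b = While (\<lambda>(po, lb, (mk, ex, ba), y) (r, j, fl, di). b r \<and> ba \<noteq> None)
     (Act (\<lambda>(po, lb, (mk, ex, ba), y) R. ((po, lb, (mk, ex, ba), y), R,
        case ba of None \<Rightarrow> \<one> | Some s \<Rightarrow> inv s)))"

definition move_pebble :: "'g \<Rightarrow> 'g option \<Rightarrow> 'g" where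
  "move_pebble g m = (case m of None \<Rightarrow> \<one> | Some s \<Rightarrow> g \<otimes> s)"

text \<open>
  The move \<open>None\<close> resets the pebble to the origin: in this case the head returns first and then puts
  the pebble down. In the case \<open>Some s\<close> it puts the pebble down on the neighbour and then returns, so
  that one of the two loops at the end of the program is idle.
\<close>

definition pebble_prog :: "('r \<Rightarrow> 'g option) \<Rightarrow> ('r \<Rightarrow> bool \<Rightarrow> 'a option \<Rightarrow> 'r) \<Rightarrow>
    ('g, ('g, 'a, 'd) cell, ('g, 'r) reg) prog" where
  "pebble_prog mov upd =
     Seq (Act (\<lambda>c (r, j, fl, di). (c, (r, j, fl, None), \<one>)))
    (Seq seek_loop
    (Seq (Act (\<lambda>(po, lb, (mk, ex, ba), y) (r, j, fl, di).
           case mov r of None \<Rightarrow> ((po, lb, (False, ex, di), y), (r, j, fl, di), \<one>)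
           | Some s \<Rightarrow> ((po, lb, (False, s, di), y), (r, j, fl, di), s)))
    (Seq (back_loop (\<lambda>r. mov r = None))
    (Seq (Act (\<lambda>(po, lb, (mk, ex, ba), y) (r, j, fl, di).
           ((po, lb, (True, ex, ba), y), (upd r (lb = Root) po, j, fl, di),
            case mov r of None \<Rightarrow> \<one> | Some s \<Rightarrow> inv s)))
      (back_loop (\<lambda>_. True))))))"

lemma trail_closed:
  assumes "trail P x n" "i \<le> n"
  shows "x i \<in> carrier G"
  using assms(2)
proof (induction i)
  case (Suc i)
  then show ?case using assms(1) by (simp add: trail_def)
qed (use assms in \<open>simp add: trail_def\<close>)

text \<open>
  The loop invariant: the cells of the trail before the \<open>i\<close>-th one have received their way back. As the trail is
  injective, none of them is overwritten later.
\<close>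

lemma runs_seek_loop:
  assumes tr: "trail P x n" and "i \<le> n"
    and "\<And>h. fst (P1 h) = fst (P h) \<and> fst (snd (P1 h)) = fst (snd (P h))"
    and "\<And>m. m < i \<Longrightarrow> snd (snd (P1 (x m))) = trail_back P x m"
  shows "\<exists>P2. (\<forall>h. fst (P2 h) = fst (P h) \<and> fst (snd (P2 h)) = fst (snd (P h))) \<and>
    (\<forall>m<n. snd (snd (P2 (x m))) = trail_back P x m) \<and>
    runs seek_loop (cells p E P1 Y, x i, (r, j, fl, trail_back P x i)) (cells p E P2 Y, x n, (r, j, fl, trail_back P x n))"
  using assms(2-)
proof (induction "n - i" arbitrary: i P1)
  case 0
  then have i: "i = n" by simp
  have c: "x n \<in> carrier G" using trail_closed[OF tr] by simp
  then have "fst (P1 (x n))" using 0 tr by (simp add: trail_def)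
  then have "runs seek_loop (cells p E P1 Y, x i, (r, j, fl, trail_back P x i)) (cells p E P1 Y, x n, (r, j, fl, trail_back P x n))"
    unfolding seek_loop_def i using c by (intro runs_While_False) (auto simp: cells_def split: prod.splits)
  then show ?case using 0 i by blast
next
  case (Suc d)
  then have lt: "i < n" by simp
  have c: "x i \<in> carrier G" using trail_closed[OF tr] lt by simp
  have ne: "x i \<noteq> x m" if "m \<le> n" "m \<noteq> i" for m
    using tr lt that by (auto simp: trail_def inj_on_def)
  define s where "s = fst (snd (P (x i)))"
  have s: "s \<in> set ss" "x (Suc i) = x i \<otimes> s" using tr lt by (auto simp: trail_def s_def)
  define P2 where "P2 = P1(x i := (fst (P1 (x i)), s, trail_back P x i))"
  have "\<exists>P3. (\<forall>h. fst (P3 h) = fst (P h) \<and> fst (snd (P3 h)) = fst (snd (P h))) \<and>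
    (\<forall>m<n. snd (snd (P3 (x m))) = trail_back P x m) \<and>
    runs seek_loop (cells p E P2 Y, x (Suc i), (r, j, fl, trail_back P x (Suc i))) (cells p E P3 Y, x n, (r, j, fl, trail_back P x n))"
  proof (rule Suc(1))
    show "d = n - Suc i" "Suc i \<le> n" using Suc by auto
    show "fst (P2 h) = fst (P h) \<and> fst (snd (P2 h)) = fst (snd (P h))" for h
      using Suc(4)[of h] by (cases "h = x i") (auto simp: P2_def s_def)
    show "snd (snd (P2 (x m))) = trail_back P x m" if "m < Suc i" for m
      using Suc(5)[of m] ne[of m] that lt by (cases "m = i") (auto simp: P2_def)
  qed
  then obtain P3 where P3: "\<forall>h. fst (P3 h) = fst (P h) \<and> fst (snd (P3 h)) = fst (snd (P h))"
    "\<forall>m<n. snd (snd (P3 (x m))) = trail_back P x m"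
    "runs seek_loop (cells p E P2 Y, x (Suc i), (r, j, fl, trail_back P x (Suc i))) (cells p E P3 Y, x n, (r, j, fl, trail_back P x n))"
    by blast
  obtain ba where P1: "P1 (x i) = (False, s, ba)"
    using Suc(4)[of "x i"] tr c ne[of n] lt by (cases "P1 (x i)") (auto simp: trail_def s_def)
  have "runs seek_loop (cells p E P1 Y, x i, (r, j, fl, trail_back P x i)) (cells p E P3 Y, x n, (r, j, fl, trail_back P x n))"
    using P3(3) unfolding seek_loop_def
    by (rule runs_While_True[rotated 2], simp add: cells_def P1,
        intro runs_Act_cells[where d = "E (x i)" and s = s])
      (use P1 s c s_def in \<open>auto simp: P2_def trail_back_def\<close>)
  then show ?case using P3 by blast
qed

lemma runs_back_loop:
  assumes tr: "trail P x n" and ba: "\<And>m. m \<le> n \<Longrightarrow> snd (snd (P1 (x m))) = trail_back P x m"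
    and "i \<le> n" "b r"
  shows "runs (back_loop b) (cells p E P1 Y, x i, (r, j, fl, di)) (cells p E P1 Y, \<one>, (r, j, fl, di))"
  using assms(3)
proof (induction i)
  case 0
  have "x 0 = \<one>" using tr by (simp add: trail_def)
  then show ?case unfolding back_loop_def using ba[of 0]
    by (simp, intro runs_While_False) (auto simp: cells_def trail_back_def split: prod.splits)
next
  case (Suc i)
  define s where "s = fst (snd (P (x i)))"
  have s: "s \<in> set ss" "x (Suc i) = x i \<otimes> s" using tr Suc by (auto simp: trail_def s_def)
  have c: "x i \<in> carrier G" "x (Suc i) \<in> carrier G" using trail_closed[OF tr] Suc by auto
  obtain mk ex where P1: "P1 (x (Suc i)) = (mk, ex, Some s)"
    using ba[of "Suc i"] Suc by (cases "P1 (x (Suc i))") (auto simp: trail_back_def s_def)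
  have "runs (back_loop b) (cells p E P1 Y, x i, (r, j, fl, di)) (cells p E P1 Y, \<one>, (r, j, fl, di))"
    using Suc by simp
  then show ?case
    unfolding back_loop_def
    by (rule runs_While_True[rotated 2], simp add: cells_def P1 \<open>b r\<close>,
        intro runs_Act_cells[where d = "E (x (Suc i))" and s = "inv s"])
      (use P1 s c in \<open>auto simp: m_assoc\<close>)
qed

text \<open>
  If the pebble moves to a cell of its trail, the trail is cut there; otherwise it becomes longer by one
  cell. In both cases the new exit belongs to the old place of the pebble, whose exit was not part of the trail.
\<close>

lemma runs_pebble:
  assumes pe: "pebble_at P g" and op: "\<And>s. mov r = Some s \<Longrightarrow> s \<in> set ss"
    and E: "\<And>h. E h = Root \<longleftrightarrow> h = \<one>"
  defines "g' \<equiv> move_pebble g (mov r)"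
  shows "\<exists>P' di'. pebble_at P' g' \<and> runs (pebble_prog mov upd) (cells p E P Y, \<one>, (r, j, fl, di))
    (cells p E P' Y, \<one>, (upd r (g' = \<one>) (p g'), j, fl, di'))"
proof -
  obtain x n where tr: "trail P x n" and g: "g = x n" using pe by (auto simp: pebble_at_def)
  have x0: "x 0 = \<one>" using tr by (simp add: trail_def)
  have c: "x n \<in> carrier G" using trail_closed[OF tr] by simp
  have b0: "trail_back P x 0 = None" by (simp add: trail_back_def)
  have R1: "runs (Act (\<lambda>c (r, j, fl, di). (c, (r, j, fl, None), \<one>))) (cells p E P Y, \<one>, (r, j, fl, di))
      (cells p E P Y, x 0, (r, j, fl, trail_back P x 0))"
    unfolding x0 b0 by (rule runs_Act_cells[where d = "E \<one>" and s = "\<one>"]) auto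
  have "\<exists>P2. (\<forall>h. fst (P2 h) = fst (P h) \<and> fst (snd (P2 h)) = fst (snd (P h))) \<and>
    (\<forall>m<n. snd (snd (P2 (x m))) = trail_back P x m) \<and>
    runs seek_loop (cells p E P Y, x 0, (r, j, fl, trail_back P x 0)) (cells p E P2 Y, x n, (r, j, fl, trail_back P x n))"
    by (rule runs_seek_loop[OF tr le0]) auto
  then obtain P2 where P2: "\<forall>h. fst (P2 h) = fst (P h) \<and> fst (snd (P2 h)) = fst (snd (P h))"
    "\<forall>m<n. snd (snd (P2 (x m))) = trail_back P x m" and
    R2: "runs seek_loop (cells p E P Y, x 0, (r, j, fl, trail_back P x 0)) (cells p E P2 Y, x n, (r, j, fl, trail_back P x n))"
    by blast
  define ex where "ex = (case mov r of None \<Rightarrow> fst (snd (P2 (x n))) | Some s \<Rightarrow> s)"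
  define P3 where "P3 = P2(x n := (False, ex, trail_back P x n))"
  define y where "y = (case mov r of None \<Rightarrow> x n | Some s \<Rightarrow> x n \<otimes> s)"
  have yc: "y \<in> carrier G" using c op by (auto simp: y_def split: option.splits)
  have g'c: "g' \<in> carrier G" using c op by (auto simp: g'_def g move_pebble_def split: option.splits)
  have R3: "runs (Act (\<lambda>(po, lb, (mk, ex, ba), y) (r, j, fl, di).
           case mov r of None \<Rightarrow> ((po, lb, (False, ex, di), y), (r, j, fl, di), \<one>)
           | Some s \<Rightarrow> ((po, lb, (False, s, di), y), (r, j, fl, di), s)))
     (cells p E P2 Y, x n, (r, j, fl, trail_back P x n)) (cells p E P3 Y, y, (r, j, fl, trail_back P x n))"
    by (cases "mov r"; cases "P2 (x n)";
        rule runs_Act_cells[where d = "E (x n)" and s = "case mov r of None \<Rightarrow> \<one> | Some s \<Rightarrow> s"])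
      (use c op in \<open>auto simp: P3_def y_def ex_def\<close>)
  have ne: "x m \<noteq> x n" if "m < n" for m
    using tr that by (auto simp: trail_def inj_on_def)
  have ba: "snd (snd (P3 (x m))) = trail_back P x m" if "m \<le> n" for m
    using P2(2) ne[of m] that by (cases "m = n") (auto simp: P3_def)
  have R4: "runs (back_loop (\<lambda>r. mov r = None)) (cells p E P3 Y, y, (r, j, fl, trail_back P x n))
      (cells p E P3 Y, g', (r, j, fl, trail_back P x n))"
  proof (cases "mov r")
    case None
    then show ?thesis
      using runs_back_loop[OF tr ba order_refl, where b = "\<lambda>r. mov r = None"]
      by (simp add: y_def g'_def move_pebble_def)
  next
    case (Some s)
    then have "y = g'" by (simp add: y_def g'_def g move_pebble_def)
    then show ?thesis unfolding back_loop_def using Some yc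
      by (simp, intro runs_While_False) (auto split: prod.splits)
  qed
  define P4 where "P4 = P3(g' := (True, snd (P3 g')))"
  define z where "z = (case mov r of None \<Rightarrow> \<one> | Some s \<Rightarrow> x n)"
  let ?t = "(upd r (g' = \<one>) (p g'), j, fl, trail_back P x n)"
  have z: "z = g' \<otimes> (case mov r of None \<Rightarrow> \<one> | Some s \<Rightarrow> inv s)"
    using c op by (auto simp: z_def g'_def g move_pebble_def m_assoc split: option.splits)
  have R5: "runs (Act (\<lambda>(po, lb, (mk, ex, ba), y) (r, j, fl, di).
           ((po, lb, (True, ex, ba), y), (upd r (lb = Root) po, j, fl, di),
            case mov r of None \<Rightarrow> \<one> | Some s \<Rightarrow> inv s)))
      (cells p E P3 Y, g', (r, j, fl, trail_back P x n)) (cells p E P4 Y, z, ?t)"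
    by (rule runs_Act_cells[where d = "E g'" and s = "case mov r of None \<Rightarrow> \<one> | Some s \<Rightarrow> inv s"])
      (use z g'c op E in \<open>auto simp: P4_def split: prod.splits option.splits\<close>)
  have ba4: "snd (snd (P4 (x m))) = trail_back P x m" if "m \<le> n" for m
    using ba[OF that] by (auto simp: P4_def)
  have "\<exists>k\<le>n. z = x k"
    using x0 by (auto simp: z_def split: option.splits)
  then have R6: "runs (back_loop (\<lambda>_. True)) (cells p E P4 Y, z, ?t) (cells p E P4 Y, \<one>, ?t)"
    using runs_back_loop[OF tr ba4, where b = "\<lambda>_. True"] by auto
  have mark: "\<forall>h\<in>carrier G. fst (P4 h) \<longleftrightarrow> h = g'"
    using tr P2(1) by (auto simp: P4_def P3_def trail_def)
  have ex4: "fst (snd (P4 h)) = fst (snd (P h))" if "h \<noteq> x n" for h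
    using P2(1) that by (simp add: P4_def P3_def)
  have ex4n: "fst (snd (P4 (x n))) = ex" by (simp add: P4_def P3_def)
  have "pebble_at P4 g'"
  proof (cases "mov r")
    case None
    then have "trail P4 x 0" using mark x0 by (simp add: trail_def g'_def move_pebble_def)
    then show ?thesis using None x0 by (auto simp: pebble_at_def g'_def move_pebble_def intro!: exI[of _ x] exI[of _ "0::nat"])
  next
    case (Some s)
    then have g': "g' = x n \<otimes> s" and s: "s \<in> set ss" "ex = s"
      using op by (auto simp: g'_def g move_pebble_def ex_def)
    have old: "fst (snd (P4 (x i))) \<in> set ss \<and> x (Suc i) = x i \<otimes> fst (snd (P4 (x i)))" if "i < n" for i
      using tr that ex4[OF ne[OF that]] by (simp add: trail_def)
    show ?thesis
    proof (cases "\<exists>k\<le>n. g' = x k")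
      case True
      \<comment> \<open>the pebble returns to its trail, which loses a loop\<close>
      then obtain k where k: "k \<le> n" "g' = x k" by blast
      have "inj_on x {..k}" using tr k by (auto simp: trail_def intro: inj_on_subset)
      then have "trail P4 x k" using mark old k x0 by (simp add: trail_def)
      then show ?thesis using k by (auto simp: pebble_at_def)
    next
      case False
      define x' where "x' = x(Suc n := g')"
      have eq: "x' i = x i" if "i \<le> n" for i using that by (simp add: x'_def)
      have "inj_on x {..n}" using tr by (simp add: trail_def)
      then have "inj_on x' {..n}" using eq by (simp add: inj_on_def)
      moreover have "x' (Suc n) \<notin> x' ` {..n}" using False eq by (auto simp: x'_def)
      ultimately have "inj_on x' {..Suc n}" by (simp add: atMost_Suc)
      moreover have "fst (snd (P4 (x' i))) \<in> set ss \<and> x' (Suc i) = x' i \<otimes> fst (snd (P4 (x' i)))"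
        if "i < Suc n" for i
      proof (cases "i = n")
        case True
        then show ?thesis using ex4n s g' by (simp add: x'_def)
      next
        case False
        then show ?thesis using old[of i] eq that by simp
      qed
      ultimately have "trail P4 x' (Suc n)" using mark x0 eq[of 0] by (simp add: trail_def x'_def)
      then show ?thesis by (auto simp: pebble_at_def x'_def intro!: exI[of _ x'] exI[of _ "Suc n"])
    qed
  qed
  moreover have "runs (pebble_prog mov upd) (cells p E P Y, \<one>, (r, j, fl, di)) (cells p E P4 Y, \<one>, ?t)"
    unfolding pebble_prog_def by (intro runs_Seq[OF R1] runs_Seq[OF R2] runs_Seq[OF R3] runs_Seq[OF R4] runs_Seq[OF R5] R6)
  ultimately show ?thesis by blast
qed

end

subsection \<open>Sweep machines\<close>

text \<open>
  A step of a sweep machine consists of a sweep through the array and a move of the pebble. After the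
  move the register is told whether the pebble is at the origin and which letter of the pattern it has
  found.
\<close>

definition (in infinite_fg_group) sweep_step :: "('d \<Rightarrow> 'r \<Rightarrow> 'd \<times> 'r) \<Rightarrow> ('d \<Rightarrow> bool) \<Rightarrow> ('r \<Rightarrow> 'g option) \<Rightarrow>
    ('r \<Rightarrow> bool \<Rightarrow> 'a option \<Rightarrow> 'r) \<Rightarrow> ('g \<rightharpoonup> 'a) \<Rightarrow> (nat \<Rightarrow> 'd) \<times> 'g \<times> 'r \<Rightarrow> (nat \<Rightarrow> 'd) \<times> 'g \<times> 'r" where
  "sweep_step f stop mov upd p = (\<lambda>(Z, g, r).
     let n = sweep_length f stop Z r; r' = sweep_reg f Z r n; g' = move_pebble g (mov r')
     in (sweep_array f Z r n, g', upd r' (g' = \<one>) (p g')))"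

context infinite_fg_group
begin

definition opt_of :: "'b set \<Rightarrow> 'b option set" where
  "opt_of A = insert None (Some ` A)"

definition all_cells :: "'a set \<Rightarrow> 'd set \<Rightarrow> ('g, 'a, 'd) cell set" where
  "all_cells \<Sigma> A = opt_of \<Sigma> \<times> ({Unvisited, Root} \<union> Via ` {..<length ss}) \<times>
     (UNIV \<times> set ss \<times> opt_of (set ss)) \<times> A"

definition all_regs :: "'r set \<Rightarrow> ('g, 'r) reg set" where
  "all_regs R = R \<times> {..length ss} \<times> {..2} \<times> opt_of (set ss)"

lemma sweep_prog_ok:
  assumes f: "\<And>y r. y \<in> A \<Longrightarrow> r \<in> R \<Longrightarrow> f y r \<in> A \<times> R"
  shows "prog_ok (all_cells \<Sigma> A) (all_regs R) (set ss) (sweep_prog f stop)"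
proof -
  have "walk_act c r \<in> all_cells \<Sigma> A \<times> all_regs R \<times> set ss"
    if cr: "c \<in> all_cells \<Sigma> A" "r \<in> all_regs R" for c r
  proof -
    obtain po lb pe y q j fl di where c: "c = (po, lb, pe, y)" "r = (q, j, fl, di)"
      by (metis prod_cases4)
    have m: "po \<in> opt_of \<Sigma>" "lb \<in> {Unvisited, Root} \<union> Via ` {..<length ss}"
      "pe \<in> UNIV \<times> set ss \<times> opt_of (set ss)" "y \<in> A" "q \<in> R" "j \<le> length ss" "fl \<le> 2" "di \<in> opt_of (set ss)"
      using cr c by (simp_all add: all_cells_def all_regs_def)
    have iv: "inv (ss ! i) \<in> set ss" if "i < length ss" for i using that inv_gen by simp
    show ?thesis
    proof (cases "j < length ss")
      case True
      then show ?thesis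
        using m iv[OF True] one_gen unfolding c walk_act_def all_cells_def all_regs_def
        by (simp, blast)
    next
      case False
      show ?thesis
      proof (cases lb)
        case (Via i)
        then have i: "i < length ss" using m(2) by auto
        then show ?thesis
          using False m(1,3-) Via iv[OF i] unfolding c walk_act_def all_cells_def all_regs_def by simp
      qed (use False m one_gen in \<open>simp_all add: c walk_act_def all_cells_def all_regs_def\<close>)
    qed
  qed
  moreover have "apply_act f c r \<in> all_cells \<Sigma> A \<times> all_regs R \<times> set ss"
    if cr: "c \<in> all_cells \<Sigma> A" "r \<in> all_regs R" for c r
  proof -
    obtain po lb pe y q j fl di where c: "c = (po, lb, pe, y)" "r = (q, j, fl, di)"
      by (metis prod_cases4)
    then have "f y q \<in> A \<times> R" using f cr by (simp add: all_cells_def all_regs_def)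
    then show ?thesis
      using c cr one_gen by (auto simp: apply_act_def all_cells_def all_regs_def split: prod.splits)
  qed
  ultimately show ?thesis
    using one_gen inv_gen
    by (auto simp: sweep_prog_def sweep_loop_def next_prog_def walk_loop_def home_prog_def
        all_cells_def all_regs_def split: label.splits)
qed

lemma pebble_prog_ok:
  assumes mov: "\<And>r s. r \<in> R \<Longrightarrow> mov r = Some s \<Longrightarrow> s \<in> set ss"
    and upd: "\<And>r b po. r \<in> R \<Longrightarrow> po \<in> opt_of \<Sigma> \<Longrightarrow> upd r b po \<in> R"
  shows "prog_ok (all_cells \<Sigma> A) (all_regs R) (set ss) (pebble_prog mov upd)"
  using one_gen inv_gen mov upd
  by (auto simp: pebble_prog_def seek_loop_def back_loop_def all_cells_def all_regs_def opt_of_def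
      split: option.splits)

text \<open>
  The program consists of the initialization at the origin and of a loop whose body is a sweep followed
  by a move of the pebble. The loop ends when the register is accepting; as each round terminates, the program
  terminates if and only if the sweep machine reaches an accepting register.
\<close>

lemma sweep_machine_exists:
  fixes f :: "'d \<Rightarrow> 'r \<Rightarrow> 'd \<times> 'r" and upd :: "'r \<Rightarrow> bool \<Rightarrow> 'a option \<Rightarrow> 'r"
    and stop :: "'d \<Rightarrow> bool" and mov :: "'r \<Rightarrow> 'g option" and y0 :: 'd and r0 :: 'r and acc :: "'r \<Rightarrow> bool"
  assumes fin: "finite \<Sigma>" "finite A" "finite R" and y0: "y0 \<in> A" and r0: "r0 \<in> R"
    and f: "\<And>y r. y \<in> A \<Longrightarrow> r \<in> R \<Longrightarrow> f y r \<in> A \<times> R"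
    and mov: "\<And>r s. r \<in> R \<Longrightarrow> mov r = Some s \<Longrightarrow> s \<in> set ss"
    and upd: "\<And>r b po. r \<in> R \<Longrightarrow> po \<in> opt_of \<Sigma> \<Longrightarrow> upd r b po \<in> R"
  defines "conf \<equiv> \<lambda>p n. (sweep_step f stop mov upd p ^^ n) (\<lambda>_. y0, \<one>, upd r0 True (p \<one>))"
  assumes halts: "\<And>p n Z g r. p \<in> patterns G \<Sigma> \<Longrightarrow> conf p n = (Z, g, r) \<Longrightarrow> \<exists>k. stop (sweep_out f Z r k)"
  shows "\<exists>T :: ('g, 'a) g_machine. g_machine (set ss) \<Sigma> T \<and>
    (\<forall>p\<in>patterns G \<Sigma>. gm_accepts G T p \<longleftrightarrow> (\<exists>n. acc (snd (snd (conf p n)))))"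
proof -
  obtain D a l where "dfs_enumeration G ss D a l" using dfs_enumeration_exists by blast
  then interpret dfs_enumeration G ss D a l .
  define init :: "('g, 'a, 'd) cell \<Rightarrow> ('g, 'r) reg \<Rightarrow> ('g, 'a, 'd) cell \<times> ('g, 'r) reg \<times> 'g" where
    "init = (\<lambda>(po, lb, (mk, ex, ba), y) (r, j, fl, di).
       ((po, Root, (True, ex, ba), y), (upd r True po, j, fl, di), \<one>))"
  define body where "body = Seq (sweep_prog f stop) (pebble_prog mov upd)"
  define ini :: "'a option \<Rightarrow> ('g, 'a, 'd) cell" where "ini = (\<lambda>po. (po, Unvisited, (False, \<one>, None), y0))"
  define b :: "('g, 'a, 'd) cell \<Rightarrow> ('g, 'r) reg \<Rightarrow> bool" where "b = (\<lambda>_ R. \<not> acc (fst R))"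
  have ok: "prog_ok (all_cells \<Sigma> A) (all_regs R) (set ss) (Seq (Act init) (While b body))"
    using sweep_prog_ok[of A R f \<Sigma> stop] f pebble_prog_ok[of R mov \<Sigma> upd A] mov upd one_gen
    by (auto simp: body_def init_def all_cells_def all_regs_def)
  have "finite (all_cells \<Sigma> A)" "finite (all_regs R)"
    using fin by (auto simp: all_cells_def all_regs_def opt_of_def)
  moreover have "(r0, 0, 0, None) \<in> all_regs R" using r0 by (simp add: all_regs_def opt_of_def)
  moreover have "ini None \<in> all_cells \<Sigma> A" "\<And>x. x \<in> \<Sigma> \<Longrightarrow> ini (Some x) \<in> all_cells \<Sigma> A"
    using y0 one_gen by (auto simp: ini_def all_cells_def opt_of_def)
  ultimately obtain T :: "('g, 'a) g_machine" where T: "g_machine (set ss) \<Sigma> T"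
    "\<forall>p\<in>patterns G \<Sigma>. gm_accepts G T p \<longleftrightarrow>
      (\<exists>n. fst (snd (snd ((head_step G (prog_step \<one>) ^^ n)
         (\<lambda>g. ini (p g), \<one>, ([Seq (Act init) (While b body)], (r0, 0, 0, None)))))) = [])"
    using program_machine_exists[OF is_group gens_carrier one_gen fin(1) _ _ ok] by blast
  have "(\<exists>n. fst (snd (snd ((head_step G (prog_step \<one>) ^^ n)
         (\<lambda>g. ini (p g), \<one>, ([Seq (Act init) (While b body)], (r0, 0, 0, None)))))) = [])
      \<longleftrightarrow> (\<exists>n. acc (snd (snd (conf p n))))" if p: "p \<in> patterns G \<Sigma>" for p
  proof -
    have po: "p h \<in> opt_of \<Sigma>" for h
      using p by (cases "p h") (auto simp: patterns_def opt_of_def ran_def)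
    have conf_Suc: "conf p (Suc n) = sweep_step f stop mov upd p (conf p n)" for n
      by (simp add: conf_def)
    have reg: "sweep_reg f Z r i \<in> R" if "\<And>i. Z i \<in> A" "r \<in> R" for Z r i
      using that(2) f[OF that(1)] by (induction i) (auto simp: mem_Times_iff)
    have closed: "(\<forall>i. fst (conf p n) i \<in> A) \<and> snd (snd (conf p n)) \<in> R" for n
    proof (induction n)
      case 0
      then show ?case using y0 upd[OF r0 po] by (simp add: conf_def)
    next
      case (Suc n)
      obtain Z g r where c: "conf p n = (Z, g, r)" by (metis prod_cases3)
      have "sweep_out f Z r i \<in> A" for i
        using f[of "Z i" "sweep_reg f Z r i"] reg[of Z r i] Suc c by (auto simp: sweep_out_def mem_Times_iff)
      then show ?case
        using Suc c upd[OF reg po] by (auto simp: conf_Suc sweep_step_def Let_def sweep_array_def)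
    qed
    define Rel where "Rel n t \<longleftrightarrow> (\<exists>N P Y j fl di. t = (cells p (D N) P Y, \<one>, (snd (snd (conf p n)), j, fl, di)) \<and>
      Y \<circ> a = fst (conf p n) \<and> pebble_at P (fst (snd (conf p n))))" for n and t :: "('g \<Rightarrow> ('g, 'a, 'd) cell) \<times> 'g \<times> ('g, 'r) reg"
    define P0 :: "'g \<Rightarrow> bool \<times> 'g \<times> 'g option" where "P0 = (\<lambda>_. (False, \<one>, None))"
    have "(\<exists>n. fst (snd (snd ((head_step G (prog_step \<one>) ^^ n)
         (\<lambda>g. ini (p g), \<one>, ([Seq (Act init) (While b body)], (r0, 0, 0, None)))))) = [])
      \<longleftrightarrow> (\<exists>n. \<not> \<not> acc (snd (snd (conf p n))))"
    proof (rule runs_main_loop[where Rel = Rel and B = "\<lambda>n. \<not> acc (snd (snd (conf p n)))"])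
      show "runs (Act init) (cells p (\<lambda>_. Unvisited) P0 (\<lambda>_. y0), \<one>, (r0, 0, 0, None))
        (cells p (D 0) (P0(\<one> := (True, \<one>, None))) (\<lambda>_. y0), \<one>, (upd r0 True (p \<one>), 0, 0, None))"
        by (rule runs_Act_cells[where d = Root and s = \<one>]) (auto simp: init_def P0_def D_0)
      show "(cells p (\<lambda>_. Unvisited) P0 (\<lambda>_. y0), \<one>, (r0, 0, 0, None)) = (\<lambda>g. ini (p g), \<one>, (r0, 0, 0, None))"
        by (simp add: ini_def cells_def P0_def)
      have "trail (P0(\<one> := (True, \<one>, None))) (\<lambda>_. \<one>) 0" by (simp add: trail_def P0_def)
      then have "pebble_at (P0(\<one> := (True, \<one>, None))) \<one>" unfolding pebble_at_def by blast
      then show "Rel 0 (cells p (D 0) (P0(\<one> := (True, \<one>, None))) (\<lambda>_. y0), \<one>, (upd r0 True (p \<one>), 0, 0, None))"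
        unfolding Rel_def conf_def
        by (intro exI[of _ "0::nat"] exI[of _ "P0(\<one> := (True, \<one>, None))"] exI[of _ "\<lambda>_. y0"]
              exI[of _ "0::nat"] exI[of _ "0::nat"] exI[of _ None])
          (simp add: comp_def)
    next
      fix n X g R'
      assume "Rel n (X, g, R')"
      then obtain N P Y j fl di where X: "X = cells p (D N) P Y" "g = \<one>"
        "R' = (snd (snd (conf p n)), j, fl, di)" "Y \<circ> a = fst (conf p n)" "pebble_at P (fst (snd (conf p n)))"
        unfolding Rel_def by blast
      show "b (X g) R' \<longleftrightarrow> \<not> acc (snd (snd (conf p n)))" by (simp add: b_def X)
      obtain Z gp r where c: "conf p n = (Z, gp, r)" by (metis prod_cases3)
      obtain k where k: "stop (sweep_out f Z r k)" using halts[OF p c] by blast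
      define m where "m = sweep_length f stop Z r"
      define r1 where "r1 = sweep_reg f Z r m"
      have r1: "r1 \<in> R" using reg closed[of n] c by (simp add: r1_def)
      obtain N' Y' j' fl' where S: "Y' \<circ> a = sweep_array f Z r m"
        "runs (sweep_prog f stop) (X, g, R') (cells p (D N') P Y', \<one>, (r1, j', fl', di))"
        using runs_sweep[OF _ k m_def, of Y p N P j fl di] X c by (auto simp: r1_def)
      obtain P' di' where P': "pebble_at P' (move_pebble gp (mov r1))"
        "runs (pebble_prog mov upd) (cells p (D N') P Y', \<one>, (r1, j', fl', di))
          (cells p (D N') P' Y', \<one>, (upd r1 (move_pebble gp (mov r1) = \<one>) (p (move_pebble gp (mov r1))), j', fl', di'))"
        using runs_pebble[of P gp mov r1 "D N'" upd p Y' j' fl' di] mov[OF r1] D_root_iff X(5) c by auto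
      have c': "conf p (Suc n) = (sweep_array f Z r m, move_pebble gp (mov r1),
          upd r1 (move_pebble gp (mov r1) = \<one>) (p (move_pebble gp (mov r1))))"
        by (simp add: conf_Suc c sweep_step_def Let_def m_def r1_def)
      have "Rel (Suc n) (cells p (D N') P' Y', \<one>, (upd r1 (move_pebble gp (mov r1) = \<one>) (p (move_pebble gp (mov r1))), j', fl', di'))"
        unfolding Rel_def c' using S(1) P'(1) by auto
      then show "\<exists>t. runs body (X, g, R') t \<and> Rel (Suc n) t"
        using runs_Seq[OF S(2) P'(2)] unfolding body_def by blast
    qed
    then show ?thesis by simp
  qed
  then show ?thesis using T by blast
qed

end

section \<open>Simulating machines with choices\<close>

text \<open>
  A machine with choices has a two-way infinite tape, initially blank, and a pebble on the group; each
  of its steps consumes one letter of a word of choices.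
\<close>

type_synonym ('k, 'y, 'a, 'g) choice_trans = "nat \<Rightarrow> 'k \<Rightarrow> 'y \<Rightarrow> bool \<Rightarrow> 'a option \<Rightarrow> 'k \<times> 'y \<times> tape_move \<times> 'g option"

definition (in infinite_fg_group) choice_step :: "('k, 'y, 'a, 'g) choice_trans \<Rightarrow> ('g \<rightharpoonup> 'a) \<Rightarrow> nat \<Rightarrow>
    'k \<times> (int \<Rightarrow> 'y) \<times> int \<times> 'g \<Rightarrow> 'k \<times> (int \<Rightarrow> 'y) \<times> int \<times> 'g" where
  "choice_step \<delta> p c = (\<lambda>(k, t, h, g). case \<delta> c k (t h) (g = \<one>) (p g) of
     (k', y, d, m) \<Rightarrow> (k', t(h := y), h + move_offset d, move_pebble g m))"

definition (in infinite_fg_group) choice_run :: "('k, 'y, 'a, 'g) choice_trans \<Rightarrow> 'k \<Rightarrow> 'y \<Rightarrow> ('g \<rightharpoonup> 'a) \<Rightarrow> nat list \<Rightarrow>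
    'k \<times> (int \<Rightarrow> 'y) \<times> int \<times> 'g" where
  "choice_run \<delta> k0 bl p ds = foldl (\<lambda>x c. choice_step \<delta> p c x) (k0, \<lambda>_. bl, 0, \<one>) ds"

text \<open>
  All words over \<open>{1..b}\<close> are enumerated by counting in the bijective numeration to the base \<open>b\<close>, the
  least digit first.
\<close>

fun count_up :: "nat \<Rightarrow> nat list \<Rightarrow> nat list" where
  "count_up b [] = [1]"
| "count_up b (d # ds) = (if d = b then 1 # count_up b ds else Suc d # ds)"

fun bij_value :: "nat \<Rightarrow> nat list \<Rightarrow> nat" where
  "bij_value b [] = 0"
| "bij_value b (d # ds) = d + b * bij_value b ds"

lemma bij_value_count_up: "bij_value b (count_up b ds) = Suc (bij_value b ds)"
  by (induction ds) auto

lemma count_up_surj: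
  assumes "0 < b" "ds \<in> lists {1..b}" "ds \<noteq> []"
  shows "\<exists>es\<in>lists {1..b}. ds = count_up b es"
  using assms(2,3)
proof (induction ds rule: list.induct)
  case (Cons d ds)
  show ?case
  proof (cases "d = 1")
    case False
    moreover have "1 \<le> d" "d \<le> b" using Cons.prems(1) by simp_all
    ultimately have "d - 1 \<in> {1..b}" "d - 1 \<noteq> b" "Suc (d - 1) = d" by auto
    then show ?thesis using Cons.prems by (intro bexI[of _ "(d - 1) # ds"]) auto
  next
    case True
    show ?thesis
    proof (cases ds)
      case Nil
      then show ?thesis using True by (intro bexI[of _ "[]"]) auto
    next
      case (Cons c cs)
      then obtain es where "es \<in> lists {1..b}" "ds = count_up b es"
        using Cons.IH Cons.prems by auto
      then show ?thesis using True assms(1) by (intro bexI[of _ "b # es"]) auto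
    qed
  qed
qed simp

lemma count_up_induct:
  assumes "0 < b" "Q []" "\<And>ds. ds \<in> lists {1..b} \<Longrightarrow> Q ds \<Longrightarrow> Q (count_up b ds)" "ds \<in> lists {1..b}"
  shows "Q ds"
  using assms(4)
proof (induction "bij_value b ds" arbitrary: ds rule: less_induct)
  case less
  show ?case
  proof (cases "ds = []")
    case False
    then obtain es where "es \<in> lists {1..b}" "ds = count_up b es"
      using count_up_surj[OF assms(1) less.prems] by blast
    then show ?thesis using less.hyps[of es] assms(3) bij_value_count_up by simp
  qed (use assms(2) in simp)
qed

lemma count_up_lists: "0 < b \<Longrightarrow> ds \<in> lists {1..b} \<Longrightarrow> count_up b ds \<in> lists {1..b}"
  by (induction ds) auto

text \<open>In the array, words are padded with zeros, and a zero marks the end.\<close>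

definition pad :: "nat list \<Rightarrow> nat \<Rightarrow> nat" where
  "pad ds i = (if i < length ds then ds ! i else 0)"

lemma pad_Cons: "pad (d # ds) i = (case i of 0 \<Rightarrow> d | Suc j \<Rightarrow> pad ds j)"
  by (simp add: pad_def split: nat.splits)

lemma pad_eq_0_iff:
  assumes "ds \<in> lists {1..b}"
  shows "pad ds i = 0 \<longleftrightarrow> length ds \<le> i"
proof -
  have "ds ! i \<noteq> 0" if "i < length ds"
    using assms nth_mem[OF that] by (metis atLeastAtMost_iff in_listsD not_one_le_zero)
  then show ?thesis by (auto simp: pad_def)
qed

text \<open>
  Counting up changes the digits before the first one different from \<open>b\<close>, and this digit. If all digits are
  equal to \<open>b\<close>, it is the padding zero behind them, and the word becomes longer.
\<close>

lemma pad_count_up: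
  assumes "0 < b"
  shows "\<exists>q. (\<forall>i<q. pad ds i = b) \<and> pad ds q \<noteq> b \<and> q < length (count_up b ds) \<and> 
    pad (count_up b ds) = (\<lambda>i. if i < q then 1 else if i = q then Suc (pad ds q) else pad ds i)"
proof (induction ds)
  case Nil
  then show ?case using assms by (intro exI[of _ 0]) (auto simp: pad_def fun_eq_iff)
next
  case (Cons d ds)
  show ?case
  proof (cases "d = b")
    case True
    obtain q where q: "\<forall>i<q. pad ds i = b" "pad ds q \<noteq> b" "q < length (count_up b ds)"
      "pad (count_up b ds) = (\<lambda>i. if i < q then 1 else if i = q then Suc (pad ds q) else pad ds i)"
      using Cons by blast
    then show ?thesis using True
      by (intro exI[of _ "Suc q"]) (auto simp: pad_Cons fun_eq_iff split: nat.splits)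
  next
    case False
    then show ?thesis by (intro exI[of _ 0]) (auto simp: pad_Cons fun_eq_iff split: nat.splits)
  qed
qed

subsection \<open>The transducer\<close>

text \<open>
  An array entry consists of a choice letter (or 0 behind the last one), two tape symbols and a marker.
  The tape is stored relative to the head: the \<open>j\<close>-th entry holds the symbols at the positions \<open>h + j\<close>
  and \<open>h - 1 - j\<close>. Whenever a step is simulated, this representation moves by one entry to the right
  in the array. The entry at its beginning carries the marker. So the \<open>t\<close>-th step is
  simulated when the beginning is the \<open>t\<close>-th entry, whose choice letter the step consumes, and a
  sweep from the left always has seen the old entries \<open>j - 1\<close>, \<open>j\<close> and \<open>j + 1\<close> when it has to write
  the new entry \<open>j\<close>. The right end does not move; what is lost there is out of reach
  of the head during the remaining steps.

  The phases 0, 1 and 2 of the register belong to the entries before, at and behind the new beginning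
  in the simulation of a step; 3 and 4 propagate the carry when counting, 3 standing for the first entry;
  5 is the rest of counting; phase 6 says that the choices have been used up. The two pairs of symbols
  in the register are the two entries seen last.
\<close>

type_synonym 'y entry = "nat \<times> 'y \<times> 'y \<times> bool"

type_synonym ('k, 'y, 'a, 'g) sim_reg =
  "nat \<times> 'k \<times> ('y \<times> 'y) \<times> ('y \<times> 'y) \<times> tape_move \<times> 'g option \<times> bool \<times> 'a option"

definition shifted :: "tape_move \<Rightarrow> 'y \<times> 'y \<Rightarrow> 'y \<times> 'y \<Rightarrow> 'y \<times> 'y \<Rightarrow> 'y \<times> 'y" where
  "shifted d x y z = (case d of MoveL \<Rightarrow> (fst x, snd z) | MoveN \<Rightarrow> y | MoveR \<Rightarrow> (fst z, snd x))"

definition sim_trans :: "('k, 'y, 'a, 'g) choice_trans \<Rightarrow> nat \<Rightarrow> 'k \<Rightarrow> 'y \<Rightarrow>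
    'y entry \<Rightarrow> ('k, 'y, 'a, 'g) sim_reg \<Rightarrow> 'y entry \<times> ('k, 'y, 'a, 'g) sim_reg" where
  "sim_trans \<delta> b k0 bl = (\<lambda>(c, R, L, st) (ph, k, x, y, d, m, hm, po).
     if ph = 0 then
       if \<not> st then ((c, R, L, st), (ph, k, x, y, d, m, hm, po))
       else if c = 0 then ((c, R, L, False), (6, k, x, y, d, None, hm, po))
       else case \<delta> c k R hm po of (k', z, d', m') \<Rightarrow>
         ((c, R, L, False), (1, k', (L, z), (z, L), d', m', hm, po))
     else if ph \<le> 2 then
       ((c, fst (shifted d x y (R, L)), snd (shifted d x y (R, L)), ph = 1), (2, k, y, (R, L), d, m, hm, po))
     else if ph \<le> 4 then
       if c = b then ((1, bl, bl, ph = 3), (4, k0, x, y, d, None, hm, po))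
       else ((Suc c, bl, bl, ph = 3), (5, k0, x, y, d, None, hm, po))
     else ((c, bl, bl, False), (ph, k, x, y, d, m, hm, po)))"

definition sim_stop :: "'y entry \<Rightarrow> bool" where "sim_stop z \<longleftrightarrow> fst z = 0"

definition sim_move :: "('k, 'y, 'a, 'g) sim_reg \<Rightarrow> 'g option" where
  "sim_move = (\<lambda>(ph, k, x, y, d, m, hm, po). m)"

definition sim_upd :: "('k, 'y, 'a, 'g) sim_reg \<Rightarrow> bool \<Rightarrow> 'a option \<Rightarrow> ('k, 'y, 'a, 'g) sim_reg" where
  "sim_upd = (\<lambda>(ph, k, x, y, d, m, hm, po) hm' po'. (if ph = 6 then 3 else 0, k, x, y, d, m, hm', po'))"

text \<open>A way to evaluate a sweep: guess the registers \<open>\<rho> i\<close> before the entries and check them.\<close>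

lemma sweep_eval:
  assumes "\<rho> 0 = r" "\<And>i. i \<le> n \<Longrightarrow> snd (f (Z i) (\<rho> i)) = \<rho> (Suc i)"
    and "\<And>i. i < n \<Longrightarrow> \<not> stop (fst (f (Z i) (\<rho> i)))" "stop (fst (f (Z n) (\<rho> n)))"
  shows "sweep_length f stop Z r = Suc n" "sweep_reg f Z r (Suc n) = \<rho> (Suc n)"
    "sweep_array f Z r (Suc n) = (\<lambda>i. if i \<le> n then fst (f (Z i) (\<rho> i)) else Z i)"
    "stop (sweep_out f Z r n)"
proof -
  have reg: "sweep_reg f Z r i = \<rho> i" if "i \<le> Suc n" for i
    using that by (induction i) (auto simp: assms)
  have out: "sweep_out f Z r i = fst (f (Z i) (\<rho> i))" if "i \<le> n" for i
    using that by (simp add: sweep_out_def reg)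
  show "stop (sweep_out f Z r n)" using assms(4) out by simp
  have "(LEAST i. stop (sweep_out f Z r i)) = n"
  proof (rule Least_equality)
    show "n \<le> i" if "stop (sweep_out f Z r i)" for i
      using that assms(3) out by (metis less_imp_le not_le_imp_less)
  qed (use assms(4) out in simp)
  then show "sweep_length f stop Z r = Suc n" by (simp add: sweep_length_def)
  show "sweep_reg f Z r (Suc n) = \<rho> (Suc n)" using reg by blast
  show "sweep_array f Z r (Suc n) = (\<lambda>i. if i \<le> n then fst (f (Z i) (\<rho> i)) else Z i)"
    by (auto simp: sweep_array_def out fun_eq_iff less_Suc_eq_le)
qed

context infinite_fg_group
begin

lemma sweep_step_eval:
  assumes "\<rho> 0 = r" "\<And>i. i \<le> n \<Longrightarrow> snd (f (Z i) (\<rho> i)) = \<rho> (Suc i)"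
    and "\<And>i. i < n \<Longrightarrow> \<not> stop (fst (f (Z i) (\<rho> i)))" "stop (fst (f (Z n) (\<rho> n)))"
    and "g' = move_pebble g (mov (\<rho> (Suc n)))"
  shows "sweep_step f stop mov upd p (Z, g, r) =
    ((\<lambda>i. if i \<le> n then fst (f (Z i) (\<rho> i)) else Z i), g', upd (\<rho> (Suc n)) (g' = \<one>) (p g'))"
  using sweep_eval(1,2,3)[where f = f and Z = Z and stop = stop and n = n and \<rho> = \<rho>, OF assms(1-4)]
  by (simp add: sweep_step_def Let_def assms(5) del: sweep_reg.simps)

text \<open>
  Between two sweeps the array either represents the state after the first \<open>t\<close> choices of \<open>ds\<close>, or all choices
  of \<open>ds\<close> are used up and the next sweep will count up. In the first case only the entries before the end
  of \<open>ds\<close> represent the tape.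
\<close>

definition simulates :: "('k, 'y, 'a, 'g) choice_trans \<Rightarrow> nat \<Rightarrow> 'k \<Rightarrow> 'y \<Rightarrow> ('g \<rightharpoonup> 'a) \<Rightarrow> nat list \<Rightarrow> nat \<Rightarrow>
    (nat \<Rightarrow> 'y entry) \<times> 'g \<times> ('k, 'y, 'a, 'g) sim_reg \<Rightarrow> bool" where
  "simulates \<delta> b k0 bl p ds t = (\<lambda>(Z, g, r). t \<le> length ds \<and> ds \<in> lists {1..b} \<and>
     (\<exists>k T h x y d m. choice_run \<delta> k0 bl p (take t ds) = (k, T, h, g) \<and>
        r = (0, k, x, y, d, m, g = \<one>, p g) \<and>
        (\<forall>i. fst (Z i) = pad ds i) \<and> (\<forall>i\<le>length ds. snd (snd (snd (Z i))) \<longleftrightarrow> i = t) \<and>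
        (\<forall>j. t + j < length ds \<longrightarrow> fst (snd (Z (t + j))) = T (h + int j) \<and>
           fst (snd (snd (Z (t + j)))) = T (h - 1 - int j))))"

definition exhausted :: "('k, 'y, 'a, 'g) choice_trans \<Rightarrow> nat \<Rightarrow> 'k \<Rightarrow> 'y \<Rightarrow> ('g \<rightharpoonup> 'a) \<Rightarrow> nat list \<Rightarrow>
    (nat \<Rightarrow> 'y entry) \<times> 'g \<times> ('k, 'y, 'a, 'g) sim_reg \<Rightarrow> bool" where
  "exhausted \<delta> b k0 bl p ds = (\<lambda>(Z, g, r). ds \<in> lists {1..b} \<and> (\<forall>i. fst (Z i) = pad ds i) \<and>
     (\<exists>x y d m hm po. r = (3, fst (choice_run \<delta> k0 bl p ds), x, y, d, m, hm, po)))"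

text \<open>
  For \<open>j = 0\<close> the first pair is the virtual entry before the beginning, with which the simulation of a step
  initializes the register.
\<close>

lemma shifted_tape:
  "shifted d (T (h + j - 1), T (h - j)) (T (h + j), T (h - 1 - j)) (T (h + j + 1), T (h - 2 - j)) =
    (T (h + move_offset d + j), T (h + move_offset d - 1 - j))" for T :: "int \<Rightarrow> 'y"
  by (cases d) (auto simp: shifted_def algebra_simps)

lemma sim_step:
  assumes G: "simulates \<delta> b k0 bl p ds t (Z, g, r)" and t: "t < length ds"
  shows "simulates \<delta> b k0 bl p ds (Suc t) (sweep_step (sim_trans \<delta> b k0 bl) sim_stop sim_move sim_upd p (Z, g, r))"
    "\<exists>n. sim_stop (sweep_out (sim_trans \<delta> b k0 bl) Z r n)"
proof -
  let ?f = "sim_trans \<delta> b k0 bl"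
  obtain k T h x0 y0 d0 m0 where C: "choice_run \<delta> k0 bl p (take t ds) = (k, T, h, g)"
    and r: "r = (0, k, x0, y0, d0, m0, g = \<one>, p g)" and Z1: "\<And>i. fst (Z i) = pad ds i"
    and Z2: "\<And>i. i \<le> length ds \<Longrightarrow> snd (snd (snd (Z i))) \<longleftrightarrow> i = t"
    and Z3: "\<And>j. t + j < length ds \<Longrightarrow> fst (snd (Z (t + j))) = T (h + int j) \<and>
           fst (snd (snd (Z (t + j)))) = T (h - 1 - int j)"
    and ds: "ds \<in> lists {1..b}"
    using G by (auto simp: simulates_def)
  obtain k' s d m where \<delta>: "\<delta> (ds ! t) k (T h) (g = \<one>) (p g) = (k', s, d, m)" by (metis prod_cases4)
  define T' where "T' = T(h := s)"
  \<comment> \<open>\<open>w i\<close> is the old entry \<open>i\<close> after the head has written, and \<open>u i\<close> is the entry two places before \<open>i\<close>,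
      or the virtual entry\<close>
  define w where "w i = (if i = t then (s, T (h - 1)) else (fst (snd (Z i)), fst (snd (snd (Z i)))))" for i
  define u where "u i = (if i = Suc t then (T (h - 1), s) else w (i - 2))" for i
  have w: "w i = (T' (h + int (i - t)), T' (h - 1 - int (i - t)))" if "t \<le> i" "i < length ds" for i
    using Z3[of "i - t"] that by (auto simp: w_def T'_def)
  have u: "u i = (T' (h + int (i - Suc t) - 1), T' (h - int (i - Suc t)))" if "t < i" "i \<le> length ds" for i
  proof (cases "i = Suc t")
    case False
    then have "u i = w (i - 2)" "t \<le> i - 2" "i - 2 < length ds" "int (i - Suc t) = int (i - 2 - t) + 1"
      using that t by (auto simp: u_def)
    then show ?thesis using w[of "i - 2"] by (simp add: algebra_simps)
  qed (simp add: u_def T'_def)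
  define \<rho> where "\<rho> i = (if i \<le> t then r else (if i = Suc t then 1 else 2, k', u i, w (i - 1), d, m, g = \<one>, p g))" for i
  have Zi: "Z i = (pad ds i, fst (snd (Z i)), fst (snd (snd (Z i))), i = t)" if "i \<le> length ds" for i
    using Z1[of i] Z2[OF that] by (simp add: prod_eq_iff)
  have Zt: "Z t = (ds ! t, T h, T (h - 1), True)"
    using Zi[of t] Z3[of 0] t by (simp add: pad_def)
  have dt: "ds ! t \<noteq> 0" using pad_eq_0_iff[OF ds, of t] t by (simp add: pad_def)
  have ft: "?f (Z t) (\<rho> t) = ((ds ! t, T h, T (h - 1), False), \<rho> (Suc t))"
    using dt by (simp add: \<rho>_def sim_trans_def Zt r \<delta> u_def w_def)
  have fa: "?f (Z i) (\<rho> i) = ((pad ds i, fst (shifted d (u i) (w (i - 1)) (w i)), snd (shifted d (u i) (w (i - 1)) (w i)), i = Suc t), \<rho> (Suc i))"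
    if i: "t < i" "i \<le> length ds" for i
  proof -
    obtain R L where Z: "Z i = (pad ds i, R, L, False)" using Zi[OF i(2)] i(1) by auto
    have w': "w i = (R, L)" using i(1) by (simp add: w_def Z)
    have "\<rho> i = (if i = Suc t then 1 else 2, k', u i, w (i - 1), d, m, g = \<one>, p g)"
      using i(1) by (simp add: \<rho>_def)
    moreover have "\<rho> (Suc i) = (2, k', w (i - 1), w i, d, m, g = \<one>, p g)"
      using i(1) by (simp add: \<rho>_def u_def)
    ultimately show ?thesis by (simp add: sim_trans_def Z w')
  qed
  have fb: "?f (Z i) (\<rho> i) = (Z i, \<rho> (Suc i))" if i: "i < t" for i
  proof -
    obtain R L where Z: "Z i = (pad ds i, R, L, False)" using Zi[of i] i t by auto
    show ?thesis using i by (simp add: \<rho>_def sim_trans_def r Z)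
  qed
  have step: "snd (?f (Z i) (\<rho> i)) = \<rho> (Suc i)" if "i \<le> length ds" for i
    using ft fa[of i] fb[of i] that by (cases i t rule: linorder_cases) auto
  have out: "fst (fst (?f (Z i) (\<rho> i))) = pad ds i" if "i \<le> length ds" for i
    using ft fa[of i] fb[of i] that Z1 t by (cases i t rule: linorder_cases) (auto simp: pad_def)
  have ev': "\<rho> 0 = r" "\<And>i. i < length ds \<Longrightarrow> \<not> sim_stop (fst (?f (Z i) (\<rho> i)))"
    "sim_stop (fst (?f (Z (length ds)) (\<rho> (length ds))))"
    using out pad_eq_0_iff[OF ds] by (auto simp: sim_stop_def \<rho>_def)
  note ev = ev'(1) step ev'(2,3)
  show "\<exists>n. sim_stop (sweep_out ?f Z r n)" using sweep_eval(4)[where f = ?f and Z = Z and stop = sim_stop and n = "length ds" and \<rho> = \<rho>, OF ev] by blast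
  define Z' where "Z' = (\<lambda>i. if i \<le> length ds then fst (?f (Z i) (\<rho> i)) else Z i)"
  define g' where "g' = move_pebble g m"
  have \<rho>': "\<rho> (Suc (length ds)) = (2, k', u (Suc (length ds)), w (length ds), d, m, g = \<one>, p g)"
    using t by (simp add: \<rho>_def)
  have S: "sweep_step ?f sim_stop sim_move sim_upd p (Z, g, r) =
      (Z', g', 0, k', u (Suc (length ds)), w (length ds), d, m, g' = \<one>, p g')"
    by (subst sweep_step_eval[where f = ?f and Z = Z and stop = sim_stop and n = "length ds" and \<rho> = \<rho> and g' = g', OF ev]) (simp_all add: \<rho>' Z'_def g'_def sim_move_def sim_upd_def)
  have run: "choice_run \<delta> k0 bl p (take (Suc t) ds) = (k', T', h + move_offset d, g')"
    using C t \<delta> by (simp add: take_Suc_conv_app_nth choice_run_def choice_step_def T'_def g'_def)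
  have Z'1: "fst (Z' i) = pad ds i" for i using out[of i] Z1 by (simp add: Z'_def)
  have Z'2: "snd (snd (snd (Z' i))) \<longleftrightarrow> i = Suc t" if "i \<le> length ds" for i
    using ft fa[of i] fb[of i] that Z2[of i] by (cases i t rule: linorder_cases) (auto simp: Z'_def)
  have Z'3: "fst (snd (Z' (Suc t + j))) = T' (h + move_offset d + int j) \<and>
      fst (snd (snd (Z' (Suc t + j)))) = T' (h + move_offset d - 1 - int j)" if j: "Suc t + j < length ds" for j
  proof -
    let ?i = "Suc t + j"
    have "u ?i = (T' (h + int j - 1), T' (h - int j))" using u[of ?i] j by simp
    moreover have "w (?i - 1) = (T' (h + int j), T' (h - 1 - int j))" using w[of "?i - 1"] j by simp
    moreover have "w ?i = (T' (h + int j + 1), T' (h - 2 - int j))"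
      using w[of ?i] j by (simp add: algebra_simps)
    ultimately show ?thesis
      using fa[of ?i] j shifted_tape[of d T' h "int j"] by (simp add: Z'_def)
  qed
  show "simulates \<delta> b k0 bl p ds (Suc t) (sweep_step ?f sim_stop sim_move sim_upd p (Z, g, r))"
    unfolding S simulates_def using run Z'1 Z'2 Z'3 t ds by auto
qed

lemma sim_exhausted:
  assumes G: "simulates \<delta> b k0 bl p ds (length ds) (Z, g, r)"
  shows "exhausted \<delta> b k0 bl p ds (sweep_step (sim_trans \<delta> b k0 bl) sim_stop sim_move sim_upd p (Z, g, r))"
    "\<exists>n. sim_stop (sweep_out (sim_trans \<delta> b k0 bl) Z r n)"
proof -
  let ?f = "sim_trans \<delta> b k0 bl"
  obtain k T h x0 y0 d0 m0 where C: "choice_run \<delta> k0 bl p ds = (k, T, h, g)"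
    and r: "r = (0, k, x0, y0, d0, m0, g = \<one>, p g)" and Z1: "\<And>i. fst (Z i) = pad ds i"
    and Z2: "\<And>i. i \<le> length ds \<Longrightarrow> snd (snd (snd (Z i))) \<longleftrightarrow> i = length ds"
    and ds: "ds \<in> lists {1..b}"
    using G by (auto simp: simulates_def)
  define \<rho> where "\<rho> i = (if i \<le> length ds then r else (6, k, x0, y0, d0, None, g = \<one>, p g))" for i
  have Zi: "Z i = (pad ds i, fst (snd (Z i)), fst (snd (snd (Z i))), i = length ds)" if "i \<le> length ds" for i
    using Z1[of i] Z2[OF that] by (simp add: prod_eq_iff)
  have f: "?f (Z i) (\<rho> i) = ((pad ds i, fst (snd (Z i)), fst (snd (snd (Z i))), False), \<rho> (Suc i))" if i: "i \<le> length ds" for i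
  proof -
    obtain R L where Z: "Z i = (pad ds i, R, L, i = length ds)" using Zi[OF i] by blast
    show ?thesis using i pad_eq_0_iff[OF ds, of i] by (auto simp: \<rho>_def sim_trans_def r Z)
  qed
  have ev: "\<rho> 0 = r" "\<And>i. i \<le> length ds \<Longrightarrow> snd (?f (Z i) (\<rho> i)) = \<rho> (Suc i)"
    "\<And>i. i < length ds \<Longrightarrow> \<not> sim_stop (fst (?f (Z i) (\<rho> i)))"
    "sim_stop (fst (?f (Z (length ds)) (\<rho> (length ds))))"
    using f pad_eq_0_iff[OF ds] by (auto simp: sim_stop_def \<rho>_def)
  show "\<exists>n. sim_stop (sweep_out ?f Z r n)" using sweep_eval(4)[where f = ?f and Z = Z and stop = sim_stop and n = "length ds" and \<rho> = \<rho>, OF ev] by blast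
  show "exhausted \<delta> b k0 bl p ds (sweep_step ?f sim_stop sim_move sim_upd p (Z, g, r))"
    using C ds f Z1 by (subst sweep_step_eval[where f = ?f and Z = Z and stop = sim_stop and n = "length ds" and \<rho> = \<rho>, OF ev refl]) (auto simp: exhausted_def \<rho>_def sim_upd_def)
qed

text \<open>The same sweep counts up and restores the initial configuration of the simulated machine.\<close>

lemma sim_count_up:
  assumes b: "0 < b" and G: "exhausted \<delta> b k0 bl p ds (Z, g, r)"
  shows "simulates \<delta> b k0 bl p (count_up b ds) 0 (sweep_step (sim_trans \<delta> b k0 bl) sim_stop sim_move sim_upd p (Z, g, r))"
    "\<exists>n. sim_stop (sweep_out (sim_trans \<delta> b k0 bl) Z r n)"
proof -
  let ?f = "sim_trans \<delta> b k0 bl"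
  let ?es = "count_up b ds"
  obtain k x0 y0 d0 m0 hm po where r: "r = (3, k, x0, y0, d0, m0, hm, po)" and Z1: "\<And>i. fst (Z i) = pad ds i"
    and ds: "ds \<in> lists {1..b}"
    using G by (auto simp: exhausted_def)
  have es: "?es \<in> lists {1..b}" using count_up_lists[OF b ds] .
  obtain q where q: "\<And>i. i < q \<Longrightarrow> pad ds i = b" "pad ds q \<noteq> b" "q < length ?es"
    "pad ?es = (\<lambda>i. if i < q then 1 else if i = q then Suc (pad ds q) else pad ds i)"
    using pad_count_up[OF b, of ds] by blast
  define \<rho> where "\<rho> i = (if i = 0 then r else (if i \<le> q then 4 else 5, k0, x0, y0, d0, None, hm, po))" for i
  have f: "?f (Z i) (\<rho> i) = ((pad ?es i, bl, bl, i = 0), \<rho> (Suc i))" for i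
  proof -
    obtain R L st where Zi: "Z i = (pad ds i, R, L, st)" using Z1[of i] by (cases "Z i") auto
    have "0 < q" if "pad ds 0 = b" using q(2) that by (cases q) auto
    note q0 = this
    consider "i < q" | "i = q" | "q < i" by linarith
    then show ?thesis
      using q(1,2) q0 Zi by cases (auto simp: \<rho>_def sim_trans_def r q(4))
  qed
  have ev: "\<rho> 0 = r" "\<And>i. i \<le> length ?es \<Longrightarrow> snd (?f (Z i) (\<rho> i)) = \<rho> (Suc i)"
    "\<And>i. i < length ?es \<Longrightarrow> \<not> sim_stop (fst (?f (Z i) (\<rho> i)))"
    "sim_stop (fst (?f (Z (length ?es)) (\<rho> (length ?es))))"
    using f pad_eq_0_iff[OF es] by (simp_all add: sim_stop_def) (simp add: \<rho>_def)
  show "\<exists>n. sim_stop (sweep_out ?f Z r n)" using sweep_eval(4)[where f = ?f and Z = Z and stop = sim_stop and n = "length ?es" and \<rho> = \<rho>, OF ev] by blast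
  have "pad ds i = pad ?es i" if "length ?es < i" for i using q(3,4) that by auto
  then show "simulates \<delta> b k0 bl p ?es 0 (sweep_step ?f sim_stop sim_move sim_upd p (Z, g, r))"
    using es f Z1 q(3)
    by (subst sweep_step_eval[where f = ?f and Z = Z and stop = sim_stop and n = "length ?es" and \<rho> = \<rho>, OF ev refl])
      (auto simp: simulates_def \<rho>_def sim_upd_def sim_move_def move_pebble_def choice_run_def)
qed


definition sim_entries :: "nat \<Rightarrow> 'y set \<Rightarrow> 'y entry set" where
  "sim_entries b \<Gamma> = {..b} \<times> \<Gamma> \<times> \<Gamma> \<times> UNIV"

definition sim_regs :: "'k set \<Rightarrow> 'y set \<Rightarrow> 'a set \<Rightarrow> ('k, 'y, 'a, 'g) sim_reg set" where
  "sim_regs Q \<Gamma> \<Sigma> = {..6} \<times> Q \<times> (\<Gamma> \<times> \<Gamma>) \<times> (\<Gamma> \<times> \<Gamma>) \<times> UNIV \<times> opt_of (set ss) \<times> UNIV \<times> opt_of \<Sigma>"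

lemma shifted_closed:
  "x \<in> \<Gamma> \<times> \<Gamma> \<Longrightarrow> y \<in> \<Gamma> \<times> \<Gamma> \<Longrightarrow> z \<in> \<Gamma> \<times> \<Gamma> \<Longrightarrow> fst (shifted d x y z) \<in> \<Gamma> \<and> snd (shifted d x y z) \<in> \<Gamma>"
  by (cases d) (auto simp: shifted_def)

lemma sim_trans_closed:
  assumes \<delta>: "\<And>c k y hm po. c \<in> {1..b} \<Longrightarrow> k \<in> Q \<Longrightarrow> y \<in> \<Gamma> \<Longrightarrow> po \<in> opt_of \<Sigma> \<Longrightarrow>
      \<delta> c k y hm po \<in> Q \<times> \<Gamma> \<times> UNIV \<times> opt_of (set ss)"
    and k0: "k0 \<in> Q" and bl: "bl \<in> \<Gamma>" and b: "0 < b"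
    and e: "e \<in> sim_entries b \<Gamma>" and r: "r \<in> sim_regs Q \<Gamma> \<Sigma>"
  shows "sim_trans \<delta> b k0 bl e r \<in> sim_entries b \<Gamma> \<times> sim_regs Q \<Gamma> \<Sigma>"
proof -
  obtain c R L st where e': "e = (c, R, L, st)" by (cases e)
  obtain ph k x y d m q where "r = (ph, k, x, y, d, m, q)" by (cases r)
  moreover obtain hm po where "q = (hm, po)" by (cases q)
  ultimately have r': "r = (ph, k, x, y, d, m, hm, po)" by simp
  have E: "c \<le> b" "R \<in> \<Gamma>" "L \<in> \<Gamma>" using e by (simp_all add: e' sim_entries_def)
  have Rg: "ph \<le> 6" "k \<in> Q" "x \<in> \<Gamma> \<times> \<Gamma>" "y \<in> \<Gamma> \<times> \<Gamma>" "m \<in> opt_of (set ss)" "po \<in> opt_of \<Sigma>"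
    using r by (simp_all add: r' sim_regs_def)
  have N: "None \<in> opt_of (set ss)" by (simp add: opt_of_def)
  obtain k' z d' m' where d: "\<delta> c k R hm po = (k', z, d', m')" by (metis prod_cases4)
  have D: "k' \<in> Q" "z \<in> \<Gamma>" "m' \<in> opt_of (set ss)" if "c \<noteq> 0"
    using \<delta>[of c k R po hm] that E Rg d by simp_all
  note sh = shifted_closed[OF Rg(3,4), of "(R, L)" d]
  show ?thesis
    unfolding e' r' sim_trans_def sim_entries_def sim_regs_def
    using E Rg N D sh k0 bl b by (simp add: d)
qed

text \<open>
  The reachable states of the sweep machine simulate all prefixes of all words of choices, one word
  after the other.
\<close>

theorem choice_machine_exists:
  fixes \<delta> :: "('k, 'y, 'a, 'g) choice_trans"
  assumes fin: "finite \<Sigma>" "finite Q" "finite \<Gamma>"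
    and k0: "k0 \<in> Q" and bl: "bl \<in> \<Gamma>" and b: "0 < b"
    and \<delta>: "\<And>c k y hm po. c \<in> {1..b} \<Longrightarrow> k \<in> Q \<Longrightarrow> y \<in> \<Gamma> \<Longrightarrow> po \<in> opt_of \<Sigma> \<Longrightarrow>
      \<delta> c k y hm po \<in> Q \<times> \<Gamma> \<times> UNIV \<times> opt_of (set ss)"
  shows "\<exists>T :: ('g, 'a) g_machine. g_machine (set ss) \<Sigma> T \<and>
    (\<forall>p\<in>patterns G \<Sigma>. gm_accepts G T p \<longleftrightarrow> (\<exists>ds\<in>lists {1..b}. fst (choice_run \<delta> k0 bl p ds) \<in> F))"
proof -
  let ?f = "sim_trans \<delta> b k0 bl"
  let ?y0 = "(0, bl, bl, False) :: 'y entry"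
  let ?r0 = "(6, k0, (bl, bl), (bl, bl), MoveN, None, True, None) :: ('k, 'y, 'a, 'g) sim_reg"
  define conf where "conf p n = (sweep_step ?f sim_stop sim_move sim_upd p ^^ n)
    (\<lambda>_. ?y0, \<one>, sim_upd ?r0 True (p \<one>))" for p n
  have conf_Suc: "conf p (Suc n) = sweep_step ?f sim_stop sim_move sim_upd p (conf p n)" for p n
    by (simp add: conf_def)
  have ex0: "exhausted \<delta> b k0 bl p [] (conf p 0)" for p
    by (simp add: conf_def exhausted_def sim_upd_def choice_run_def pad_def exI[of _ True])
  have inv: "(\<exists>ds t. simulates \<delta> b k0 bl p ds t (conf p n)) \<or> (\<exists>ds. exhausted \<delta> b k0 bl p ds (conf p n))" for p n
  proof (induction n)
    case (Suc n)
    obtain Z g r where c: "conf p n = (Z, g, r)" by (cases "conf p n")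
    from Suc show ?case
    proof
      assume "\<exists>ds t. simulates \<delta> b k0 bl p ds t (conf p n)"
      then obtain ds t where s: "simulates \<delta> b k0 bl p ds t (Z, g, r)" using c by auto
      then have "t < length ds \<or> t = length ds" by (auto simp: simulates_def)
      then show ?thesis unfolding conf_Suc c
        using s sim_step(1)[OF s] sim_exhausted(1)[of \<delta> b k0 bl p ds Z g r] by blast
    next
      assume "\<exists>ds. exhausted \<delta> b k0 bl p ds (conf p n)"
      then obtain ds where "exhausted \<delta> b k0 bl p ds (Z, g, r)" using c by auto
      from sim_count_up(1)[OF b this] show ?thesis unfolding conf_Suc c by blast
    qed
  qed (use ex0 in blast)
  have halts: "\<exists>k. sim_stop (sweep_out ?f Z r k)" if c: "conf p n = (Z, g, r)" for p n Z g r
    using inv[of p n] unfolding c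
  proof
    assume "\<exists>ds t. simulates \<delta> b k0 bl p ds t (Z, g, r)"
    then obtain ds t where s: "simulates \<delta> b k0 bl p ds t (Z, g, r)" by blast
    then have "t < length ds \<or> t = length ds" by (auto simp: simulates_def)
    then show ?thesis
      using s sim_step(2)[OF s] sim_exhausted(2)[of \<delta> b k0 bl p ds Z g r] by blast
  next
    assume "\<exists>ds. exhausted \<delta> b k0 bl p ds (Z, g, r)"
    then obtain ds where "exhausted \<delta> b k0 bl p ds (Z, g, r)" by blast
    from sim_count_up(2)[OF b this] show ?thesis .
  qed
  have simul: "\<exists>n. simulates \<delta> b k0 bl p ds t (conf p n)"
    if "simulates \<delta> b k0 bl p ds 0 (conf p n0)" "t \<le> length ds" for p ds n0 t
    using that(2)
  proof (induction t)
    case (Suc t)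
    then obtain n where n: "simulates \<delta> b k0 bl p ds t (conf p n)" by auto
    obtain Z g r where c: "conf p n = (Z, g, r)" by (cases "conf p n")
    have "simulates \<delta> b k0 bl p ds (Suc t) (conf p (Suc n))"
      using sim_step(1)[OF n[unfolded c]] Suc.prems unfolding conf_Suc c by simp
    then show ?case by blast
  qed (use that in blast)
  have complete: "\<exists>n. exhausted \<delta> b k0 bl p ds (conf p n)" if "ds \<in> lists {1..b}" for p ds
    using b _ _ that
  proof (rule count_up_induct)
    show "\<exists>n. exhausted \<delta> b k0 bl p [] (conf p n)" using ex0 by blast
    fix ds assume "\<exists>n. exhausted \<delta> b k0 bl p ds (conf p n)"
    then obtain n where n: "exhausted \<delta> b k0 bl p ds (conf p n)" by blast
    obtain Z g r where c: "conf p n = (Z, g, r)" by (cases "conf p n")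
    have "simulates \<delta> b k0 bl p (count_up b ds) 0 (conf p (Suc n))"
      using sim_count_up(1)[OF b n[unfolded c]] unfolding conf_Suc c .
    from simul[OF this order_refl] obtain m where
      m: "simulates \<delta> b k0 bl p (count_up b ds) (length (count_up b ds)) (conf p m)" by blast
    obtain Z' g' r' where c': "conf p m = (Z', g', r')" by (cases "conf p m")
    have "exhausted \<delta> b k0 bl p (count_up b ds) (conf p (Suc m))"
      using sim_exhausted(1)[OF m[unfolded c']] unfolding conf_Suc c' .
    then show "\<exists>n. exhausted \<delta> b k0 bl p (count_up b ds) (conf p n)" by blast
  qed
  have acc: "(\<exists>n. fst (snd (snd (snd (conf p n)))) \<in> F) \<longleftrightarrow> (\<exists>ds\<in>lists {1..b}. fst (choice_run \<delta> k0 bl p ds) \<in> F)" for p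
  proof
    assume "\<exists>n. fst (snd (snd (snd (conf p n)))) \<in> F"
    then obtain n where n: "fst (snd (snd (snd (conf p n)))) \<in> F" by blast
    obtain Z g r where c: "conf p n = (Z, g, r)" by (cases "conf p n")
    from inv[of p n] show "\<exists>ds\<in>lists {1..b}. fst (choice_run \<delta> k0 bl p ds) \<in> F"
    proof
      assume "\<exists>ds t. simulates \<delta> b k0 bl p ds t (conf p n)"
      then obtain ds t where sim: "simulates \<delta> b k0 bl p ds t (Z, g, r)" unfolding c by blast
      then have s: "ds \<in> lists {1..b}" by (simp add: simulates_def)
      have "fst (choice_run \<delta> k0 bl p (take t ds)) = fst (snd r)" using sim by (auto simp: simulates_def)
      then have "fst (choice_run \<delta> k0 bl p (take t ds)) \<in> F" using n c by simp
      moreover have "take t ds \<in> lists {1..b}" using s by (meson in_lists_conv_set in_set_takeD)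
      ultimately show ?thesis by blast
    next
      assume "\<exists>ds. exhausted \<delta> b k0 bl p ds (conf p n)"
      then show ?thesis using n c by (auto simp: exhausted_def)
    qed
  next
    assume "\<exists>ds\<in>lists {1..b}. fst (choice_run \<delta> k0 bl p ds) \<in> F"
    then obtain ds where ds: "ds \<in> lists {1..b}" "fst (choice_run \<delta> k0 bl p ds) \<in> F" by blast
    obtain n where "exhausted \<delta> b k0 bl p ds (conf p n)" using complete[OF ds(1)] by blast
    then have "fst (snd (snd (snd (conf p n)))) = fst (choice_run \<delta> k0 bl p ds)"
      by (auto simp: exhausted_def)
    then show "\<exists>n. fst (snd (snd (snd (conf p n)))) \<in> F" using ds(2) by metis
  qed
  have moves: "(UNIV :: tape_move set) = {MoveL, MoveN, MoveR}" using tape_move.exhaust by blast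
  have "\<exists>T :: ('g, 'a) g_machine. g_machine (set ss) \<Sigma> T \<and>
    (\<forall>p\<in>patterns G \<Sigma>. gm_accepts G T p \<longleftrightarrow> (\<exists>n. fst (snd (snd (snd (conf p n)))) \<in> F))"
    unfolding conf_def
  proof (rule sweep_machine_exists[where A = "sim_entries b \<Gamma>" and R = "sim_regs Q \<Gamma> \<Sigma>" and acc = "\<lambda>r. fst (snd r) \<in> F"])
    show "finite (sim_entries b \<Gamma>)" "finite (sim_regs Q \<Gamma> \<Sigma>)"
      using fin by (simp_all add: sim_entries_def sim_regs_def opt_of_def moves)
    show "?y0 \<in> sim_entries b \<Gamma>" "?r0 \<in> sim_regs Q \<Gamma> \<Sigma>"
      using k0 bl by (simp_all add: sim_entries_def sim_regs_def opt_of_def)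
    show "?f y r \<in> sim_entries b \<Gamma> \<times> sim_regs Q \<Gamma> \<Sigma>" if "y \<in> sim_entries b \<Gamma>" "r \<in> sim_regs Q \<Gamma> \<Sigma>" for y r
      using sim_trans_closed[OF \<delta> k0 bl b that] .
    show "s \<in> set ss" if "r \<in> sim_regs Q \<Gamma> \<Sigma>" "sim_move r = Some s" for r s
      using that by (auto simp: sim_regs_def sim_move_def opt_of_def)
    show "sim_upd r hm po \<in> sim_regs Q \<Gamma> \<Sigma>" if "r \<in> sim_regs Q \<Gamma> \<Sigma>" "po \<in> opt_of \<Sigma>" for r hm po
      using that by (auto simp: sim_regs_def sim_upd_def)
    show "\<exists>k. sim_stop (sweep_out ?f Z r k)"
      if "p \<in> patterns G \<Sigma>" "(sweep_step ?f sim_stop sim_move sim_upd p ^^ n) (\<lambda>_. ?y0, \<one>, sim_upd ?r0 True (p \<one>)) = (Z, g, r)"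
      for p n Z g r
      using halts that(2) unfolding conf_def .
  qed (rule fin)
  then show ?thesis unfolding acc .
qed

end

section \<open>Patterns and pattern codings\<close>

lemma pattern_of_eq:
  assumes "consistent G c" "(w, a) \<in> c"
  shows "pattern_of G c (word_val G w) = Some a"
proof -
  have "(THE b. \<exists>v. (v, b) \<in> c \<and> word_val G v = word_val G w) = a"
    using assms unfolding consistent_def by (intro the_equality) blast+
  then show ?thesis using assms(2) by (auto simp: pattern_of_def)
qed

lemma pattern_of_SomeD:
  assumes "consistent G c" "pattern_of G c g = Some a"
  shows "\<exists>w. (w, a) \<in> c \<and> word_val G w = g"
proof -
  obtain w b where "(w, b) \<in> c" "word_val G w = g"
    using assms(2) by (auto simp: pattern_of_def split: if_splits)
  then show ?thesis using pattern_of_eq[OF assms(1)] assms(2) by fastforce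
qed

lemma (in group) word_val_in_carrier: "w \<in> lists S \<Longrightarrow> S \<subseteq> carrier G \<Longrightarrow> word_val G w \<in> carrier G"
  by (induction w rule: list.induct) (auto simp: word_val_def)

lemma (in group) pattern_of_patterns:
  assumes "c \<in> pattern_codings S \<Sigma>" "S \<subseteq> carrier G" "consistent G c"
  shows "pattern_of G c \<in> patterns G \<Sigma>"
proof -
  have c: "finite c" "c \<subseteq> lists S \<times> \<Sigma>" using assms(1) by (auto simp: pattern_codings_def)
  have "dom (pattern_of G c) \<subseteq> (\<lambda>(w, a). word_val G w) ` c"
    using pattern_of_SomeD[OF assms(3)] by force
  moreover have "(\<lambda>(w, a). word_val G w) ` c \<subseteq> carrier G"
    using c(2) word_val_in_carrier[OF _ assms(2)] by fast
  moreover have "ran (pattern_of G c) \<subseteq> \<Sigma>"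
    using pattern_of_SomeD[OF assms(3)] c(2) by (fastforce simp: ran_def)
  ultimately show ?thesis
    using c(1) finite_subset[of "dom (pattern_of G c)"] by (auto simp: patterns_def)
qed

text \<open>
  A coding all of whose letters occur in \<open>p\<close> is consistent and codes a restriction of \<open>p\<close>, so that closure under
  extensions applies. The condition on the right only asks for letters at finitely many given places, so
  that the support of \<open>p\<close> need not be determined.
\<close>

lemma (in group) patterns_of_iff:
  assumes S: "S \<subseteq> carrier G" and C: "C \<subseteq> pattern_codings S \<Sigma>"
    and closed: "closed_by_extensions G \<Sigma> (patterns_of G C)" and p: "p \<in> patterns G \<Sigma>"
  shows "p \<in> patterns_of G C \<longleftrightarrow> (\<exists>c\<in>C. \<forall>(w, a)\<in>c. p (word_val G w) = Some a)"
proof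
  assume "p \<in> patterns_of G C"
  then obtain c where "c \<in> C" "consistent G c" "p = pattern_of G c" by (auto simp: patterns_of_def)
  then show "\<exists>c\<in>C. \<forall>(w, a)\<in>c. p (word_val G w) = Some a" using pattern_of_eq[of G c] by blast
next
  assume "\<exists>c\<in>C. \<forall>(w, a)\<in>c. p (word_val G w) = Some a"
  then obtain c where c: "c \<in> C" "\<And>w a. (w, a) \<in> c \<Longrightarrow> p (word_val G w) = Some a" by blast
  have con: "consistent G c"
    unfolding consistent_def
  proof (intro allI impI)
    fix u a v b
    assume "(u, a) \<in> c" "(v, b) \<in> c" "word_val G u = word_val G v"
    then show "a = b" using c(2)[of u a] c(2)[of v b] by simp
  qed
  have "pattern_of G c \<subseteq>\<^sub>m p"
    using pattern_of_SomeD[OF con] c(2) by (force simp: map_le_def)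
  moreover have "pattern_of G c \<in> patterns_of G C" using c(1) con by (auto simp: patterns_of_def)
  moreover have "pattern_of G c \<in> patterns G \<Sigma>" using pattern_of_patterns[OF _ S con] C c(1) by blast
  ultimately show "p \<in> patterns_of G C" using closed p unfolding closed_by_extensions_def by blast
qed

section \<open>Guessing a pattern coding and running the oracle machine\<close>

datatype control = Between | Within | Rewinding | Rejected | Running nat

locale coding_guesser = infinite_fg_group G ss
  for G :: "('g, 'm) monoid_scheme" (structure) and ss +
  fixes M :: "('g + 'a, 'g) oracle_tm" and \<Sigma> :: "'a set" and ls :: "('g + 'a) option list"
  assumes M: "oracle_tm (set ss <+> \<Sigma>) (set ss) M"
    and ls: "set ls = insert None (Some ` (set ss <+> \<Sigma>))"
begin

text \<open>
  The choices spell a pattern coding, which is written on the tape; the choice \<open>None\<close> ends it. The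
  pebble follows the current word, so that it lies on the place where the letter after the word has to
  be compared with the pattern. Then the head returns to the beginning of the tape, and the oracle machine is
  run. Its oracle tape is not represented: it is enough to know the element of the group that the
  word on it stands for, which is the place of the pebble, and a query asks whether the pebble is at
  the origin.
\<close>

definition guess_trans :: "(control, ('g + 'a) + nat, 'a, 'g) choice_trans" where
  "guess_trans c k y hm po = (case k of
     Running q \<Rightarrow>
       if q = tm_query M then (Running (if hm then tm_yes M else tm_no M), y, MoveN, None)
       else (case tm_trans M (y, q) of (z, r, d, e) \<Rightarrow>
         (Running r, z, d, Some (case e of None \<Rightarrow> \<one> | Some s \<Rightarrow> s)))
   | Rewinding \<Rightarrow>
       if y = tm_blank M then (Running (tm_init M), y, MoveR, None) else (Rewinding, y, MoveL, None)
   | Rejected \<Rightarrow> (Rejected, y, MoveN, None)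
   | _ \<Rightarrow> (case ls ! (c - 1) of
       None \<Rightarrow> (if k = Between then Rewinding else Rejected, y, MoveL, None)
     | Some (Inl s) \<Rightarrow> (Within, Inl (Inl s), MoveR, Some s)
     | Some (Inr a) \<Rightarrow>
         if po = Some a then (Between, Inl (Inr a), MoveR, None) else (Rejected, y, MoveN, None)))"

definition matching :: "('g \<rightharpoonup> 'a) \<Rightarrow> ('g list \<times> 'a) list \<Rightarrow> bool" where
  "matching p cs \<longleftrightarrow> cs \<in> lists (lists (set ss) \<times> \<Sigma>) \<and> (\<forall>(w, a)\<in>set cs. p (word_val G w) = Some a)"

definition tape :: "('g + 'a) list \<Rightarrow> int \<Rightarrow> ('g + 'a) + nat" where
  "tape v = (\<lambda>k. if 0 \<le> k \<and> k < int (length v) then Inl (v ! nat k) else tm_blank M)"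

text \<open>
  The invariant describes what a computation with arbitrary choices may have done so far.
\<close>

definition guess_inv :: "('g \<rightharpoonup> 'a) \<Rightarrow> control \<times> (int \<Rightarrow> ('g + 'a) + nat) \<times> int \<times> 'g \<Rightarrow> bool" where
  "guess_inv p = (\<lambda>(k, t, h, g). case k of
     Between \<Rightarrow> \<exists>cs. matching p cs \<and> t = tape (encode_coding cs) \<and> h = int (length (encode_coding cs)) \<and> g = \<one>
   | Within \<Rightarrow> \<exists>cs w. matching p cs \<and> w \<in> lists (set ss) \<and> t = tape (encode_coding cs @ map Inl w) \<and>
       h = int (length (encode_coding cs @ map Inl w)) \<and> g = word_val G w
   | Rewinding \<Rightarrow> \<exists>cs. matching p cs \<and> t = tape (encode_coding cs) \<and> - 1 \<le> h \<and> h < int (length (encode_coding cs))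
   | Rejected \<Rightarrow> True
   | Running q \<Rightarrow> \<exists>cs n u. matching p cs \<and>
       (tm_step M (WP G (set ss)) ^^ n) (tm_start M (encode_coding cs)) = (q, t, h, u) \<and> g = word_val G u)"

lemma word_val_Nil [simp]: "word_val G [] = \<one>"
  by (simp add: word_val_def)

lemma word_val_Cons [simp]: "word_val G (s # w) = s \<otimes> word_val G w"
  by (simp add: word_val_def)

lemma word_val_closed [simp]: "w \<in> lists (set ss) \<Longrightarrow> word_val G w \<in> carrier G"
  using word_val_in_carrier gens_carrier by blast

lemma word_val_snoc: "w \<in> lists (set ss) \<Longrightarrow> s \<in> set ss \<Longrightarrow> word_val G (w @ [s]) = word_val G w \<otimes> s"
  by (induction w rule: list.induct) (auto simp: m_assoc)

lemma encode_coding_snoc: "encode_coding (cs @ [(w, a)]) = encode_coding cs @ map Inl w @ [Inr a]"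
  by (simp add: encode_coding_def)

lemma matching_snoc:
  "matching p (cs @ [(w, a)]) \<longleftrightarrow> matching p cs \<and> w \<in> lists (set ss) \<and> a \<in> \<Sigma> \<and> p (word_val G w) = Some a"
  by (auto simp: matching_def)

lemma tape_snoc: "(tape v)(int (length v) := Inl x) = tape (v @ [x])"
  by (auto simp: tape_def fun_eq_iff nth_append)

lemma encode_coding_letters:
  "cs \<in> lists (lists (set ss) \<times> \<Sigma>) \<Longrightarrow> set (encode_coding cs) \<subseteq> set ss <+> \<Sigma>"
  by (auto simp: encode_coding_def in_lists_conv_set)

lemma tm_start_eq: "tm_start M v = (tm_init M, tape v, 0, [])"
  by (simp add: tm_start_def tape_def)

lemma tape_letter_not_blank:
  assumes "set v \<subseteq> set ss <+> \<Sigma>" "0 \<le> k" "k < int (length v)"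
  shows "tape v k \<noteq> tm_blank M"
proof -
  have "nat k < length v" using assms by simp
  then have "Inl (v ! nat k) \<in> Inl ` (set ss <+> \<Sigma>)" using assms(1) nth_mem by blast
  moreover have "tm_blank M \<notin> Inl ` (set ss <+> \<Sigma>)" using M by (simp add: oracle_tm_def)
  moreover have "tape v k = Inl (v ! nat k)" using assms(2,3) by (simp add: tape_def)
  ultimately show ?thesis by metis
qed

lemma tm_run_closed:
  assumes "set v \<subseteq> set ss <+> \<Sigma>"
  shows "case (tm_step M A ^^ n) (tm_start M v) of (q, t, h, u) \<Rightarrow>
    q \<in> tm_states M \<and> (\<forall>i. t i \<in> tm_alphabet M) \<and> u \<in> lists (set ss)"
proof (induction n)
  case 0
  have "tape v k \<in> tm_alphabet M" for k
  proof (cases "0 \<le> k \<and> k < int (length v)")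
    case True
    then have "nat k < length v" by auto
    then have "Inl (v ! nat k) \<in> Inl ` (set ss <+> \<Sigma>)" using assms nth_mem by blast
    moreover have "Inl ` (set ss <+> \<Sigma>) \<subseteq> tm_alphabet M" using M by (simp add: oracle_tm_def)
    moreover have "tape v k = Inl (v ! nat k)" using True by (simp add: tape_def)
    ultimately show ?thesis by auto
  qed (use M in \<open>auto simp: oracle_tm_def tape_def\<close>)
  then show ?case using M by (simp add: tm_start_eq oracle_tm_def)
next
  case (Suc n)
  obtain q t h u where c: "(tm_step M A ^^ n) (tm_start M v) = (q, t, h, u)" by (metis prod_cases4)
  with Suc have I: "q \<in> tm_states M" "\<And>i. t i \<in> tm_alphabet M" "u \<in> lists (set ss)" by auto
  obtain z r d e where tr: "tm_trans M (t h, q) = (z, r, d, e)" by (metis prod_cases4)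
  have "z \<in> tm_alphabet M" "r \<in> tm_states M" "set_option e \<subseteq> set ss"
    using M I(1) I(2)[of h] tr unfolding oracle_tm_def by fastforce+
  moreover have "tm_yes M \<in> tm_states M" "tm_no M \<in> tm_states M" using M by (auto simp: oracle_tm_def)
  ultimately show ?case using c tr I by (auto split: option.splits)
qed

lemma guess_inv_intros:
  assumes "matching p cs"
  shows "guess_inv p (Between, tape (encode_coding cs), int (length (encode_coding cs)), \<one>)"
    and "w \<in> lists (set ss) \<Longrightarrow> guess_inv p (Within, tape (encode_coding cs @ map Inl w),
      int (length (encode_coding cs @ map Inl w)), word_val G w)"
    and "(tm_step M (WP G (set ss)) ^^ n) (tm_start M (encode_coding cs)) = (q, t, h, u) \<Longrightarrow>
      guess_inv p (Running q, t, h, word_val G u)"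
  using assms unfolding guess_inv_def by (simp, blast)+

text \<open>One step of the guesser in the last phase is one step of the oracle machine.\<close>

lemma guess_running_step:
  assumes "u \<in> lists (set ss)" "q \<in> tm_states M" "t h \<in> tm_alphabet M"
    and "tm_step M (WP G (set ss)) (q, t, h, u) = (q', t', h', u')"
  shows "choice_step guess_trans p c (Running q, t, h, word_val G u) = (Running q', t', h', word_val G u')"
proof (cases "q = tm_query M")
  case True
  then show ?thesis using assms(1,4)
    by (auto simp: choice_step_def guess_trans_def move_pebble_def WP_def)
next
  case False
  obtain z r d e where tr: "tm_trans M (t h, q) = (z, r, d, e)" by (metis prod_cases4)
  have "set_option e \<subseteq> set ss"
    using M assms(2,3) tr unfolding oracle_tm_def by fastforce
  then have "word_val G (u @ [s]) = word_val G u \<otimes> s" if "e = Some s" for s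
    using that word_val_snoc[OF assms(1)] by simp
  then show ?thesis using False assms(1,4) tr
    by (auto simp: choice_step_def guess_trans_def move_pebble_def split: option.splits)
qed

lemma guess_inv_step:
  assumes inv: "guess_inv p (k, t, h, g)" and c: "c \<in> {1..length ls}"
  shows "guess_inv p (choice_step guess_trans p c (k, t, h, g))"
proof -
  have "ls ! (c - 1) \<in> set ls" using c by (intro nth_mem) auto
  then consider (stop) "ls ! (c - 1) = None"
    | (word) s where "ls ! (c - 1) = Some (Inl s)" "s \<in> set ss"
    | (letter) a where "ls ! (c - 1) = Some (Inr a)" "a \<in> \<Sigma>"
    by (auto simp: ls Plus_def)
  note choice = this
  show ?thesis
  proof (cases k)
    case Between
    then obtain cs where cs: "matching p cs" "t = tape (encode_coding cs)" "h = int (length (encode_coding cs))" "g = \<one>"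
      using inv by (auto simp: guess_inv_def)
    show ?thesis
    proof (cases rule: choice)
      case stop
      then show ?thesis using Between cs
        by (auto simp: guess_inv_def choice_step_def guess_trans_def)
    next
      case (word s)
      have "choice_step guess_trans p c (k, t, h, g) =
          (Within, tape (encode_coding cs @ map Inl [s]), int (length (encode_coding cs @ map Inl [s])), word_val G [s])"
        using Between word cs by (simp add: choice_step_def guess_trans_def tape_snoc move_pebble_def)
      moreover have "[s] \<in> lists (set ss)" using word by simp
      ultimately show ?thesis using guess_inv_intros(2)[OF cs(1), of "[s]"] by simp
    next
      case (letter a)
      have "choice_step guess_trans p c (k, t, h, g) =
          (Between, tape (encode_coding (cs @ [([], a)])), int (length (encode_coding (cs @ [([], a)]))), \<one>)"
        if "p \<one> = Some a"
        using that Between letter cs by (simp add: choice_step_def guess_trans_def tape_snoc move_pebble_def encode_coding_snoc)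
      moreover have "matching p (cs @ [([], a)])" if "p \<one> = Some a"
        using that cs letter by (simp add: matching_snoc)
      moreover have "fst (choice_step guess_trans p c (k, t, h, g)) = Rejected" if "p \<one> \<noteq> Some a"
        using that Between letter cs by (simp add: choice_step_def guess_trans_def)
      ultimately show ?thesis
        using guess_inv_intros(1)[of p "cs @ [([], a)]"]
        by (cases "p \<one> = Some a"; cases "choice_step guess_trans p c (k, t, h, g)")
          (simp_all add: guess_inv_def)
    qed
  next
    case Within
    then obtain cs w where cs: "matching p cs" "w \<in> lists (set ss)" "t = tape (encode_coding cs @ map Inl w)"
       "h = int (length (encode_coding cs @ map Inl w))" "g = word_val G w"
      using inv by (auto simp: guess_inv_def)
    show ?thesis
    proof (cases rule: choice)
      case stop
      then show ?thesis using Within cs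
        by (auto simp: guess_inv_def choice_step_def guess_trans_def)
    next
      case (word s)
      have "choice_step guess_trans p c (k, t, h, g) =
          (Within, tape (encode_coding cs @ map Inl (w @ [s])), int (length (encode_coding cs @ map Inl (w @ [s]))), word_val G (w @ [s]))"
        using Within word cs tape_snoc[of "encode_coding cs @ map Inl w" "Inl s"]
        by (simp add: choice_step_def guess_trans_def move_pebble_def word_val_snoc)
      moreover have "w @ [s] \<in> lists (set ss)" using word cs by simp
      ultimately show ?thesis using guess_inv_intros(2)[OF cs(1), of "w @ [s]"] by simp
    next
      case (letter a)
      have "choice_step guess_trans p c (k, t, h, g) =
          (Between, tape (encode_coding (cs @ [(w, a)])), int (length (encode_coding (cs @ [(w, a)]))), \<one>)"
        if "p g = Some a"
        using that Within letter cs tape_snoc[of "encode_coding cs @ map Inl w" "Inr a"]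
        by (simp add: choice_step_def guess_trans_def move_pebble_def encode_coding_snoc)
      moreover have "matching p (cs @ [(w, a)])" if "p g = Some a"
        using that cs letter by (simp add: matching_snoc)
      moreover have "fst (choice_step guess_trans p c (k, t, h, g)) = Rejected" if "p g \<noteq> Some a"
        using that Within letter cs by (simp add: choice_step_def guess_trans_def)
      ultimately show ?thesis
        using guess_inv_intros(1)[of p "cs @ [(w, a)]"]
        by (cases "p g = Some a"; cases "choice_step guess_trans p c (k, t, h, g)")
          (simp_all add: guess_inv_def)
    qed
  next
    case Rewinding
    then obtain cs where cs: "matching p cs" "t = tape (encode_coding cs)" "- 1 \<le> h" "h < int (length (encode_coding cs))"
      using inv by (auto simp: guess_inv_def)
    have letters: "set (encode_coding cs) \<subseteq> set ss <+> \<Sigma>"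
      using cs(1) encode_coding_letters by (simp add: matching_def)
    show ?thesis
    proof (cases "h = - 1")
      case True
      then have "choice_step guess_trans p c (k, t, h, g) = (Running (tm_init M), tape (encode_coding cs), 0, word_val G [])"
        using Rewinding cs by (auto simp: choice_step_def guess_trans_def tape_def move_pebble_def fun_eq_iff)
      moreover have "(tm_step M (WP G (set ss)) ^^ 0) (tm_start M (encode_coding cs)) = (tm_init M, tape (encode_coding cs), 0, [])"
        by (simp add: tm_start_eq)
      ultimately show ?thesis using guess_inv_intros(3)[OF cs(1)] by metis
    next
      case False
      then have "t h \<noteq> tm_blank M" using cs tape_letter_not_blank[OF letters] by simp
      then show ?thesis using Rewinding cs False
        by (auto simp: choice_step_def guess_trans_def guess_inv_def)
    qed
  next
    case Rejected
    then show ?thesis by (simp add: guess_inv_def choice_step_def guess_trans_def)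
  next
    case (Running q)
    then obtain cs n u where cs: "matching p cs" "g = word_val G u"
      "(tm_step M (WP G (set ss)) ^^ n) (tm_start M (encode_coding cs)) = (q, t, h, u)"
      using inv by (auto simp: guess_inv_def)
    have letters: "set (encode_coding cs) \<subseteq> set ss <+> \<Sigma>"
      using cs(1) encode_coding_letters by (simp add: matching_def)
    obtain q' t' h' u' where s: "tm_step M (WP G (set ss)) (q, t, h, u) = (q', t', h', u')" by (metis prod_cases4)
    have "u \<in> lists (set ss)" "q \<in> tm_states M" "t h \<in> tm_alphabet M"
      using tm_run_closed[OF letters, where A = "WP G (set ss)" and n = n] cs(3) by auto
    from guess_running_step[OF this s]
    have "choice_step guess_trans p c (k, t, h, g) = (Running q', t', h', word_val G u')"
      using Running cs(2) by simp
    moreover have "(tm_step M (WP G (set ss)) ^^ Suc n) (tm_start M (encode_coding cs)) = (q', t', h', u')"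
      using cs(3) s by simp
    ultimately show ?thesis using guess_inv_intros(3)[OF cs(1)] by metis
  qed
qed

text \<open>By the invariant, acceptance comes from an accepting run on a matching coding.\<close>

lemma guess_sound:
  assumes "ds \<in> lists {1..length ls}" "fst (choice_run guess_trans Between (tm_blank M) p ds) = Running q" "q \<in> tm_final M"
  shows "\<exists>cs. matching p cs \<and> tm_accepts M (WP G (set ss)) (encode_coding cs)"
proof -
  have "guess_inv p (choice_run guess_trans Between (tm_blank M) p ds)"
    using assms(1)
  proof (induction ds rule: rev_induct)
    case Nil
    have "matching p []" "tape (encode_coding []) = (\<lambda>_. tm_blank M)" "encode_coding [] = ([] :: ('g + 'a) list)"
      by (auto simp: matching_def tape_def encode_coding_def fun_eq_iff)
    then show ?case unfolding guess_inv_def choice_run_def by (auto intro!: exI[of _ "[]"])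
  next
    case (snoc c ds)
    then have "guess_inv p (choice_run guess_trans Between (tm_blank M) p ds)" "c \<in> {1..length ls}" by auto
    then show ?case using guess_inv_step
      by (cases "choice_run guess_trans Between (tm_blank M) p ds") (auto simp: choice_run_def)
  qed
  then obtain cs n u t h where "matching p cs"
      "(tm_step M (WP G (set ss)) ^^ n) (tm_start M (encode_coding cs)) = (q, t, h, u)"
    using assms(2) by (cases "choice_run guess_trans Between (tm_blank M) p ds") (auto simp: guess_inv_def)
  then show ?thesis using assms(3) unfolding tm_accepts_def by (metis fst_conv)
qed

definition reaches where
  "reaches p x y \<longleftrightarrow> (\<exists>ds\<in>lists {1..length ls}. foldl (\<lambda>x c. choice_step guess_trans p c x) x ds = y)"

lemma reaches_refl: "reaches p x x"
  unfolding reaches_def by (rule bexI[of _ "[]"]) auto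

lemma reaches_trans: "reaches p x y \<Longrightarrow> reaches p y z \<Longrightarrow> reaches p x z"
  unfolding reaches_def by (metis append_in_lists_conv foldl_append)

lemma reaches_choice:
  assumes "x \<in> set ls" "\<And>c. ls ! (c - 1) = x \<Longrightarrow> choice_step guess_trans p c y = z"
  shows "reaches p y z"
proof -
  obtain i where i: "i < length ls" "ls ! i = x" using assms(1) by (metis in_set_conv_nth)
  then show ?thesis using assms(2)[of "Suc i"]
    unfolding reaches_def by (intro bexI[of _ "[Suc i]"]) auto
qed

lemma reaches_any:
  assumes "\<And>c. choice_step guess_trans p c y = z"
  shows "reaches p y z"
  by (rule reaches_choice[of None]) (use assms ls in auto)

lemma guess_word:
  assumes "w \<in> lists (set ss)" "k = Between \<or> k = Within" "g \<in> carrier G"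
  shows "\<exists>k'. (k' = Between \<or> k' = Within) \<and>
    reaches p (k, tape v, int (length v), g) (k', tape (v @ map Inl w), int (length (v @ map Inl w)), g \<otimes> word_val G w)"
  using assms
proof (induction w arbitrary: k v g rule: list.induct)
  case Nil
  then show ?case using reaches_refl by auto
next
  case (Cons s w)
  then have s: "s \<in> set ss" "w \<in> lists (set ss)" by auto
  have 1: "reaches p (k, tape v, int (length v), g) (Within, tape (v @ [Inl s]), int (length (v @ [Inl s])), g \<otimes> s)"
    by (rule reaches_choice[of "Some (Inl s)"])
      (use s Cons.prems ls in \<open>auto simp: choice_step_def guess_trans_def tape_snoc move_pebble_def\<close>)
  have "g \<otimes> s \<in> carrier G" "g \<otimes> s \<otimes> word_val G w = g \<otimes> word_val G (s # w)"
    using s Cons.prems by (simp_all add: m_assoc)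
  then show ?case
    using reaches_trans[OF 1] Cons.IH[OF s(2), of Within "g \<otimes> s" "v @ [Inl s]"] by auto
qed

lemma guess_coding:
  "matching p cs \<Longrightarrow> reaches p (Between, \<lambda>_. tm_blank M, 0, \<one>)
    (Between, tape (encode_coding cs), int (length (encode_coding cs)), \<one>)"
proof (induction cs rule: rev_induct)
  case Nil
  have "tape (encode_coding []) = (\<lambda>_. tm_blank M)" "encode_coding [] = ([] :: ('g + 'a) list)"
    by (auto simp: tape_def encode_coding_def fun_eq_iff)
  then show ?case using reaches_refl by simp
next
  case (snoc x cs)
  obtain w a where x: "x = (w, a)" by (cases x)
  let ?v = "encode_coding cs"
  have m: "matching p cs" "w \<in> lists (set ss)" "a \<in> \<Sigma>" "p (word_val G w) = Some a"
    using snoc.prems x by (auto simp: matching_snoc)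
  obtain k where k: "k = Between \<or> k = Within"
    "reaches p (Between, tape ?v, int (length ?v), \<one>) (k, tape (?v @ map Inl w), int (length (?v @ map Inl w)), word_val G w)"
    using guess_word[OF m(2), of Between \<one> p ?v] m(2) by auto
  have "reaches p (k, tape (?v @ map Inl w), int (length (?v @ map Inl w)), word_val G w)
      (Between, tape (encode_coding (cs @ [x])), int (length (encode_coding (cs @ [x]))), \<one>)"
    by (rule reaches_choice[of "Some (Inr a)"])
      (use m k(1) x ls tape_snoc[of "?v @ map Inl w" "Inr a"] in
        \<open>auto simp: choice_step_def guess_trans_def move_pebble_def encode_coding_snoc\<close>)
  then show ?case using snoc.IH[OF m(1)] k(2) reaches_trans by blast
qed

text \<open>The beginning of the tape is recognized by the blank before it; letters are never blank.\<close>

lemma guess_rewind: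
  assumes "set v \<subseteq> set ss <+> \<Sigma>" "n \<le> length v"
  shows "reaches p (Rewinding, tape v, int n - 1, g) (Running (tm_init M), tape v, 0, \<one>)"
  using assms(2)
proof (induction n arbitrary: g)
  case 0
  show ?case
    by (rule reaches_any) (auto simp: choice_step_def guess_trans_def tape_def move_pebble_def fun_eq_iff)
next
  case (Suc n)
  have "tape v (int n) \<noteq> tm_blank M" using tape_letter_not_blank[OF assms(1)] Suc.prems by simp
  then have "reaches p (Rewinding, tape v, int (Suc n) - 1, g) (Rewinding, tape v, int n - 1, \<one>)"
    by (intro reaches_any) (auto simp: choice_step_def guess_trans_def move_pebble_def)
  then show ?case using Suc reaches_trans by (meson Suc_leD)
qed

lemma guess_complete:
  assumes cs: "matching p cs" and acc: "tm_accepts M (WP G (set ss)) (encode_coding cs)"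
  shows "\<exists>ds\<in>lists {1..length ls}. \<exists>q\<in>tm_final M. fst (choice_run guess_trans Between (tm_blank M) p ds) = Running q"
proof -
  let ?v = "encode_coding cs"
  have letters: "set ?v \<subseteq> set ss <+> \<Sigma>" using cs encode_coding_letters by (simp add: matching_def)
  have "reaches p (Between, tape ?v, int (length ?v), \<one>) (Rewinding, tape ?v, int (length ?v) - 1, \<one>)"
    by (rule reaches_choice[of None]) (use ls in \<open>auto simp: choice_step_def guess_trans_def move_pebble_def\<close>)
  then have start: "reaches p (Between, \<lambda>_. tm_blank M, 0, \<one>) (Running (tm_init M), tape ?v, 0, \<one>)"
    using guess_coding[OF cs] guess_rewind[OF letters order_refl] reaches_trans by blast
  have run: "case (tm_step M (WP G (set ss)) ^^ n) (tm_start M ?v) of (q, t, h, u) \<Rightarrow>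
      reaches p (Between, \<lambda>_. tm_blank M, 0, \<one>) (Running q, t, h, word_val G u)" for n
  proof (induction n)
    case 0
    then show ?case using start by (simp add: tm_start_eq)
  next
    case (Suc n)
    obtain q t h u where c: "(tm_step M (WP G (set ss)) ^^ n) (tm_start M ?v) = (q, t, h, u)" by (metis prod_cases4)
    obtain q' t' h' u' where s: "tm_step M (WP G (set ss)) (q, t, h, u) = (q', t', h', u')" by (metis prod_cases4)
    have "u \<in> lists (set ss)" "q \<in> tm_states M" "t h \<in> tm_alphabet M"
      using tm_run_closed[OF letters, where A = "WP G (set ss)" and n = n] c by auto
    from reaches_any[OF guess_running_step[OF this s]]
    have "reaches p (Running q, t, h, word_val G u) (Running q', t', h', word_val G u')" .
    moreover have "reaches p (Between, \<lambda>_. tm_blank M, 0, \<one>) (Running q, t, h, word_val G u)" using Suc c by simp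
    ultimately have "reaches p (Between, \<lambda>_. tm_blank M, 0, \<one>) (Running q', t', h', word_val G u')"
      using reaches_trans by blast
    moreover have "(tm_step M (WP G (set ss)) ^^ Suc n) (tm_start M ?v) = (q', t', h', u')"
      using c s by simp
    ultimately show ?case by (simp only: prod.case)
  qed
  obtain n where n: "fst ((tm_step M (WP G (set ss)) ^^ n) (tm_start M ?v)) \<in> tm_final M"
    using acc unfolding tm_accepts_def by blast
  obtain q t h u where c: "(tm_step M (WP G (set ss)) ^^ n) (tm_start M ?v) = (q, t, h, u)" by (metis prod_cases4)
  have "reaches p (Between, \<lambda>_. tm_blank M, 0, \<one>) (Running q, t, h, word_val G u)" using run[of n] c by simp
  then obtain ds where "ds \<in> lists {1..length ls}"
      "choice_run guess_trans Between (tm_blank M) p ds = (Running q, t, h, word_val G u)"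
    unfolding reaches_def choice_run_def by blast
  then show ?thesis using n c by (intro bexI[of _ ds] bexI[of _ q]) auto
qed

lemma guesser_machine_exists:
  assumes "finite \<Sigma>"
  shows "\<exists>T :: ('g, 'a) g_machine. g_machine (set ss) \<Sigma> T \<and> (\<forall>p\<in>patterns G \<Sigma>. gm_accepts G T p \<longleftrightarrow>
    (\<exists>cs. matching p cs \<and> tm_accepts M (WP G (set ss)) (encode_coding cs)))"
proof -
  define Q where "Q = {Between, Within, Rewinding, Rejected} \<union> Running ` tm_states M"
  have tm: "finite (tm_states M)" "finite (tm_alphabet M)" "tm_blank M \<in> tm_alphabet M"
    "tm_init M \<in> tm_states M" "tm_yes M \<in> tm_states M" "tm_no M \<in> tm_states M"
    "Inl ` (set ss <+> \<Sigma>) \<subseteq> tm_alphabet M"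
    using M unfolding oracle_tm_def by simp_all
  have Q: "finite Q" "Between \<in> Q" using tm by (simp_all add: Q_def)
  have len: "0 < length ls" using ls by (cases ls) auto
  have closed: "guess_trans c k y hm po \<in> Q \<times> tm_alphabet M \<times> UNIV \<times> opt_of (set ss)"
    if c: "c \<in> {1..length ls}" and k: "k \<in> Q" and y: "y \<in> tm_alphabet M" for c k y hm po
  proof -
    have "ls ! (c - 1) \<in> set ls" using c by (intro nth_mem) auto
    then have l: "ls ! (c - 1) \<in> insert None (Some ` (set ss <+> \<Sigma>))" unfolding ls .
    have alph: "\<And>s. s \<in> set ss \<Longrightarrow> Inl (Inl s) \<in> tm_alphabet M" "\<And>a. a \<in> \<Sigma> \<Longrightarrow> Inl (Inr a) \<in> tm_alphabet M"
      using tm(7) by auto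
    have none: "None \<in> opt_of (set ss)" "\<And>s. s \<in> set ss \<Longrightarrow> Some s \<in> opt_of (set ss)" by (auto simp: opt_of_def)
    show ?thesis
    proof (cases k)
      case (Running q)
      then have q: "q \<in> tm_states M" using k by (auto simp: Q_def)
      obtain z r d e where tr: "tm_trans M (y, q) = (z, r, d, e)" by (metis prod_cases4)
      have "z \<in> tm_alphabet M" "r \<in> tm_states M" "set_option e \<subseteq> set ss"
        using M q y tr unfolding oracle_tm_def by fastforce+
      then show ?thesis using Running tr tm y none one_gen
        by (auto simp: guess_trans_def Q_def split: option.splits)
    qed (use l tm y none alph in \<open>auto simp: guess_trans_def Q_def split: option.splits sum.splits\<close>)
  qed
  have "\<exists>T :: ('g, 'a) g_machine. g_machine (set ss) \<Sigma> T \<and> (\<forall>p\<in>patterns G \<Sigma>. gm_accepts G T p \<longleftrightarrow>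
      (\<exists>ds\<in>lists {1..length ls}. fst (choice_run guess_trans Between (tm_blank M) p ds) \<in> Running ` tm_final M))"
    by (rule choice_machine_exists[OF assms Q(1) tm(2) Q(2) tm(3) len]) (rule closed)
  then obtain T :: "('g, 'a) g_machine" where T: "g_machine (set ss) \<Sigma> T"
    "\<forall>p\<in>patterns G \<Sigma>. gm_accepts G T p \<longleftrightarrow>
       (\<exists>ds\<in>lists {1..length ls}. fst (choice_run guess_trans Between (tm_blank M) p ds) \<in> Running ` tm_final M)"
    by blast
  have "(\<exists>ds\<in>lists {1..length ls}. fst (choice_run guess_trans Between (tm_blank M) p ds) \<in> Running ` tm_final M) \<longleftrightarrow>
      (\<exists>cs. matching p cs \<and> tm_accepts M (WP G (set ss)) (encode_coding cs))" for p
  proof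
    assume "\<exists>ds\<in>lists {1..length ls}. fst (choice_run guess_trans Between (tm_blank M) p ds) \<in> Running ` tm_final M"
    then show "\<exists>cs. matching p cs \<and> tm_accepts M (WP G (set ss)) (encode_coding cs)" using guess_sound by blast
  next
    assume "\<exists>cs. matching p cs \<and> tm_accepts M (WP G (set ss)) (encode_coding cs)"
    then show "\<exists>ds\<in>lists {1..length ls}. fst (choice_run guess_trans Between (tm_blank M) p ds) \<in> Running ` tm_final M"
      using guess_complete by (metis imageI)
  qed
  then show ?thesis using T by auto
qed

end

theorem theorem3p4:
  fixes G :: "('g, 'm) monoid_scheme"
    and S :: "'g set"
    and \<Sigma> :: "'a set"
    and C :: "('g list \<times> 'a) set set"
  assumes "group G"
    and "infinite (carrier G)"
    and "finite S"
    and "S \<subseteq> carrier G"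
    and "generate G S = carrier G"
    and "\<one>\<^bsub>G\<^esub> \<in> S"
    and "\<forall>s\<in>S. inv\<^bsub>G\<^esub> s \<in> S"
    and "finite \<Sigma>"
    and "C \<subseteq> pattern_codings S \<Sigma>"
    and "re_with_oracle S \<Sigma> (WP G S) C"
    and "closed_by_extensions G \<Sigma> (patterns_of G C)"
  shows "G_recursively_enumerable G S \<Sigma> (patterns_of G C)"
proof -
  interpret group G by fact
  obtain ss where ss: "set ss = S" using finite_list[OF \<open>finite S\<close>] by blast
  interpret infinite_fg_group G ss
    using assms(2,4-7) ss by unfold_locales auto
  obtain M :: "('g + 'a, 'g) oracle_tm" where tm: "oracle_tm (S <+> \<Sigma>) S M"
    "\<And>cs. cs \<in> lists (lists S \<times> \<Sigma>) \<Longrightarrow> tm_accepts M (WP G S) (encode_coding cs) \<longleftrightarrow> set cs \<in> C"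
    using assms(10) unfolding re_with_oracle_def by blast
  have "finite (insert None (Some ` (S <+> \<Sigma>)))" using assms(3,8) by simp
  then obtain ls where ls: "set ls = insert None (Some ` (S <+> \<Sigma>))" using finite_list by blast
  interpret coding_guesser G ss M \<Sigma> ls
    using tm(1) ls ss by unfold_locales auto
  obtain T :: "('g, 'a) g_machine" where T: "g_machine S \<Sigma> T"
    "\<And>p. p \<in> patterns G \<Sigma> \<Longrightarrow> gm_accepts G T p \<longleftrightarrow>
       (\<exists>cs. matching p cs \<and> tm_accepts M (WP G S) (encode_coding cs))"
    using guesser_machine_exists[OF assms(8)] ss by auto
  have "(\<exists>cs. matching p cs \<and> tm_accepts M (WP G S) (encode_coding cs)) \<longleftrightarrow>
      (\<exists>c\<in>C. \<forall>(w, a)\<in>c. p (word_val G w) = Some a)" for p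
  proof
    assume "\<exists>cs. matching p cs \<and> tm_accepts M (WP G S) (encode_coding cs)"
    then show "\<exists>c\<in>C. \<forall>(w, a)\<in>c. p (word_val G w) = Some a"
      using tm(2) ss unfolding matching_def by blast
  next
    assume "\<exists>c\<in>C. \<forall>(w, a)\<in>c. p (word_val G w) = Some a"
    then obtain c where c: "c \<in> C" "\<forall>(w, a)\<in>c. p (word_val G w) = Some a" by blast
    then have fin: "finite c" and sub: "c \<subseteq> lists S \<times> \<Sigma>" using assms(9) by (auto simp: pattern_codings_def)
    obtain cs where cs: "set cs = c" using finite_list[OF fin] by blast
    then have l: "cs \<in> lists (lists S \<times> \<Sigma>)" using sub by (auto simp: in_lists_conv_set)
    then have "tm_accepts M (WP G S) (encode_coding cs)" using tm(2) c(1) cs by simp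
    moreover have "matching p cs" using l c(2) cs ss by (simp add: matching_def)
    ultimately show "\<exists>cs. matching p cs \<and> tm_accepts M (WP G S) (encode_coding cs)" by blast
  qed
  then have "\<forall>p\<in>patterns G \<Sigma>. gm_accepts G T p \<longleftrightarrow> p \<in> patterns_of G C"
    using T(2) patterns_of_iff[OF assms(4,9,11)] by simp
  moreover have "patterns_of G C \<subseteq> patterns G \<Sigma>"
    using pattern_of_patterns[OF _ assms(4)] assms(9) by (auto simp: patterns_of_def)
  ultimately show ?thesis
    using T(1) unfolding G_recursively_enumerable_def by blast
qed

end
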